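(* Let $d\ge1$ be an integer and let $(X_n)_{n\in\mathbb{N}}$ be a sequence of zero-mean Gaussian random fields on $\mathbb{R}^d$ whose covariance functions $C_n(x,y)=C_n(x-y)$ satisfy $$\left|\widehat{C}_n(\xi)\right|\le\frac{c}{1+|\xi|^{2s}},\qquad \xi\in\mathbb{R}^d,$$ for some constants $c>0$, $s>(d+1)/2$ and for all $n$. If $$\lim_{n\to\infty}C_n(x,y)=C(x,y)\qquad\text{for all }x,y\in\mathbb{R}^d,$$ then the distributions of $X_n$ converge weakly on $C(\mathbb{R}^d)$ to the distribution of the zero-mean Gaussian random field $X$ whose covariance function is $C(x,y)$.
   Context: Random fields are real-valued. $\widehat{C}_n$ denotes the spectrum (Fourier transform) of the stationary covariance function, with the convention $$C_n(x)=\frac{1}{(2\pi)^d}\int_{\mathbb{R}^d}\exp(-i\,x\cdot\xi)\,\widehat{C}_n(\xi)\,d\xi,\qquad x\in\mathbb{R}^d .$$ $C(\mathbb{R}^d)$ is the space of continuous functions on $\mathbb{R}^d$ with its usual metrizable topology of uniform convergence on compact sets, given by the seminorms $|f|_k=\sup_{x\in K_k}|f(x)|$, where $K_k\subset\mathbb{R}^d$ are compact sets with union $\mathbb{R}^d$ (e.g. $K_k$ the closed ball of radius $k$ about $0$). The fields are identified with their versions having continuous sample paths, so that their distributions are Borel probability measures on $C(\mathbb{R}^d)$. Weak convergence is convergence of expectations of all bounded continuous functions on $C(\mathbb{R}^d)$. *)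

theory Defs
  imports "HOL-Probability.Probability"
begin

definition ball_seminorm :: "nat \<Rightarrow> ('a::euclidean_space \<Rightarrow> real) \<Rightarrow> real" where
  "ball_seminorm k f = (SUP x\<in>cball 0 (real k). \<bar>f x\<bar>)"

text \<open>The points of the space are the functions that are continuous on the whole space
  (lemma \<open>topspace_C_topology\<close> below).\<close>

definition C_topology :: "('a::euclidean_space \<Rightarrow> real) topology" where
  "C_topology = topology_generated_by
     {{g. continuous_on UNIV g \<and> ball_seminorm k (\<lambda>x. g x - f x) < e} | f k e.
        continuous_on UNIV f \<and> e > 0}"

lemma topspace_C_topology:
  "topspace (C_topology :: ('a::euclidean_space \<Rightarrow> real) topology) = {f. continuous_on UNIV f}"
proof (rule set_eqI)
  fix g :: "'a \<Rightarrow> real"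
  have "\<exists>f k e. continuous_on UNIV f \<and> (e::real) > 0 \<and> ball_seminorm k (\<lambda>x. g x - f x) < e"
    if "continuous_on UNIV g"
    by (rule exI[of _ g], rule exI[of _ 0], rule exI[of _ 1])
       (use that in \<open>simp add: ball_seminorm_def\<close>)
  then show "g \<in> topspace C_topology \<longleftrightarrow> g \<in> {f. continuous_on UNIV f}"
    unfolding C_topology_def topology_generated_by_topspace Union_iff by auto
qed

definition borel_of_topology :: "'b topology \<Rightarrow> 'b measure" where
  "borel_of_topology T = sigma (topspace T) {U. openin T U}"

definition weakly_converges ::
    "'b topology \<Rightarrow> (nat \<Rightarrow> 'b measure) \<Rightarrow> 'b measure \<Rightarrow> bool" where
  "weakly_converges T \<mu> \<nu> \<longleftrightarrow>
     (\<forall>n. prob_space (\<mu> n) \<and> sets (\<mu> n) = sets (borel_of_topology T)) \<and>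
     prob_space \<nu> \<and> sets \<nu> = sets (borel_of_topology T) \<and>
     (\<forall>\<phi>. continuous_map T euclideanreal \<phi> \<and> bounded (\<phi> ` topspace T) \<longrightarrow>
        (\<lambda>n. integral\<^sup>L (\<mu> n) \<phi>) \<longlonglongrightarrow> integral\<^sup>L \<nu> \<phi>)"

text \<open>Constants count as (degenerate) Gaussian random variables.\<close>

definition gaussian_rv :: "'w measure \<Rightarrow> ('w \<Rightarrow> real) \<Rightarrow> bool" where
  "gaussian_rv M Z \<longleftrightarrow> Z \<in> borel_measurable M \<and>
     ((\<exists>m. AE \<omega> in M. Z \<omega> = m) \<or>
      (\<exists>m \<sigma>. \<sigma> > 0 \<and> distributed M lborel Z (normal_density m \<sigma>)))"

text \<open>The finite-dimensional distributions are jointly Gaussian, i.e. all finite linear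
  combinations of the values of the field are Gaussian.\<close>

definition gaussian_field :: "'w measure \<Rightarrow> ('t \<Rightarrow> 'w \<Rightarrow> real) \<Rightarrow> bool" where
  "gaussian_field M X \<longleftrightarrow> prob_space M \<and>
     (\<forall>F a. finite F \<longrightarrow> gaussian_rv M (\<lambda>\<omega>. \<Sum>x\<in>F. a x * X x \<omega>))"

definition mean_function :: "'w measure \<Rightarrow> ('t \<Rightarrow> 'w \<Rightarrow> real) \<Rightarrow> 't \<Rightarrow> real" where
  "mean_function M X x = integral\<^sup>L M (X x)"

definition covariance_function ::
    "'w measure \<Rightarrow> ('t \<Rightarrow> 'w \<Rightarrow> real) \<Rightarrow> 't \<Rightarrow> 't \<Rightarrow> real" where
  "covariance_function M X x y =
     integral\<^sup>L M (\<lambda>\<omega>. (X x \<omega> - mean_function M X x) * (X y \<omega> - mean_function M X y))"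

definition centered_gaussian_field ::
    "'w measure \<Rightarrow> ('t \<Rightarrow> 'w \<Rightarrow> real) \<Rightarrow> ('t \<Rightarrow> 't \<Rightarrow> real) \<Rightarrow> bool" where
  "centered_gaussian_field M X K \<longleftrightarrow> gaussian_field M X \<and>
     (\<forall>x. mean_function M X x = 0) \<and> (\<forall>x y. covariance_function M X x y = K x y)"

definition continuous_version ::
    "'w measure \<Rightarrow> ('a::euclidean_space \<Rightarrow> 'w \<Rightarrow> real) \<Rightarrow> ('a \<Rightarrow> 'w \<Rightarrow> real) \<Rightarrow> bool" where
  "continuous_version M X Y \<longleftrightarrow>
     (\<forall>x. Y x \<in> borel_measurable M) \<and>
     (\<forall>x. AE \<omega> in M. Y x \<omega> = X x \<omega>) \<and>
     (\<forall>\<omega>\<in>space M. continuous_on UNIV (\<lambda>x. Y x \<omega>))"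

definition field_distribution ::
    "'w measure \<Rightarrow> ('a::euclidean_space \<Rightarrow> 'w \<Rightarrow> real) \<Rightarrow> ('a \<Rightarrow> real) measure" where
  "field_distribution M Y = distr M (borel_of_topology C_topology) (\<lambda>\<omega> x. Y x \<omega>)"

text \<open>The Borel probability measures on the space of continuous functions that are the
  distribution of a continuous zero-mean Gaussian field with covariance function \<open>K\<close>,
  expressed through the coordinate field \<open>(x, f) \<mapsto> f x\<close>.\<close>

definition centered_gaussian_law ::
    "('a::euclidean_space \<Rightarrow> real) measure \<Rightarrow> ('a \<Rightarrow> 'a \<Rightarrow> real) \<Rightarrow> bool" where
  "centered_gaussian_law \<mu> K \<longleftrightarrow>
     sets \<mu> = sets (borel_of_topology C_topology) \<and>
     centered_gaussian_field \<mu> (\<lambda>x f. f x) K"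

definition has_spectrum ::
    "('a::euclidean_space \<Rightarrow> real) \<Rightarrow> ('a \<Rightarrow> complex) \<Rightarrow> bool" where
  "has_spectrum K S \<longleftrightarrow> integrable lborel S \<and>
     (\<forall>x. complex_of_real (K x) =
        1 / (2 * of_real pi) ^ DIM('a) *
          (LINT \<xi>|lborel. exp (- (\<i> * of_real (x \<bullet> \<xi>))) * S \<xi>))"

end

theory Submission
  imports Defs
begin

text \<open>The spectra enter through one estimate only. Since \<open>2 * s > d + 1\<close>, the function \<open>\<bar>\<xi>\<bar>\<close> is
  integrable against the common bound of the spectra, so the covariance functions satisfy
  \<open>\<bar>C\<^sub>n h - C\<^sub>n h'\<bar> \<le> B \<bar>h - h'\<bar>\<close> with the same \<open>B\<close> for all \<open>n\<close>
  (\<open>spectral_decay_imp_uniform_Lipschitz\<close>). An increment \<open>X\<^sub>n x - X\<^sub>n y\<close> is therefore normal of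
  variance at most \<open>2 B \<bar>x - y\<bar>\<close>, and its moment of order \<open>2 (d + 1)\<close> is at most a constant times
  \<open>\<bar>x - y\<bar>\<close> to the power \<open>d + 1\<close>. Chaining along dyadic grids, the method of Kolmogorov, turns this
  into continuous versions (\<open>gaussian_continuous_version\<close>) and into a modulus of continuity on
  compact sets that holds outside an event of small probability, uniformly in \<open>n\<close>
  (\<open>prob_not_dyadic_regular\<close>). The latter is the tightness of the sequence.

  A Borel probability measure on the space of continuous functions is determined by its
  finite-dimensional distributions, and those of a centred Gaussian field by its covariance
  function (\<open>gaussian_law_unique\<close>). So the convergence of the laws may be proved for any
  realisation of the fields. All of them are put on one space carrying a sequence of independent
  standard normal variables: the values at the dyadic points are finite linear combinations of these
  variables, with the Cholesky factor of the covariance as coefficients. The entries of the factors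
  stay bounded, so they converge along a subsequence, and the limit is a factor of \<open>C\<close>. Along this
  subsequence the fields converge at every dyadic point for every outcome. With the uniform modulus of
  continuity, the convergence is uniform on compact sets in probability, hence almost surely along a
  further subsequence, and dominated convergence gives the convergence of the expectations of bounded
  continuous functions (\<open>gaussian_laws_convergent_subseq\<close>).

  The limit field provides the Gaussian law with covariance function \<open>C\<close>. Because this law is unique,
  every subsequence has a further subsequence along which the expectations converge to the same
  limit, which is the convergence of the whole sequence.\<close>

section \<open>Covariance functions with decaying spectrum\<close>

lemma nn_integral_power_decay_finite:
  fixes q :: real
  assumes "q > 1"
  shows "(\<integral>\<^sup>+x. ennreal ((1 + \<bar>x\<bar>) powr (- q)) \<partial>lborel) < \<infinity>"
proof -
  define I where "I = (\<integral>\<^sup>+x. ennreal ((1 + x) powr (- q)) * indicator {0..} x \<partial>lborel)"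
  have tends: "((\<lambda>x. - ((1 + x) powr (1 - q)) / (q - 1)) \<longlongrightarrow> 0 / (q - 1)) at_top"
    using assms
    by (intro tendsto_divide tendsto_minus[where a = 0, simplified] tendsto_neg_powr
          filterlim_tendsto_add_at_top[OF tendsto_const] filterlim_ident tendsto_const) auto
  have deriv: "((\<lambda>x. - ((1 + x) powr (1 - q)) / (q - 1)) has_real_derivative (1 + x) powr (- q)) (at x)"
    if "0 \<le> x" for x :: real
  proof -
    have "((\<lambda>x. (1 + x) powr (1 - q)) has_real_derivative
        (1 - q) * (1 + x) powr (1 - q - 1) * 1) (at x)"
      using that DERIV_fun_powr[of "\<lambda>x. 1 + x" 1 x "1 - q"]
      by (auto intro!: derivative_eq_intros)
    from DERIV_cdivide[OF DERIV_minus[OF this], of "q - 1"] show ?thesis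
      by (rule DERIV_cong) (use assms in \<open>simp add: field_simps\<close>)
  qed
  have "I = ennreal (0 / (q - 1) - (- ((1 + 0) powr (1 - q)) / (q - 1)))"
    unfolding I_def by (intro nn_integral_FTC_atLeast tends deriv) auto
  then have fin: "I < \<infinity>" by simp
  have refl: "I = (\<integral>\<^sup>+x. ennreal ((1 - x) powr (- q)) * indicator {0..} (- x) \<partial>lborel)"
    unfolding I_def by (subst nn_integral_real_affine[where c = "-1" and t = 0]) simp_all
  have "(\<integral>\<^sup>+x. ennreal ((1 + \<bar>x\<bar>) powr (- q)) \<partial>lborel)
      \<le> (\<integral>\<^sup>+x. ennreal ((1 + x) powr (- q)) * indicator {0..} x
             + ennreal ((1 - x) powr (- q)) * indicator {0..} (- x) \<partial>lborel)"
    by (intro nn_integral_mono) (auto simp: indicator_def)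
  also have "\<dots> = I + I"
    by (subst nn_integral_add) (simp_all add: I_def[symmetric] refl[symmetric])
  also have "\<dots> < \<infinity>" using fin by (simp add: less_top[symmetric])
  finally show ?thesis .
qed

text \<open>A radial weight of order \<open>r > d\<close> is dominated by a product of one-dimensional weights of
  order \<open>r / d > 1\<close>, because every coordinate is bounded by the norm. This replaces integration
  in polar coordinates.\<close>

lemma integrable_norm_powr_decay:
  assumes r: "r > real DIM('a)"
  shows "integrable lborel (\<lambda>\<xi>::'a::euclidean_space. (1 + norm \<xi>) powr (- r))"
proof (rule integrableI_bounded)
  define q where "q = r / real DIM('a)"
  have q: "q > 1" using r by (simp add: q_def)
  have dom: "(1 + norm \<xi>) powr (- r) \<le> (\<Prod>b\<in>Basis. (1 + \<bar>\<xi> \<bullet> b\<bar>) powr (- q))" for \<xi> :: 'a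
  proof -
    have "(1 + norm \<xi>) powr (- r) = ((1 + norm \<xi>) powr (- q)) ^ DIM('a)"
      by (subst powr_power) (auto simp: q_def add_nonneg_eq_0_iff)
    also have "\<dots> = (\<Prod>b\<in>(Basis :: 'a set). (1 + norm \<xi>) powr (- q))" by simp
    also have "\<dots> \<le> (\<Prod>b\<in>Basis. (1 + \<bar>\<xi> \<bullet> b\<bar>) powr (- q))"
      using q by (intro prod_mono conjI powr_mono2') (auto intro: Basis_le_norm)
    finally show ?thesis .
  qed
  have "(\<integral>\<^sup>+\<xi>. ennreal (norm ((1 + norm (\<xi>::'a)) powr (- r))) \<partial>lborel)
      \<le> (\<integral>\<^sup>+\<xi>. (\<Prod>b\<in>(Basis :: 'a set). ennreal ((1 + \<bar>\<xi> \<bullet> b\<bar>) powr (- q))) \<partial>lborel)"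
    using dom by (intro nn_integral_mono) (auto simp: prod_ennreal intro!: ennreal_leI)
  also have "\<dots> = (\<Prod>b\<in>(Basis :: 'a set). \<integral>\<^sup>+x. ennreal ((1 + \<bar>x\<bar>) powr (- q)) \<partial>lborel)"
    by (subst nn_integral_lborel_prod) auto
  also have "\<dots> < \<infinity>"
    using nn_integral_power_decay_finite[OF q]
    by (simp add: power_less_top_ennreal)
  finally show "(\<integral>\<^sup>+\<xi>. ennreal (norm ((1 + norm (\<xi>::'a)) powr (- r))) \<partial>lborel) < \<infinity>" .
qed simp

lemma integrable_norm_times_decay:
  assumes p: "p > real DIM('a) + 1"
  shows "integrable lborel (\<lambda>\<xi>::'a::euclidean_space. norm \<xi> / (1 + norm \<xi> powr p))"
proof (rule Bochner_Integration.integrable_bound)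
  show "integrable lborel (\<lambda>\<xi>::'a. 2 powr p * (1 + norm \<xi>) powr (- (p - 1)))"
    using p by (intro integrable_mult_right integrable_norm_powr_decay) auto
  have "norm \<xi> / (1 + norm \<xi> powr p) \<le> 2 powr p * (1 + norm \<xi>) powr (- (p - 1))" for \<xi> :: 'a
  proof -
    define t where "t = norm \<xi>"
    have t: "t \<ge> 0" by (simp add: t_def)
    have p0: "p \<ge> 0" using p by (simp add: add_nonneg_nonneg order.trans[OF _ less_imp_le[OF p]])
    have "(1 + t) powr p \<le> (2 * max 1 t) powr p"
      using t p0 by (intro powr_mono2) auto
    also have "\<dots> = 2 powr p * (max 1 t) powr p" by (simp add: powr_mult)
    also have "\<dots> \<le> 2 powr p * (1 + t powr p)"
      by (intro mult_left_mono) (auto simp: max_def)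
    finally have "(1 + t) powr p \<le> 2 powr p * (1 + t powr p)" .
    moreover have "t * (1 + t) powr (p - 1) \<le> (1 + t) powr p"
      using t by (simp add: powr_diff divide_le_eq mult_left_mono algebra_simps)
    ultimately have "t * (1 + t) powr (p - 1) \<le> 2 powr p * (1 + t powr p)" by linarith
    moreover have "1 + t powr p > 0" by (simp add: add_pos_nonneg)
    moreover define w where "w = (1 + t) powr (p - 1)"
    moreover have "(1 + t) powr (- (p - 1)) = 1 / w" unfolding w_def by (rule powr_minus_divide)
    moreover have "w > 0" using t by (simp add: w_def)
    ultimately show ?thesis unfolding t_def[symmetric] by (simp add: divide_le_eq le_divide_eq mult_ac)
  qed
  then show "AE \<xi> in lborel. norm (norm (\<xi>::'a) / (1 + norm \<xi> powr p))
      \<le> norm (2 powr p * (1 + norm \<xi>) powr (- (p - 1)))"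
    by (auto simp: abs_of_nonneg add_nonneg_nonneg)
qed simp

text \<open>A decay exponent \<open>p > d + 1\<close> makes \<open>\<bar>\<xi>\<bar>\<close> integrable against the spectrum, and the
  modulus of \<open>exp (- \<i> h \<xi>) - exp (- \<i> h' \<xi>)\<close> is at most \<open>\<bar>h - h'\<bar> \<bar>\<xi>\<bar>\<close>. The constant depends on
  the bound only, not on the individual spectrum.\<close>

lemma spectral_decay_imp_uniform_Lipschitz:
  fixes K :: "nat \<Rightarrow> 'a::euclidean_space \<Rightarrow> real"
  assumes spectrum: "\<And>n. has_spectrum (K n) (S n)"
    and p: "p > real DIM('a) + 1"
    and bound: "\<And>n \<xi>. cmod (S n \<xi>) \<le> c / (1 + norm \<xi> powr p)"
  obtains B where "B \<ge> 0" "\<And>n h h'. \<bar>K n h - K n h'\<bar> \<le> B * norm (h - h')"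
proof -
  define W where "W \<xi> = norm \<xi> / (1 + norm \<xi> powr p)" for \<xi> :: 'a
  define B where "B = 1 / (2 * pi) ^ DIM('a) * (\<bar>c\<bar> * (LINT \<xi>|lborel. W \<xi>))"
  have W: "integrable lborel W" unfolding W_def by (rule integrable_norm_times_decay[OF p])
  have W0: "W \<xi> \<ge> 0" for \<xi> by (simp add: W_def add_nonneg_nonneg)
  have B0: "B \<ge> 0" unfolding B_def using W0 by (intro mult_nonneg_nonneg integral_nonneg_AE) auto
  have lip: "\<bar>K n h - K n h'\<bar> \<le> B * norm (h - h')" for n h h'
  proof -
    define E where "E h \<xi> = exp (- (\<i> * of_real (h \<bullet> \<xi>)))" for h \<xi> :: 'a
    have normE: "cmod (E h \<xi>) = 1" for h \<xi> unfolding E_def by simp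
    have S: "integrable lborel (S n)" using spectrum by (simp add: has_spectrum_def)
    have meas: "E h \<in> borel_measurable borel" for h
      unfolding E_def by (intro borel_measurable_continuous_onI continuous_intros)
    have ES: "integrable lborel (\<lambda>\<xi>. E h \<xi> * S n \<xi>)" for h
      using meas S by (intro Bochner_Integration.integrable_bound[OF S])
        (auto simp: normE norm_mult)
    have diff: "cmod (E h \<xi> - E h' \<xi>) \<le> norm (h - h') * norm \<xi>" for \<xi>
    proof -
      have "E h \<xi> - E h' \<xi> = cis (- (h \<bullet> \<xi>)) - cis (- (h' \<bullet> \<xi>))"
        by (simp add: E_def cis_conv_exp)
      also have "\<dots> = cis (- (h' \<bullet> \<xi>)) * (cis (- ((h - h') \<bullet> \<xi>)) - 1)"
        by (simp add: algebra_simps cis_mult inner_diff_left)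
      finally have "cmod (E h \<xi> - E h' \<xi>) = cmod (iexp (- ((h - h') \<bullet> \<xi>)) - 1)"
        by (simp add: norm_mult cis_conv_exp)
      also have "\<dots> \<le> \<bar>- ((h - h') \<bullet> \<xi>)\<bar>"
        using iexp_approx1[of "- ((h - h') \<bullet> \<xi>)" 0] by simp
      also have "\<dots> \<le> norm (h - h') * norm \<xi>" by (simp add: Cauchy_Schwarz_ineq2)
      finally show ?thesis .
    qed
    have "complex_of_real (K n h - K n h') =
        1 / (2 * of_real pi) ^ DIM('a) * (LINT \<xi>|lborel. E h \<xi> * S n \<xi> - E h' \<xi> * S n \<xi>)"
      using spectrum[of n] ES
      by (simp add: has_spectrum_def E_def algebra_simps)
    then have "cmod (complex_of_real (K n h - K n h')) =
        cmod (1 / (2 * of_real pi) ^ DIM('a) * (LINT \<xi>|lborel. E h \<xi> * S n \<xi> - E h' \<xi> * S n \<xi>))"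
      by (rule arg_cong)
    then have "\<bar>K n h - K n h'\<bar> =
        1 / (2 * pi) ^ DIM('a) * cmod (LINT \<xi>|lborel. E h \<xi> * S n \<xi> - E h' \<xi> * S n \<xi>)"
      by (simp only: norm_mult norm_divide norm_of_real norm_power norm_one norm_numeral) simp
    also have "\<dots> \<le> 1 / (2 * pi) ^ DIM('a) * (LINT \<xi>|lborel. (\<bar>c\<bar> * norm (h - h')) * W \<xi>)"
    proof (rule mult_left_mono[OF order_trans[OF integral_norm_bound integral_mono]])
      fix \<xi>
      have "cmod (S n \<xi>) \<le> \<bar>c\<bar> / (1 + norm \<xi> powr p)"
        by (rule order_trans[OF bound divide_right_mono]) (auto intro: add_nonneg_nonneg)
      then have "cmod (E h \<xi> - E h' \<xi>) * cmod (S n \<xi>)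
          \<le> (norm (h - h') * norm \<xi>) * (\<bar>c\<bar> / (1 + norm \<xi> powr p))"
        by (intro mult_mono diff) auto
      then show "cmod (E h \<xi> * S n \<xi> - E h' \<xi> * S n \<xi>) \<le> (\<bar>c\<bar> * norm (h - h')) * W \<xi>"
        by (simp add: left_diff_distrib[symmetric] norm_mult W_def mult_ac)
    qed (use ES W in auto)
    also have "\<dots> = B * norm (h - h')" by (simp add: B_def)
    finally show ?thesis .
  qed
  show thesis by (rule that[OF B0 lip])
qed

section \<open>Characteristic functions of Gaussian fields\<close>

text \<open>The centred normal law of variance \<open>v\<close> is described through its characteristic function,
  so that \<open>v = 0\<close> needs no separate treatment and limits of variances pass to the laws.\<close>

definition centered_normal :: "'w measure \<Rightarrow> ('w \<Rightarrow> real) \<Rightarrow> real \<Rightarrow> bool" where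
  "centered_normal M Z v \<longleftrightarrow> Z \<in> borel_measurable M \<and>
     (\<forall>t. (CLINT \<omega>|M. iexp (t * Z \<omega>)) = of_real (exp (- v * t\<^sup>2 / 2)))"

lemma centered_normal_var_nonneg:
  assumes "prob_space M" "centered_normal M Z v"
  shows "v \<ge> 0"
proof -
  interpret prob_space M by fact
  have "exp (- v * 1\<^sup>2 / 2) = cmod (CLINT \<omega>|M. iexp (1 * Z \<omega>))"
    using assms(2) unfolding centered_normal_def
    by (metis norm_of_real abs_exp_cancel)
  also have "\<dots> \<le> (LINT \<omega>|M. 1)"
    by (rule order_trans[OF integral_norm_bound]) simp
  also have "\<dots> = 1" by (simp add: prob_space)
  finally show ?thesis by simp
qed

lemma centered_normal_distr:
  assumes "prob_space M" "centered_normal M Z v"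
  shows "distr M borel Z = distr std_normal_distribution borel (\<lambda>x. sqrt v * x)"
proof (rule Levy_uniqueness)
  interpret prob_space M by fact
  interpret N: real_distribution std_normal_distribution by (rule real_dist_normal_dist)
  have [measurable]: "Z \<in> borel_measurable M" using assms(2) by (simp add: centered_normal_def)
  show "real_distribution (distr M borel Z)" by (rule real_distribution_distr) measurable
  show "real_distribution (distr std_normal_distribution borel (\<lambda>x. sqrt v * x))"
    by (rule N.real_distribution_distr) measurable
  show "char (distr M borel Z) = char (distr std_normal_distribution borel (\<lambda>x. sqrt v * x))"
  proof
    fix t
    have "char (distr std_normal_distribution borel (\<lambda>x. sqrt v * x)) t
        = char std_normal_distribution (t * sqrt v)"
      by (simp add: char_def integral_distr mult_ac)
    also have "\<dots> = of_real (exp (- v * t\<^sup>2 / 2))"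
      using centered_normal_var_nonneg[OF assms]
      by (simp add: char_std_normal_distribution power_mult_distrib mult_ac)
    finally show "char (distr M borel Z) t = char (distr std_normal_distribution borel (\<lambda>x. sqrt v * x)) t"
      using assms(2) by (simp add: char_def integral_distr centered_normal_def)
  qed
qed

lemma centered_normal_moment:
  assumes "prob_space M" "centered_normal M Z v"
  shows "integrable M (\<lambda>\<omega>. Z \<omega> ^ k)"
    and "(LINT \<omega>|M. Z \<omega> ^ k) = sqrt v ^ k * (LINT x|std_normal_distribution. x ^ k)"
proof -
  have [measurable]: "Z \<in> borel_measurable M" using assms(2) by (simp add: centered_normal_def)
  have "integrable (distr std_normal_distribution borel (\<lambda>x. sqrt v * x)) (\<lambda>x. x ^ k)"
    by (subst integrable_distr_eq)
      (auto simp: power_mult_distrib intro!: integrable_mult_right integrable_std_normal_distribution_moment)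
  then have "integrable (distr M borel Z) (\<lambda>x. x ^ k)"
    by (simp only: centered_normal_distr[OF assms])
  then show "integrable M (\<lambda>\<omega>. Z \<omega> ^ k)" by (simp add: integrable_distr_eq)
  have "(LINT \<omega>|M. Z \<omega> ^ k) = (LINT x|distr M borel Z. x ^ k)" by (simp add: integral_distr)
  also have "\<dots> = sqrt v ^ k * (LINT x|std_normal_distribution. x ^ k)"
    unfolding centered_normal_distr[OF assms] by (simp add: integral_distr power_mult_distrib)
  finally show "(LINT \<omega>|M. Z \<omega> ^ k) = sqrt v ^ k * (LINT x|std_normal_distribution. x ^ k)" .
qed

lemma centered_normal_mean_variance:
  assumes "prob_space M" "centered_normal M Z v"
  shows "(LINT \<omega>|M. Z \<omega>) = 0" "(LINT \<omega>|M. (Z \<omega>)\<^sup>2) = v"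
  using centered_normal_moment(2)[OF assms, of 1] centered_normal_moment(2)[OF assms, of 2]
    integral_std_normal_distribution_moment_odd[of 1] std_normal_distribution_even_moments(1)[of 1]
    centered_normal_var_nonneg[OF assms]
  by (simp_all add: fact_numeral)

lemma centered_normal_imp_gaussian_rv:
  assumes "prob_space M" "centered_normal M Z v"
  shows "gaussian_rv M Z"
proof -
  interpret prob_space M by fact
  have [measurable]: "Z \<in> borel_measurable M" using assms(2) by (simp add: centered_normal_def)
  have v: "v \<ge> 0" by (rule centered_normal_var_nonneg[OF assms])
  consider "v = 0" | "v > 0" using v by linarith
  then show ?thesis
  proof cases
    case 1
    have "integrable M (\<lambda>\<omega>. (Z \<omega>)\<^sup>2)" using centered_normal_moment(1)[OF assms] .
    moreover have "(LINT \<omega>|M. (Z \<omega>)\<^sup>2) = 0" using centered_normal_mean_variance[OF assms] 1 by simp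
    ultimately have "AE \<omega> in M. (Z \<omega>)\<^sup>2 = 0" by (subst (asm) integral_nonneg_eq_0_iff_AE) auto
    then show ?thesis unfolding gaussian_rv_def by auto
  next
    case 2
    interpret N: prob_space std_normal_distribution
      using real_dist_normal_dist by (simp add: real_distribution_def)
    have "distributed std_normal_distribution lborel (\<lambda>x. x) std_normal_density"
      unfolding distributed_def by (auto simp: distr_id2)
    from N.normal_density_affine[OF this, of "sqrt v" 0]
    have "distributed std_normal_distribution lborel (\<lambda>x. sqrt v * x) (normal_density 0 (sqrt v))"
      using 2 by simp
    then have "distr std_normal_distribution lborel (\<lambda>x. sqrt v * x) = density lborel (normal_density 0 (sqrt v))"
      by (simp add: distributed_def)
    moreover have "distr M lborel Z = distr M borel Z" by (rule distr_cong) auto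
    moreover have "distr std_normal_distribution lborel (\<lambda>x. sqrt v * x)
        = distr std_normal_distribution borel (\<lambda>x. sqrt v * x)" by (rule distr_cong) auto
    ultimately have "distributed M lborel Z (normal_density 0 (sqrt v))"
      unfolding distributed_def using centered_normal_distr[OF assms] by auto
    then show ?thesis unfolding gaussian_rv_def using 2 by force
  qed
qed

lemma gaussian_rv_imp_centered_normal:
  assumes "prob_space M" "gaussian_rv M Z" "(LINT \<omega>|M. Z \<omega>) = 0" 
  shows "centered_normal M Z (LINT \<omega>|M. (Z \<omega>)\<^sup>2)"
proof -
  interpret prob_space M by fact
  have [measurable]: "Z \<in> borel_measurable M" using assms(2) by (simp add: gaussian_rv_def)
  consider m where "AE \<omega> in M. Z \<omega> = m"
    | m \<sigma> where "\<sigma> > 0" "distributed M lborel Z (normal_density m \<sigma>)"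
    using assms(2) unfolding gaussian_rv_def by auto
  then show ?thesis
  proof cases
    case 1
    have "(LINT \<omega>|M. Z \<omega>) = (LINT \<omega>|M. m)" using 1 by (intro integral_cong_AE) auto
    then have "m = 0" using assms(3) by (simp add: prob_space)
    then have ae: "AE \<omega> in M. Z \<omega> = 0" using 1 by simp
    have "(LINT \<omega>|M. (Z \<omega>)\<^sup>2) = (LINT \<omega>|M. 0)" using ae by (intro integral_cong_AE) auto
    moreover have "(CLINT \<omega>|M. iexp (t * Z \<omega>)) = (CLINT \<omega>|M. 1)" for t
      using ae by (intro integral_cong_AE) auto
    ultimately show ?thesis by (simp add: centered_normal_def prob_space)
  next
    case 2
    have m: "m = 0" using assms(3) normal_distributed_expectation[OF 2] by simp
    have var: "(LINT \<omega>|M. (Z \<omega>)\<^sup>2) = \<sigma>\<^sup>2"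
      using normal_distributed_variance[OF 2] assms(3) by simp
    interpret N: prob_space std_normal_distribution
      using real_dist_normal_dist by (simp add: real_distribution_def)
    have "distributed M lborel (\<lambda>\<omega>. Z \<omega> / \<sigma>) std_normal_density"
      using normal_standard_normal_convert[OF 2(1), of Z m] 2(2) m by simp
    then have "distr M lborel (\<lambda>\<omega>. Z \<omega> / \<sigma>) = std_normal_distribution"
      by (simp add: distributed_def)
    moreover have "distr M lborel (\<lambda>\<omega>. Z \<omega> / \<sigma>) = distr M borel (\<lambda>\<omega>. Z \<omega> / \<sigma>)"
      by (rule distr_cong) auto
    ultimately have d: "char (distr M borel (\<lambda>\<omega>. Z \<omega> / \<sigma>)) t = exp (- (t\<^sup>2) / 2)" for t
      by (simp add: char_std_normal_distribution)
    have "(CLINT \<omega>|M. iexp (t * Z \<omega>)) = of_real (exp (- \<sigma>\<^sup>2 * t\<^sup>2 / 2))" for t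
      using d[of "t * \<sigma>"] 2(1) by (simp add: char_def integral_distr power_mult_distrib mult_ac)
    then show ?thesis by (simp add: centered_normal_def var)
  qed
qed

text \<open>Linear combinations are indexed by numbers rather than by points, so that points may
  coincide; this is what survives when points are moved to nearby grid points.\<close>

definition gaussian_on ::
    "'t set \<Rightarrow> 'w measure \<Rightarrow> ('t \<Rightarrow> 'w \<Rightarrow> real) \<Rightarrow> ('t \<Rightarrow> 't \<Rightarrow> real) \<Rightarrow> bool" where
  "gaussian_on T M X K \<longleftrightarrow> prob_space M \<and>
     (\<forall>n (a :: nat \<Rightarrow> real) p. (\<forall>i<n. p i \<in> T) \<longrightarrow>
        centered_normal M (\<lambda>\<omega>. \<Sum>i<n. a i * X (p i) \<omega>)
          (\<Sum>i<n. \<Sum>j<n. a i * a j * K (p i) (p j)))"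

lemma gaussian_onD:
  fixes a :: "nat \<Rightarrow> real"
  assumes "gaussian_on T M X K" "\<And>i. i < n \<Longrightarrow> p i \<in> T"
  shows "centered_normal M (\<lambda>\<omega>. \<Sum>i<n. a i * X (p i) \<omega>)
          (\<Sum>i<n. \<Sum>j<n. a i * a j * K (p i) (p j))"
  using assms unfolding gaussian_on_def by blast

lemma gaussian_on_char:
  fixes a :: "nat \<Rightarrow> real"
  assumes "gaussian_on T M X K" "\<And>i. i < n \<Longrightarrow> p i \<in> T"
  shows "(CLINT \<omega>|M. iexp (\<Sum>i<n. a i * X (p i) \<omega>))
    = of_real (exp (- (\<Sum>i<n. \<Sum>j<n. a i * a j * K (p i) (p j)) / 2))"
  using gaussian_onD[where n = n and p = p and a = a, OF assms, unfolded centered_normal_def, THEN conjunct2, rule_format, of 1]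
  by (simp only: mult_1 mult_1_right power_one)

lemma gaussian_on_prob_space: "gaussian_on T M X K \<Longrightarrow> prob_space M"
  by (simp add: gaussian_on_def)

lemma gaussian_on_value:
  assumes "gaussian_on T M X K" "x \<in> T"
  shows "centered_normal M (X x) (K x x)"
  using gaussian_onD[OF assms(1), of "Suc 0" "\<lambda>_. x" "\<lambda>_. 1"] assms(2) by simp

lemma gaussian_on_measurable:
  "gaussian_on T M X K \<Longrightarrow> x \<in> T \<Longrightarrow> X x \<in> borel_measurable M"
  using gaussian_on_value[of T M X K x] by (simp add: centered_normal_def)

lemma gaussian_on_two_points:
  assumes "gaussian_on T M X K" "x \<in> T" "y \<in> T"
  shows "centered_normal M (\<lambda>\<omega>. X x \<omega> + r * X y \<omega>)
    (K x x + r * K x y + r * K y x + r\<^sup>2 * K y y)"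
  using gaussian_onD[OF assms(1), of "Suc (Suc 0)" "\<lambda>i. if i = 0 then x else y"
      "\<lambda>i. if i = 0 then 1 else r"] assms(2,3)
  by (simp add: power2_eq_square algebra_simps)

lemma gaussian_on_subset: "gaussian_on T M X K \<Longrightarrow> S \<subseteq> T \<Longrightarrow> gaussian_on S M X K"
  unfolding gaussian_on_def by blast

lemma gaussian_on_PSD:
  fixes a :: "nat \<Rightarrow> real"
  assumes "gaussian_on T M X K" "\<And>i. i < n \<Longrightarrow> p i \<in> T"
  shows "(\<Sum>i<n. \<Sum>j<n. a i * a j * K (p i) (p j)) \<ge> 0"
  using centered_normal_var_nonneg[OF gaussian_on_prob_space gaussian_onD] assms by blast

lemma square_integrable_mult:
  fixes f g :: "'w \<Rightarrow> real"
  assumes "f \<in> borel_measurable M" "g \<in> borel_measurable M"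
    "integrable M (\<lambda>\<omega>. (f \<omega>)\<^sup>2)" "integrable M (\<lambda>\<omega>. (g \<omega>)\<^sup>2)"
  shows "integrable M (\<lambda>\<omega>. f \<omega> * g \<omega>)"
proof (rule Bochner_Integration.integrable_bound)
  show "integrable M (\<lambda>\<omega>. (f \<omega>)\<^sup>2 + (g \<omega>)\<^sup>2)" using assms by simp
  have "\<bar>x * y\<bar> \<le> x\<^sup>2 + y\<^sup>2" for x y :: real
  proof -
    have "2 * (\<bar>x\<bar> * \<bar>y\<bar>) \<le> x\<^sup>2 + y\<^sup>2" using sum_squares_bound[of "\<bar>x\<bar>" "\<bar>y\<bar>"] by simp
    moreover have "0 \<le> \<bar>x\<bar> * \<bar>y\<bar>" by simp
    ultimately show ?thesis unfolding abs_mult by linarith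
  qed
  then show "AE \<omega> in M. norm (f \<omega> * g \<omega>) \<le> norm ((f \<omega>)\<^sup>2 + (g \<omega>)\<^sup>2)"
    by (auto simp: abs_of_nonneg)
qed (use assms in auto)

lemma centered_gaussian_field_imp_gaussian_on:
  assumes "centered_gaussian_field M X K"
  shows "gaussian_on UNIV M X K"
  unfolding gaussian_on_def
proof (intro conjI allI impI)
  have M: "prob_space M" and field: "\<And>F a. finite F \<Longrightarrow> gaussian_rv M (\<lambda>\<omega>. \<Sum>x\<in>F. a x * X x \<omega>)"
    and mean: "\<And>x. (LINT \<omega>|M. X x \<omega>) = 0"
    and cov: "\<And>x y. covariance_function M X x y = K x y"
    using assms by (auto simp: centered_gaussian_field_def gaussian_field_def mean_function_def)
  show "prob_space M" by fact
  have K: "(LINT \<omega>|M. X x \<omega> * X y \<omega>) = K x y" for x y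
    using cov[of x y] mean by (simp add: covariance_function_def mean_function_def)
  have "gaussian_rv M (X x)" for x using field[of "{x}" "\<lambda>_. 1"] by simp
  then have N: "centered_normal M (X x) (LINT \<omega>|M. (X x \<omega>)\<^sup>2)" for x
    by (rule gaussian_rv_imp_centered_normal[OF M _ mean])
  then have meas [measurable]: "X x \<in> borel_measurable M" for x by (simp add: centered_normal_def)
  have int: "integrable M (X x)" and int2: "integrable M (\<lambda>\<omega>. (X x \<omega>)\<^sup>2)" for x
    using centered_normal_moment(1)[OF M N, of x 1] centered_normal_moment(1)[OF M N, of x 2] by auto
  have intXY: "integrable M (\<lambda>\<omega>. X x \<omega> * X y \<omega>)" for x y
    by (intro square_integrable_mult meas int2)
  fix n :: nat and a :: "nat \<Rightarrow> real" and p
  let ?Z = "\<lambda>\<omega>. \<Sum>i<n. a i * X (p i) \<omega>"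
  have "?Z \<omega> = (\<Sum>x\<in>p ` {..<n}. (\<Sum>i | i \<in> {..<n} \<and> p i = x. a i) * X x \<omega>)" for \<omega>
    unfolding sum.image_gen[OF finite_lessThan, of _ n p] sum_distrib_right
    by (intro sum.cong) auto
  \<comment> \<open>the coefficients at coinciding points are added up\<close>
  then have g: "gaussian_rv M ?Z"
    using field[of "p ` {..<n}" "\<lambda>x. \<Sum>i | i \<in> {..<n} \<and> p i = x. a i"] by (simp only: finite_imageI finite_lessThan)
  have "(LINT \<omega>|M. ?Z \<omega>) = 0" using int mean by simp
  from gaussian_rv_imp_centered_normal[OF M g this]
  have "centered_normal M ?Z (LINT \<omega>|M. (?Z \<omega>)\<^sup>2)" .
  moreover have "(LINT \<omega>|M. (?Z \<omega>)\<^sup>2) = (LINT \<omega>|M. (\<Sum>i<n. \<Sum>j<n. a i * a j * (X (p i) \<omega> * X (p j) \<omega>)))"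
    by (simp add: power2_eq_square sum_product mult_ac)
  moreover have "\<dots> = (\<Sum>i<n. \<Sum>j<n. a i * a j * K (p i) (p j))"
    using intXY by (simp add: K)
  ultimately show "centered_normal M ?Z (\<Sum>i<n. \<Sum>j<n. a i * a j * K (p i) (p j))" by simp
qed

lemma gaussian_on_imp_centered_gaussian_field:
  assumes "gaussian_on UNIV M X K" and sym: "\<And>x y. K x y = K y x"
  shows "centered_gaussian_field M X K"
  unfolding centered_gaussian_field_def gaussian_field_def
proof (intro conjI allI impI)
  show M: "prob_space M" using assms(1) by (rule gaussian_on_prob_space)
  have N: "centered_normal M (X x) (K x x)" for x
    by (rule gaussian_on_value[OF assms(1) UNIV_I])
  show mean: "mean_function M X x = 0" for x
    unfolding mean_function_def by (rule centered_normal_mean_variance[OF M N])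
  show "gaussian_rv M (\<lambda>\<omega>. \<Sum>x\<in>F. a x * X x \<omega>)" if fin: "finite F" for F a
  proof -
    obtain p where p: "bij_betw p {0..<card F} F" using ex_bij_betw_nat_finite[OF fin] by blast
    have "(\<lambda>\<omega>. \<Sum>x\<in>F. a x * X x \<omega>) = (\<lambda>\<omega>. \<Sum>i<card F. a (p i) * X (p i) \<omega>)"
      by (subst sum.reindex_bij_betw[OF p, symmetric]) (simp add: lessThan_atLeast0)
    then show ?thesis
      using centered_normal_imp_gaussian_rv[OF M gaussian_onD[OF assms(1), of "card F" p "\<lambda>i. a (p i)"]]
      by simp
  qed
  show "covariance_function M X x y = K x y" for x y
  proof -
    \<comment> \<open>the covariance is recovered from variances by polarisation\<close>
    note plus = gaussian_on_two_points[OF assms(1), of x y 1, simplified]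
    have meas [measurable]: "X x \<in> borel_measurable M" for x using N by (simp add: centered_normal_def)
    have int2: "integrable M (\<lambda>\<omega>. (X x \<omega>)\<^sup>2)" for x
      by (rule centered_normal_moment(1)[OF M N])
    have intXY: "integrable M (\<lambda>\<omega>. X x \<omega> * X y \<omega>)"
      by (intro square_integrable_mult meas int2)
    have "(LINT \<omega>|M. (X x \<omega> + X y \<omega>)\<^sup>2)
        = (LINT \<omega>|M. (X x \<omega>)\<^sup>2 + (X y \<omega>)\<^sup>2 + 2 * (X x \<omega> * X y \<omega>))"
      by (simp add: power2_sum mult_ac)
    also have "\<dots> = K x x + K y y + 2 * (LINT \<omega>|M. X x \<omega> * X y \<omega>)"
      using int2 intXY centered_normal_mean_variance(2)[OF M N] by simp
    finally have "(LINT \<omega>|M. X x \<omega> * X y \<omega>) = K x y"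
      using centered_normal_mean_variance(2)[OF M plus] sym[of y x] by simp
    then show ?thesis using mean by (simp add: covariance_function_def)
  qed
qed

section \<open>Joint laws are determined by linear combinations\<close>

text \<open>A weight turns the law of \<open>X\<close> into a finite measure, which after normalisation is
  determined by its characteristic function.\<close>

lemma weighted_law_eqI:
  fixes X w :: "'w \<Rightarrow> real" and Y u :: "'v \<Rightarrow> real"
  assumes M: "prob_space M" and N: "prob_space N"
    and meas [measurable]: "X \<in> borel_measurable M" "Y \<in> borel_measurable N"
      "w \<in> borel_measurable M" "u \<in> borel_measurable N"
    and w: "\<And>\<omega>. 0 \<le> w \<omega>" "\<And>\<omega>. w \<omega> \<le> b" and u: "\<And>\<omega>. 0 \<le> u \<omega>" "\<And>\<omega>. u \<omega> \<le> b"
    and eq: "\<And>t. (CLINT \<omega>|M. iexp (t * X \<omega>) * of_real (w \<omega>))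
               = (CLINT \<omega>|N. iexp (t * Y \<omega>) * of_real (u \<omega>))"
    and A [measurable]: "A \<in> sets borel"
  shows "(LINT \<omega>|M. indicator A (X \<omega>) * w \<omega>) = (LINT \<omega>|N. indicator A (Y \<omega>) * u \<omega>)"
proof -
  interpret M: prob_space M by fact
  interpret N: prob_space N by fact
  define m where "m = (LINT \<omega>|M. w \<omega>)"
  have iw: "integrable M w" using w by (intro M.integrable_const_bound[where B = b]) auto
  have iu: "integrable N u" using u by (intro N.integrable_const_bound[where B = b]) auto
  have mu: "m = (LINT \<omega>|N. u \<omega>)"
    using eq[of 0] by (simp add: m_def)
  have m0: "m \<ge> 0" unfolding m_def using w by simp
  show ?thesis
  proof (cases "m = 0")
    case True
    \<comment> \<open>the weights vanish almost everywhere\<close>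
    have "AE \<omega> in M. w \<omega> = 0" using True w iw
      by (subst integral_nonneg_eq_0_iff_AE[symmetric]) (auto simp: m_def)
    then have "(LINT \<omega>|M. indicator A (X \<omega>) * w \<omega>) = (LINT \<omega>|M. 0)"
      by (intro integral_cong_AE) auto
    moreover have "AE \<omega> in N. u \<omega> = 0" using True u iu
      by (subst integral_nonneg_eq_0_iff_AE[symmetric]) (auto simp: mu)
    then have "(LINT \<omega>|N. indicator A (Y \<omega>) * u \<omega>) = (LINT \<omega>|N. 0)"
      by (intro integral_cong_AE) auto
    ultimately show ?thesis by simp
  next
    case False
    then have m: "m > 0" using m0 by simp
    define P where "P = distr (density M (\<lambda>\<omega>. w \<omega> / m)) borel X"
    define Q where "Q = distr (density N (\<lambda>\<omega>. u \<omega> / m)) borel Y"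
    have int_P: "(LINT x|P. f x) = (LINT \<omega>|M. (w \<omega> / m) *\<^sub>R f (X \<omega>))"
      if [measurable]: "f \<in> borel_measurable borel" for f :: "real \<Rightarrow> 'c::{banach, second_countable_topology}"
      unfolding P_def using w m by (simp add: integral_distr integral_density)
    have int_Q: "(LINT x|Q. f x) = (LINT \<omega>|N. (u \<omega> / m) *\<^sub>R f (Y \<omega>))"
      if [measurable]: "f \<in> borel_measurable borel" for f :: "real \<Rightarrow> 'c::{banach, second_countable_topology}"
      unfolding Q_def using u m by (simp add: integral_distr integral_density)
    have "prob_space (density M (\<lambda>\<omega>. w \<omega> / m))"
    proof
      have "(\<integral>\<^sup>+\<omega>. ennreal (w \<omega> / m) \<partial>M) = ennreal (LINT \<omega>|M. w \<omega> / m)"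
        using w m iw by (intro nn_integral_eq_integral) auto
      then show "emeasure (density M (\<lambda>\<omega>. w \<omega> / m)) (space (density M (\<lambda>\<omega>. w \<omega> / m))) = 1"
        using m iw by (simp add: emeasure_density m_def[symmetric] cong: nn_integral_cong)
    qed
    then have P: "real_distribution P" unfolding P_def
      by (rule prob_space.real_distribution_distr) simp
    have "prob_space (density N (\<lambda>\<omega>. u \<omega> / m))"
    proof
      have "(\<integral>\<^sup>+\<omega>. ennreal (u \<omega> / m) \<partial>N) = ennreal (LINT \<omega>|N. u \<omega> / m)"
        using u m iu by (intro nn_integral_eq_integral) auto
      then show "emeasure (density N (\<lambda>\<omega>. u \<omega> / m)) (space (density N (\<lambda>\<omega>. u \<omega> / m))) = 1"
        using m iu by (simp add: emeasure_density mu[symmetric] cong: nn_integral_cong)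
    qed
    then have Q: "real_distribution Q" unfolding Q_def
      by (rule prob_space.real_distribution_distr) simp
    have "char P t = char Q t" for t
    proof -
      have "char P t = (CLINT \<omega>|M. iexp (t * X \<omega>) * of_real (w \<omega>)) / of_real m"
        unfolding char_def by (subst int_P) (simp_all add: scaleR_conv_of_real mult_ac)
      moreover have "char Q t = (CLINT \<omega>|N. iexp (t * Y \<omega>) * of_real (u \<omega>)) / of_real m"
        unfolding char_def by (subst int_Q) (simp_all add: scaleR_conv_of_real mult_ac)
      ultimately show ?thesis by (simp only: eq)
    qed
    then have "P = Q" by (intro Levy_uniqueness P Q) auto
    then have "(LINT x|P. indicator A x) = (LINT x|Q. indicator A x :: real)" by simp
    then have "(LINT \<omega>|M. (w \<omega> / m) *\<^sub>R indicator A (X \<omega>)) = (LINT \<omega>|N. (u \<omega> / m) *\<^sub>R indicator A (Y \<omega>) :: real)"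
      using int_P[of "indicator A :: real \<Rightarrow> real"] int_Q[of "indicator A :: real \<Rightarrow> real"]
      by (simp only: borel_measurable_indicator A)
    then have "(LINT \<omega>|M. indicator A (X \<omega>) * w \<omega>) / m = (LINT \<omega>|N. indicator A (Y \<omega>) * u \<omega>) / m"
      by (simp add: mult_ac)
    then show ?thesis using m by simp
  qed
qed

lemma sum_lessThan_fun_upd:
  fixes a :: "nat \<Rightarrow> real"
  shows "(\<Sum>i<Suc n. (a(n := t)) i * f ((p(n := q)) i)) = t * f q + (\<Sum>i<n. a i * f (p i))"
  by (simp add: add.commute)

lemma iexp_one_plus_cos:
  "iexp x * of_real ((1 + cos y) * v) = iexp x * of_real v
     + 1/2 * (iexp (x + y) * of_real v) + 1/2 * (iexp (x - y) * of_real v)"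
  for x y v :: real
  unfolding cis_conv_exp[symmetric] complex_eq_iff
  by (simp add: cos_add sin_add cos_diff sin_diff field_simps)

lemma iexp_one_plus_sin:
  "iexp x * of_real ((1 + sin y) * v) = iexp x * of_real v
     + (- \<i>/2) * (iexp (x + y) * of_real v) + \<i>/2 * (iexp (x - y) * of_real v)"
  for x y v :: real
  unfolding cis_conv_exp[symmetric] complex_eq_iff
  by (simp add: cos_add sin_add cos_diff sin_diff field_simps)

text \<open>The integral of \<open>exp (\<i> Z)\<close> against the weight \<open>W\<close> is a combination of the total masses of three
  nonnegative weights. This converts statements about nonnegative weights back into statements
  about exponentials.\<close>

lemma (in prob_space) integral_iexp_weight:
  fixes Z W :: "'a \<Rightarrow> real"
  assumes [measurable]: "Z \<in> borel_measurable M" "W \<in> borel_measurable M"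
    and W: "\<And>\<omega>. 0 \<le> W \<omega>" "\<And>\<omega>. W \<omega> \<le> 1"
  shows "(CLINT \<omega>|M. iexp (Z \<omega>) * of_real (W \<omega>))
     = of_real (LINT \<omega>|M. (1 + cos (Z \<omega>)) * W \<omega>) + \<i> * of_real (LINT \<omega>|M. (1 + sin (Z \<omega>)) * W \<omega>)
       - (1 + \<i>) * of_real (LINT \<omega>|M. W \<omega>)"
proof -
  have iW: "integrable M W"
    using W by (intro integrable_const_bound[where B = 1]) auto
  have ic: "integrable M (\<lambda>\<omega>. cos (Z \<omega>) * W \<omega>)" and si: "integrable M (\<lambda>\<omega>. sin (Z \<omega>) * W \<omega>)"
    using W by (auto intro!: Bochner_Integration.integrable_bound[OF iW] simp: abs_mult mult_left_le_one_le)
  have "(CLINT \<omega>|M. iexp (Z \<omega>) * of_real (W \<omega>))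
     = (CLINT \<omega>|M. complex_of_real (cos (Z \<omega>) * W \<omega>) + \<i> * of_real (sin (Z \<omega>) * W \<omega>))"
    by (intro Bochner_Integration.integral_cong) (auto simp: cis_conv_exp[symmetric] complex_eq_iff)
  also have "\<dots> = of_real (LINT \<omega>|M. cos (Z \<omega>) * W \<omega>) + \<i> * of_real (LINT \<omega>|M. sin (Z \<omega>) * W \<omega>)"
    using ic si by (subst Bochner_Integration.integral_add) (simp_all del: of_real_mult)
  finally show ?thesis using iW ic si by (simp add: algebra_simps)
qed

text \<open>The coordinates are moved one at a time from the exponential into indicator functions.
  In one step the product \<open>W\<close> of the indicators obtained so far, multiplied by
  \<open>1 + cos Z\<close> or \<open>1 + sin Z\<close>, serves as a nonnegative weight for the next coordinate, so that only
  the uniqueness theorem on the line is used.\<close>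

lemma joint_law_eq_mixed:
  fixes X :: "'t \<Rightarrow> 'w \<Rightarrow> real" and Y :: "'t \<Rightarrow> 'v \<Rightarrow> real" and A :: "nat \<Rightarrow> real set"
    and a :: "nat \<Rightarrow> real" and p q :: "nat \<Rightarrow> 't"
  assumes M: "prob_space M" and N: "prob_space N"
    and X [measurable]: "\<And>x. X x \<in> borel_measurable M" and Y [measurable]: "\<And>x. Y x \<in> borel_measurable N"
    and char: "\<And>n (a :: nat \<Rightarrow> real) p :: nat \<Rightarrow> 't. (CLINT \<omega>|M. iexp (\<Sum>i<n. a i * X (p i) \<omega>))
                 = (CLINT \<omega>|N. iexp (\<Sum>i<n. a i * Y (p i) \<omega>))"
    and A [measurable]: "\<And>i. A i \<in> sets borel"
  shows "(CLINT \<omega>|M. iexp (\<Sum>i<n. a i * X (p i) \<omega>) * of_real (\<Prod>i<k. indicator (A i) (X (q i) \<omega>)))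
       = (CLINT \<omega>|N. iexp (\<Sum>i<n. a i * Y (p i) \<omega>) * of_real (\<Prod>i<k. indicator (A i) (Y (q i) \<omega>)))"
proof (induction k arbitrary: n a p)
  case 0
  then show ?case using char by simp
next
  case (Suc k)
  interpret M: prob_space M by fact
  interpret N: prob_space N by fact
  define W where "W \<omega> = (\<Prod>i<k. indicator (A i) (X (q i) \<omega>) :: real)" for \<omega>
  define V where "V \<omega> = (\<Prod>i<k. indicator (A i) (Y (q i) \<omega>) :: real)" for \<omega>
  define Z where "Z \<omega> = (\<Sum>i<n. a i * X (p i) \<omega>)" for \<omega>
  define U where "U \<omega> = (\<Sum>i<n. a i * Y (p i) \<omega>)" for \<omega>
  have [measurable]: "W \<in> borel_measurable M" "Z \<in> borel_measurable M"
    "V \<in> borel_measurable N" "U \<in> borel_measurable N"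
    unfolding W_def Z_def V_def U_def by measurable
  have W: "0 \<le> W \<omega>" "W \<omega> \<le> 1" for \<omega>
    unfolding W_def by (auto intro!: prod_nonneg prod_le_1)
  have V: "0 \<le> V \<omega>" "V \<omega> \<le> 1" for \<omega>
    unfolding V_def by (auto intro!: prod_nonneg prod_le_1)
  have shifted: "(CLINT \<omega>|M. iexp (t * X (q k) \<omega> + r * Z \<omega>) * of_real (W \<omega>))
      = (CLINT \<omega>|N. iexp (t * Y (q k) \<omega> + r * U \<omega>) * of_real (V \<omega>))" for t r
    using Suc.IH[where n = "Suc n" and a = "(\<lambda>i. r * a i)(n := t)" and p = "p(n := q k)"]
    unfolding sum_lessThan_fun_upd W_def V_def Z_def U_def by (simp add: sum_distrib_left ac_simps)
  have intM: "complex_integrable M (\<lambda>\<omega>. iexp (f \<omega>) * of_real (W \<omega>))" if [measurable]: "f \<in> borel_measurable M" for f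
    using W by (intro M.integrable_const_bound[where B = 1]) (auto simp: norm_mult)
  have intN: "complex_integrable N (\<lambda>\<omega>. iexp (f \<omega>) * of_real (V \<omega>))" if [measurable]: "f \<in> borel_measurable N" for f
    using V by (intro N.integrable_const_bound[where B = 1]) (auto simp: norm_mult)
  have base: "(CLINT \<omega>|M. iexp (t * X (q k) \<omega>) * of_real (W \<omega>))
      = (CLINT \<omega>|N. iexp (t * Y (q k) \<omega>) * of_real (V \<omega>))" for t
    using shifted[of t 0] by simp
  have plus: "(CLINT \<omega>|M. iexp (t * X (q k) \<omega> + Z \<omega>) * of_real (W \<omega>))
      = (CLINT \<omega>|N. iexp (t * Y (q k) \<omega> + U \<omega>) * of_real (V \<omega>))" for t
    using shifted[of t 1] by simp
  have minus: "(CLINT \<omega>|M. iexp (t * X (q k) \<omega> - Z \<omega>) * of_real (W \<omega>))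
      = (CLINT \<omega>|N. iexp (t * Y (q k) \<omega> - U \<omega>) * of_real (V \<omega>))" for t
    using shifted[of t "-1"] by simp
  let ?I = "\<lambda>\<omega>. indicator (A k) (X (q k) \<omega>) :: real"
  let ?J = "\<lambda>\<omega>. indicator (A k) (Y (q k) \<omega>) :: real"
  have one: "(LINT \<omega>|M. ?I \<omega> * W \<omega>) = (LINT \<omega>|N. ?J \<omega> * V \<omega>)"
    by (rule weighted_law_eqI[where b = 1, OF M N]) (use W V base in auto)
  have le2: "(1 + x) * v \<le> 2" if "x \<le> 1" "x \<ge> -1" "0 \<le> v" "v \<le> 1" for x v :: real
    using mult_mono[of "1 + x" 2 v 1] that by simp
  have ge0: "0 \<le> (1 + x) * v" if "x \<ge> -1" "0 \<le> v" for x v :: real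
    using that by simp
  have c: "(LINT \<omega>|M. ?I \<omega> * ((1 + cos (Z \<omega>)) * W \<omega>)) = (LINT \<omega>|N. ?J \<omega> * ((1 + cos (U \<omega>)) * V \<omega>))"
  proof (rule weighted_law_eqI[where b = 2, OF M N])
    show "(CLINT \<omega>|M. iexp (t * X (q k) \<omega>) * of_real ((1 + cos (Z \<omega>)) * W \<omega>))
        = (CLINT \<omega>|N. iexp (t * Y (q k) \<omega>) * of_real ((1 + cos (U \<omega>)) * V \<omega>))" for t
      unfolding iexp_one_plus_cos using intM intN by (simp add: plus minus base del: of_real_add of_real_diff of_real_mult)
  qed (simp_all add: le2 ge0 W V)
  have s: "(LINT \<omega>|M. ?I \<omega> * ((1 + sin (Z \<omega>)) * W \<omega>)) = (LINT \<omega>|N. ?J \<omega> * ((1 + sin (U \<omega>)) * V \<omega>))"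
  proof (rule weighted_law_eqI[where b = 2, OF M N])
    show "(CLINT \<omega>|M. iexp (t * X (q k) \<omega>) * of_real ((1 + sin (Z \<omega>)) * W \<omega>))
        = (CLINT \<omega>|N. iexp (t * Y (q k) \<omega>) * of_real ((1 + sin (U \<omega>)) * V \<omega>))" for t
      unfolding iexp_one_plus_sin using intM intN by (simp add: plus minus base del: of_real_add of_real_diff of_real_mult)
  qed (simp_all add: le2 ge0 W V)
  have "(CLINT \<omega>|M. iexp (Z \<omega>) * of_real (?I \<omega> * W \<omega>)) = (CLINT \<omega>|N. iexp (U \<omega>) * of_real (?J \<omega> * V \<omega>))"
    using W V one c s
    by (subst M.integral_iexp_weight, (auto simp: indicator_def)[4])
       (subst N.integral_iexp_weight, (auto simp: indicator_def)[4], simp add: mult_ac)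
  then show ?case by (simp add: W_def V_def Z_def U_def mult_ac)
qed

section \<open>The space of continuous functions\<close>

lemma ball_seminorm_upper:
  fixes f :: "'a::euclidean_space \<Rightarrow> real"
  assumes "continuous_on UNIV f" "norm x \<le> real k"
  shows "\<bar>f x\<bar> \<le> ball_seminorm k f"
proof -
  have "compact ((\<lambda>x. \<bar>f x\<bar>) ` cball 0 (real k))"
    using assms(1) by (intro compact_continuous_image continuous_on_rabs) (auto intro: continuous_on_subset)
  then have "bdd_above ((\<lambda>x. \<bar>f x\<bar>) ` cball 0 (real k))"
    by (intro bounded_imp_bdd_above compact_imp_bounded)
  then show ?thesis
    using cSUP_upper[of x "cball 0 (real k)" "\<lambda>x. \<bar>f x\<bar>"] assms(2) by (simp add: ball_seminorm_def)
qed

lemma ball_seminorm_least: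
  fixes f :: "'a::euclidean_space \<Rightarrow> real"
  assumes "\<And>x. norm x \<le> real k \<Longrightarrow> \<bar>f x\<bar> \<le> r"
  shows "ball_seminorm k f \<le> r"
  unfolding ball_seminorm_def by (rule cSUP_least) (use assms in auto)

lemma ball_seminorm_nonneg:
  fixes f :: "'a::euclidean_space \<Rightarrow> real"
  shows "continuous_on UNIV f \<Longrightarrow> 0 \<le> ball_seminorm k f"
  using ball_seminorm_upper[of f 0 k] by simp

lemma ball_seminorm_mono:
  fixes f :: "'a::euclidean_space \<Rightarrow> real"
  assumes "continuous_on UNIV f" "k \<le> l"
  shows "ball_seminorm k f \<le> ball_seminorm l f"
  using assms by (intro ball_seminorm_least ball_seminorm_upper) auto

definition C_ball :: "nat \<Rightarrow> ('a::euclidean_space \<Rightarrow> real) \<Rightarrow> real \<Rightarrow> ('a \<Rightarrow> real) set" where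
  "C_ball k f e = {g. continuous_on UNIV g \<and> ball_seminorm k (\<lambda>x. g x - f x) < e}"

lemma openin_C_ball:
  "continuous_on UNIV f \<Longrightarrow> e > 0 \<Longrightarrow> openin C_topology (C_ball k f e)"
  unfolding C_topology_def C_ball_def by (rule topology_generated_by_Basis) blast

lemma C_ball_mono:
  assumes "continuous_on UNIV f" "k \<le> l" "e \<le> e'"
  shows "C_ball l f e \<subseteq> C_ball k f e'"
  using ball_seminorm_mono[OF continuous_on_diff[OF _ assms(1)] assms(2)] assms(3)
  unfolding C_ball_def by force

text \<open>The generating balls may have any centre. Around each of its points such a ball contains a
  smaller one by the triangle inequality, and finite intersections are handled by taking the larger
  compact set and the smaller radius.\<close>

lemma openin_C_topology_imp_C_ball:
  assumes "openin C_topology U" "f \<in> U"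
  obtains k e where "e > 0" "C_ball k f e \<subseteq> U"
proof -
  have "generate_topology_on {C_ball k f e | f k e. continuous_on UNIV f \<and> e > 0} U"
    using assms(1) unfolding C_topology_def C_ball_def openin_topology_generated_by_iff .
  moreover have "continuous_on UNIV f"
    using openin_subset[OF assms(1)] assms(2) by (auto simp: topspace_C_topology)
  ultimately have "\<exists>k e. e > 0 \<and> C_ball k f e \<subseteq> U" using assms(2)
  proof induction
    case (Int a b)
    then obtain k e l d where "e > 0" "C_ball k f e \<subseteq> a" "d > 0" "C_ball l f d \<subseteq> b" by auto
    moreover from this have "C_ball (max k l) f (min e d) \<subseteq> a" "C_ball (max k l) f (min e d) \<subseteq> b"
      using C_ball_mono[OF Int.prems(1), of k "max k l" "min e d" e]
        C_ball_mono[OF Int.prems(1), of l "max k l" "min e d" d] by auto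
    ultimately show ?case by (intro exI[of _ "max k l"] exI[of _ "min e d"]) auto
  next
    case (UN \<K>)
    then obtain V where "V \<in> \<K>" "f \<in> V" by auto
    from UN.IH[OF this(1) UN.prems(1) this(2)] this(1) show ?case by blast
  next
    case (Basis V)
    then obtain h k e where V: "V = C_ball k h e" and h: "continuous_on UNIV h" by auto
    have cont: "continuous_on UNIV (\<lambda>x. f x - h x)" using h Basis.prems by (intro continuous_on_diff)
    define d where "d = e - ball_seminorm k (\<lambda>x. f x - h x)"
    have "C_ball k f d \<subseteq> V"
    proof
      fix g assume g: "g \<in> C_ball k f d"
      then have gf: "continuous_on UNIV (\<lambda>x. g x - f x)"
        using Basis.prems by (auto simp: C_ball_def intro: continuous_on_diff)
      have "ball_seminorm k (\<lambda>x. g x - h x)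
          \<le> ball_seminorm k (\<lambda>x. g x - f x) + ball_seminorm k (\<lambda>x. f x - h x)"
      proof (rule ball_seminorm_least)
        fix x :: 'a assume "norm x \<le> real k"
        then show "\<bar>g x - h x\<bar> \<le> ball_seminorm k (\<lambda>x. g x - f x) + ball_seminorm k (\<lambda>x. f x - h x)"
          using ball_seminorm_upper[OF gf, of x k] ball_seminorm_upper[OF cont, of x k] by linarith
      qed
      then show "g \<in> V" using g by (auto simp: C_ball_def V d_def)
    qed
    moreover have "d > 0" using Basis.prems V by (simp add: C_ball_def d_def)
    ultimately show ?case by blast
  qed simp
  then show thesis using that by blast
qed

lemma C_topology_convergent_imp:
  assumes \<phi>: "continuous_map C_topology euclideanreal \<phi>"
    and f: "continuous_on UNIV f" and g: "\<And>n. continuous_on UNIV (g n)"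
    and lim: "\<And>k. (\<lambda>n. ball_seminorm k (\<lambda>x. g n x - f x)) \<longlonglongrightarrow> 0"
  shows "(\<lambda>n. \<phi> (g n)) \<longlonglongrightarrow> \<phi> f"
proof (rule topological_tendstoI)
  fix S :: "real set" assume S: "open S" "\<phi> f \<in> S"
  have "openin C_topology {h \<in> topspace C_topology. \<phi> h \<in> S}"
    using \<phi> S(1) by (simp add: continuous_map_def)
  moreover have "f \<in> {h \<in> topspace C_topology. \<phi> h \<in> S}" using S f by (simp add: topspace_C_topology)
  ultimately obtain k e where e: "e > 0" and sub: "C_ball k f e \<subseteq> {h \<in> topspace C_topology. \<phi> h \<in> S}"
    by (rule openin_C_topology_imp_C_ball)
  from order_tendstoD(2)[OF lim[of k] e] show "\<forall>\<^sub>F n in sequentially. \<phi> (g n) \<in> S"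
  proof eventually_elim
    case (elim n)
    then have "g n \<in> C_ball k f e" using g by (simp add: C_ball_def)
    then show ?case using sub by auto
  qed
qed

text \<open>A continuous function close to \<open>f\<close> on a compact set is one that obeys finitely many
  conditions of the form \<open>a \<le> g \<le> b\<close> on a basic open set, with rational \<open>a\<close>, \<open>b\<close>; and such a
  condition needs to be tested on a countable dense set only. Since there are countably many such
  conditions, open sets are countable unions of sets described by countably many evaluations.\<close>

lemma openin_C_topology_countable_cylinders:
  fixes U :: "('a::euclidean_space \<Rightarrow> real) set"
  assumes U: "openin C_topology U"
  obtains \<J> :: "('a \<times> real \<times> real) set set"
  where "countable \<J>" "\<And>J. J \<in> \<J> \<Longrightarrow> countable J"
    "U = (\<Union>J\<in>\<J>. {g. continuous_on UNIV g \<and> (\<forall>(x, a, b)\<in>J. a \<le> g x \<and> g x \<le> b)})"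
proof -
  obtain \<B> :: "'a set set" where \<B>: "countable \<B>" "topological_basis \<B>"
    using ex_countable_basis by blast
  obtain D :: "'a set" where D: "countable D" "\<And>X. open X \<Longrightarrow> X \<noteq> {} \<Longrightarrow> \<exists>d\<in>D. d \<in> X"
    using countable_dense_setE by blast
  define tests where "tests S = (\<Union>(B, a, b)\<in>S. (D \<inter> B) \<times> {(a, b)})" for S :: "('a set \<times> real \<times> real) set"
  define cyl where "cyl J = {g. continuous_on UNIV g \<and> (\<forall>(x, a, b)\<in>J. a \<le> g x \<and> g x \<le> b)}"
    for J :: "('a \<times> real \<times> real) set"
  define \<S> where "\<S> = {S. finite S \<and> S \<subseteq> \<B> \<times> \<rat> \<times> \<rat> \<and> cyl (tests S) \<subseteq> U}"
  have "countable {S. finite S \<and> S \<subseteq> \<B> \<times> (\<rat> :: real set) \<times> (\<rat> :: real set)}"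
    using \<B>(1) countable_rat by (intro countable_Collect_finite_subset countable_SIGMA)
  then have "countable \<S>" unfolding \<S>_def by (rule countable_subset[rotated]) auto
  then have "countable (tests ` \<S>)" by simp
  moreover have "countable J" if J: "J \<in> tests ` \<S>" for J
  proof -
    obtain S where S: "finite S" "J = tests S" using J by (auto simp: \<S>_def)
    have "countable (D \<inter> B)" for B using D(1) by (rule countable_subset[rotated]) auto
    then show ?thesis unfolding S(2) tests_def using S(1)
      by (intro countable_UN[OF countable_finite]) (auto intro!: countable_SIGMA)
  qed
  moreover have "U = (\<Union>J\<in>tests ` \<S>. cyl J)"
  proof (rule subset_antisym)
    show "U \<subseteq> (\<Union>J\<in>tests ` \<S>. cyl J)"
    proof
      fix f assume f: "f \<in> U"
      then have cont: "continuous_on UNIV f" using openin_subset[OF U] by (auto simp: topspace_C_topology)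
      obtain k e where e: "e > 0" and sub: "C_ball k f e \<subseteq> U"
        using openin_C_topology_imp_C_ball[OF U f] .
      have "\<exists>B a b. x \<in> B \<and> B \<in> \<B> \<and> a \<in> \<rat> \<and> b \<in> \<rat> \<and> b - a \<le> e / 2 \<and> (\<forall>y\<in>B. a \<le> f y \<and> f y \<le> b)" for x
      proof -
        obtain a where a: "a \<in> \<rat>" "f x - e / 4 < a" "a < f x" using Rats_dense_in_real[of "f x - e / 4" "f x"] e by auto
        obtain b where b: "b \<in> \<rat>" "f x < b" "b < f x + e / 4" using Rats_dense_in_real[of "f x" "f x + e / 4"] e by auto
        have "open (f -` {a<..<b})" using cont by (intro open_vimage) auto
        moreover have "x \<in> f -` {a<..<b}" using a b by auto
        ultimately obtain B where "B \<in> \<B>" "x \<in> B" "B \<subseteq> f -` {a<..<b}"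
          using topological_basisE[OF \<B>(2)] by metis
        then show ?thesis using a b by (intro exI[of _ B] exI[of _ a] exI[of _ b]) force
      qed
      then obtain B a b where Bab: "\<And>x. x \<in> B x" "\<And>x. B x \<in> \<B>" "\<And>x. a x \<in> \<rat>" "\<And>x. b x \<in> \<rat>"
          "\<And>x. b x - a x \<le> e / 2" "\<And>x y. y \<in> B x \<Longrightarrow> a x \<le> f y \<and> f y \<le> b x"
        by metis
      have openB: "open (B x)" for x using Bab(2) topological_basis_open[OF \<B>(2)] by blast
      obtain F where F: "F \<subseteq> cball 0 (real k)" "finite F" "cball 0 (real k) \<subseteq> (\<Union>x\<in>F. B x)"
        by (rule compactE_image[of "cball 0 (real k)" "cball 0 (real k)" B])
          (use openB Bab(1) in auto)
      define S where "S = (\<lambda>x. (B x, a x, b x)) ` F"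
      have "f \<in> cyl (tests S)" using cont Bab(6) by (auto simp: cyl_def tests_def S_def)
      moreover have "cyl (tests S) \<subseteq> C_ball k f e"
      proof
        fix g assume g: "g \<in> cyl (tests S)"
        then have contg: "continuous_on UNIV g" by (simp add: cyl_def)
        have "\<bar>g y - f y\<bar> \<le> e / 2" if "norm y \<le> real k" for y
        proof -
          obtain x where x: "x \<in> F" "y \<in> B x" using F(3) \<open>norm y \<le> real k\<close> by (auto simp: subset_iff)
          have "a x \<le> g y \<and> g y \<le> b x"
          proof (rule ccontr)
            assume "\<not> ?thesis"
            then have "y \<in> B x \<inter> (g -` {..<a x} \<union> g -` {b x<..})" using x by auto
            moreover have "open (B x \<inter> (g -` {..<a x} \<union> g -` {b x<..}))"
              using contg by (intro open_Int openB open_Un open_vimage) auto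
            ultimately obtain d where "d \<in> D" "d \<in> B x" "g d < a x \<or> b x < g d"
              using D(2)[of "B x \<inter> (g -` {..<a x} \<union> g -` {b x<..})"] by auto
            moreover have "a x \<le> g d \<and> g d \<le> b x"
              using g x(1) calculation(1,2) by (auto simp: cyl_def tests_def S_def)
            ultimately show False by auto
          qed
          then show ?thesis using Bab(6)[OF x(2)] Bab(5)[of x] by linarith
        qed
        then have "ball_seminorm k (\<lambda>x. g x - f x) \<le> e / 2" by (rule ball_seminorm_least)
        then show "g \<in> C_ball k f e" using e contg by (simp add: C_ball_def)
      qed
      moreover have "finite S" "S \<subseteq> \<B> \<times> \<rat> \<times> \<rat>" using F Bab by (auto simp: S_def)
      ultimately have "S \<in> \<S>" using sub by (auto simp: \<S>_def)
      then show "f \<in> (\<Union>J\<in>tests ` \<S>. cyl J)" using \<open>f \<in> cyl (tests S)\<close> by blast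
    qed
    show "(\<Union>J\<in>tests ` \<S>. cyl J) \<subseteq> U" by (auto simp: \<S>_def)
  qed
  ultimately show thesis using that unfolding cyl_def by blast
qed

lemma space_borel_of_topology [simp]: "space (borel_of_topology T) = topspace T"
  by (simp add: borel_of_topology_def space_measure_of_conv)

lemma sets_borel_of_topology: "sets (borel_of_topology T) = sigma_sets (topspace T) {U. openin T U}"
  unfolding borel_of_topology_def by (rule sets_measure_of) (auto dest: openin_subset)

lemma borel_measurable_continuous_map:
  assumes "continuous_map T euclideanreal \<phi>"
  shows "\<phi> \<in> borel_measurable (borel_of_topology T)"
proof (rule borel_measurableI)
  fix S :: "real set" assume "open S"
  then have "openin T {h \<in> topspace T. \<phi> h \<in> S}" using assms by (simp add: continuous_map_def)
  moreover have "\<phi> -` S \<inter> space (borel_of_topology T) = {h \<in> topspace T. \<phi> h \<in> S}" by auto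
  ultimately show "\<phi> -` S \<inter> space (borel_of_topology T) \<in> sets (borel_of_topology T)"
    by (auto simp: sets_borel_of_topology)
qed

lemma ball_seminorm_measurable:
  "ball_seminorm k \<in> borel_measurable (borel_of_topology (C_topology :: ('a::euclidean_space \<Rightarrow> real) topology))"
proof (subst borel_measurable_iff_less, rule allI)
  fix e
  have "{f \<in> space (borel_of_topology C_topology). ball_seminorm k f < e}
      = (if e > 0 then C_ball k (\<lambda>_::'a. 0) e else {})"
    using ball_seminorm_nonneg[of _ k] by (force simp: C_ball_def topspace_C_topology)
  also have "\<dots> \<in> sets (borel_of_topology C_topology)"
    by (auto simp: sets_borel_of_topology intro!: sigma_sets.Basic openin_C_ball sigma_sets.Empty)
  finally show "{f \<in> space (borel_of_topology (C_topology :: ('a \<Rightarrow> real) topology)). ball_seminorm k f < e}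
      \<in> sets (borel_of_topology C_topology)" .
qed

lemma evaluation_measurable:
  "(\<lambda>f. f x) \<in> borel_measurable (borel_of_topology (C_topology :: ('a::euclidean_space \<Rightarrow> real) topology))"
proof (subst borel_measurable_iff_less, rule allI)
  fix r :: real
  let ?V = "{f \<in> space (borel_of_topology (C_topology :: ('a \<Rightarrow> real) topology)). f x < r}"
  have "openin C_topology ?V"
  proof (subst openin_subopen, rule ballI)
    fix f assume f: "f \<in> ?V"
    then have cont: "continuous_on UNIV f" by (simp add: topspace_C_topology)
    obtain k where k: "norm x \<le> real k" using real_arch_simple by blast
    have "g x < r" if "g \<in> C_ball k f (r - f x)" for g
    proof -
      have "continuous_on UNIV (\<lambda>x. g x - f x)" using that cont by (auto simp: C_ball_def intro: continuous_on_diff)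
      from ball_seminorm_upper[OF this k] have "\<bar>g x - f x\<bar> \<le> ball_seminorm k (\<lambda>x. g x - f x)" .
      moreover have "ball_seminorm k (\<lambda>x. g x - f x) < r - f x" using that by (simp add: C_ball_def)
      ultimately show ?thesis by linarith
    qed
    moreover have "f \<in> C_ball k f (r - f x)"
      using f cont ball_seminorm_least[of k "\<lambda>x. f x - f x" 0] by (auto simp: C_ball_def)
    ultimately show "\<exists>T. openin C_topology T \<and> f \<in> T \<and> T \<subseteq> ?V"
      using openin_C_ball[OF cont, of "r - f x" k] f
      by (intro exI[of _ "C_ball k f (r - f x)"]) (auto simp: C_ball_def topspace_C_topology)
  qed
  then show "?V \<in> sets (borel_of_topology C_topology)" by (simp add: sets_borel_of_topology)
qed

text \<open>In other words, the Borel sets are generated by the evaluations: the preimage of an open set is a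
  countable union of sets defined by countably many measurable conditions.\<close>

lemma measurable_into_C_topology:
  fixes h :: "'w \<Rightarrow> 'a::euclidean_space \<Rightarrow> real"
  assumes h: "\<And>x. (\<lambda>\<omega>. h \<omega> x) \<in> borel_measurable M"
    and cont: "\<And>\<omega>. \<omega> \<in> space M \<Longrightarrow> continuous_on UNIV (h \<omega>)"
  shows "h \<in> measurable M (borel_of_topology C_topology)"
  unfolding borel_of_topology_def
proof (rule measurable_measure_of)
  show "h \<in> space M \<rightarrow> topspace C_topology" using cont by (auto simp: topspace_C_topology)
  fix U :: "('a \<Rightarrow> real) set" assume "U \<in> {U. openin C_topology U}"
  then have "openin C_topology U" by simp
  then obtain \<J> :: "('a \<times> real \<times> real) set set" where \<J>: "countable \<J>" "\<And>J. J \<in> \<J> \<Longrightarrow> countable J"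
    and U: "U = (\<Union>J\<in>\<J>. {g. continuous_on UNIV g \<and> (\<forall>(x, a, b)\<in>J. a \<le> g x \<and> g x \<le> b)})"
    by (rule openin_C_topology_countable_cylinders) blast
  have "{\<omega>\<in>space M. \<forall>j\<in>J. fst (snd j) \<le> h \<omega> (fst j) \<and> h \<omega> (fst j) \<le> snd (snd j)} \<in> sets M" if "J \<in> \<J>" for J
    using \<J>(2)[OF that] h
    by (intro sets.sets_Collect_countable_All' sets.sets_Collect_conj borel_measurable_le) auto
  then have "(\<Union>J\<in>\<J>. {\<omega>\<in>space M. \<forall>j\<in>J. fst (snd j) \<le> h \<omega> (fst j) \<and> h \<omega> (fst j) \<le> snd (snd j)}) \<in> sets M"
    using \<J>(1) by (intro sets.countable_UN') auto
  moreover have "h -` U \<inter> space M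
      = (\<Union>J\<in>\<J>. {\<omega>\<in>space M. \<forall>j\<in>J. fst (snd j) \<le> h \<omega> (fst j) \<and> h \<omega> (fst j) \<le> snd (snd j)})"
    using cont unfolding U by (auto simp: split_beta)
  ultimately show "h -` U \<inter> space M \<in> sets M" by simp
qed (auto dest: openin_subset)

text \<open>The finite-dimensional cylinders form an intersection-stable generator of the Borel sets, and
  their probabilities are determined by the characteristic functions of linear combinations.\<close>

lemma gaussian_law_unique:
  fixes \<mu> \<nu> :: "('a::euclidean_space \<Rightarrow> real) measure"
  assumes \<mu>: "gaussian_on UNIV \<mu> (\<lambda>x f. f x) K" "sets \<mu> = sets (borel_of_topology C_topology)"
    and \<nu>: "gaussian_on UNIV \<nu> (\<lambda>x f. f x) K" "sets \<nu> = sets (borel_of_topology C_topology)"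
  shows "\<mu> = \<nu>"
proof -
  let ?\<Omega> = "{f :: 'a \<Rightarrow> real. continuous_on UNIV f}"
  define cyl where "cyl F A = {f \<in> ?\<Omega>. \<forall>x\<in>F. f x \<in> A x}" for F :: "'a set" and A :: "'a \<Rightarrow> real set"
  define E where "E = {cyl F A | F A. finite F \<and> (\<forall>x. A x \<in> sets borel)}"
  interpret \<mu>: prob_space \<mu> by (rule gaussian_on_prob_space[OF \<mu>(1)])
  interpret \<nu>: prob_space \<nu> by (rule gaussian_on_prob_space[OF \<nu>(1)])
  have space: "space \<mu> = ?\<Omega>" "space \<nu> = ?\<Omega>"
    using \<mu>(2) \<nu>(2) by (auto dest!: sets_eq_imp_space_eq simp: topspace_C_topology)
  have ev\<mu> [measurable]: "(\<lambda>f. f x) \<in> borel_measurable \<mu>" and ev\<nu> [measurable]: "(\<lambda>f. f x) \<in> borel_measurable \<nu>" for x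
    by (rule gaussian_on_measurable[OF \<mu>(1) UNIV_I], rule gaussian_on_measurable[OF \<nu>(1) UNIV_I])
  have "emeasure \<mu> (cyl F A) = emeasure \<nu> (cyl F A)" if F: "finite F" and A: "\<And>x. A x \<in> sets borel" for F A
  proof -
    obtain q where q: "bij_betw q {0..<card F} F" using ex_bij_betw_nat_finite[OF F] by blast
    have cyl: "indicator (cyl F A) f = (\<Prod>i<card F. indicator (A (q i)) (f (q i)) :: real)" if "f \<in> ?\<Omega>" for f
    proof -
      have "(\<Prod>i<card F. indicator (A (q i)) (f (q i))) = (\<Prod>x\<in>F. indicator (A x) (f x) :: real)"
        using prod.reindex_bij_betw[OF q, of "\<lambda>x. indicator (A x) (f x)"] by (simp add: lessThan_atLeast0)
      also have "\<dots> = (if \<forall>x\<in>F. f x \<in> A x then 1 else 0)"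
        using F by (auto simp: indicator_def intro!: prod.neutral)
      finally show ?thesis using that by (simp add: cyl_def indicator_def)
    qed
    have "(CLINT f|\<mu>. iexp (\<Sum>i<n. a i * f (p i))) = (CLINT f|\<nu>. iexp (\<Sum>i<n. a i * f (p i)))"
      for n and a :: "nat \<Rightarrow> real" and p
      by (simp only: gaussian_on_char[OF \<mu>(1) UNIV_I] gaussian_on_char[OF \<nu>(1) UNIV_I])
    from joint_law_eq_mixed[where X = "\<lambda>x f. f x" and Y = "\<lambda>x f. f x" and n = 0 and A = "\<lambda>i. A (q i)" and q = q and k = "card F",
        OF \<mu>.prob_space_axioms \<nu>.prob_space_axioms ev\<mu> ev\<nu> this A]
    have "(LINT f|\<mu>. (\<Prod>i<card F. indicator (A (q i)) (f (q i)) :: real))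
        = (LINT f|\<nu>. (\<Prod>i<card F. indicator (A (q i)) (f (q i))))"
      by (simp del: of_real_prod)
    moreover have "(LINT f|\<mu>. (\<Prod>i<card F. indicator (A (q i)) (f (q i)) :: real)) = (LINT f|\<mu>. indicator (cyl F A) f)"
      by (intro Bochner_Integration.integral_cong) (auto simp: space cyl)
    moreover have "(LINT f|\<nu>. (\<Prod>i<card F. indicator (A (q i)) (f (q i)) :: real)) = (LINT f|\<nu>. indicator (cyl F A) f)"
      by (intro Bochner_Integration.integral_cong) (auto simp: space cyl)
    moreover have "cyl F A \<inter> ?\<Omega> = cyl F A" by (auto simp: cyl_def)
    ultimately show ?thesis by (simp add: \<mu>.emeasure_eq_measure \<nu>.emeasure_eq_measure space)
  qed
  moreover have "sets (borel_of_topology C_topology) = sigma_sets ?\<Omega> E"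
  proof (rule subset_antisym)
    have "(\<lambda>f. f x) \<in> borel_measurable (sigma ?\<Omega> E)" for x
    proof (rule measurableI)
      fix A :: "real set" assume "A \<in> sets borel"
      then have "cyl {x} (\<lambda>_. A) \<in> E" unfolding E_def by blast
      moreover have "(\<lambda>f. f x) -` A \<inter> space (sigma ?\<Omega> E) = cyl {x} (\<lambda>_. A)"
        by (auto simp: cyl_def space_measure_of_conv)
      moreover have "E \<subseteq> Pow ?\<Omega>" by (auto simp: E_def cyl_def)
      ultimately show "(\<lambda>f. f x) -` A \<inter> space (sigma ?\<Omega> E) \<in> sets (sigma ?\<Omega> E)" by auto
    qed simp
    then have id: "(\<lambda>f. f) \<in> measurable (sigma ?\<Omega> E) (borel_of_topology C_topology)"
      by (intro measurable_into_C_topology) (auto simp: space_measure_of_conv)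
    have E: "E \<subseteq> Pow ?\<Omega>" by (auto simp: E_def cyl_def)
    show "sets (borel_of_topology C_topology) \<subseteq> sigma_sets ?\<Omega> E"
    proof
      fix B :: "('a \<Rightarrow> real) set" assume B: "B \<in> sets (borel_of_topology C_topology)"
      then have "B \<subseteq> ?\<Omega>" using sets.sets_into_space[OF B] by (simp add: topspace_C_topology)
      then show "B \<in> sigma_sets ?\<Omega> E"
        using measurable_sets[OF id B] E by (simp add: space_measure_of_conv Int_absorb2)
    qed
    have "cyl F A \<in> sets \<mu>" if "finite F" "\<And>x. A x \<in> sets borel" for F A
    proof -
      have "{f \<in> space \<mu>. \<forall>x\<in>F. f x \<in> A x} \<in> sets \<mu>"
        using that by (intro sets.sets_Collect_countable_All' countable_finite) auto
      then show ?thesis by (simp add: cyl_def space)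
    qed
    then have "E \<subseteq> sets \<mu>" by (auto simp: E_def)
    then show "sigma_sets ?\<Omega> E \<subseteq> sets (borel_of_topology C_topology)"
      using sets.sigma_sets_subset[of E \<mu>] by (simp add: space \<mu>(2))
  qed
  moreover have "Int_stable E"
  proof (rule Int_stableI)
    fix S S' assume "S \<in> E" "S' \<in> E"
    then obtain F A F' A' where "S = cyl F A" "finite F" "\<And>x. A x \<in> sets borel"
      "S' = cyl F' A'" "finite F'" "\<And>x. A' x \<in> sets borel" unfolding E_def by blast
    moreover have "cyl F A \<inter> cyl F' A'
        = cyl (F \<union> F') (\<lambda>x. (if x \<in> F then A x else UNIV) \<inter> (if x \<in> F' then A' x else UNIV))"
      by (auto simp: cyl_def)
    ultimately show "S \<inter> S' \<in> E" unfolding E_def by (auto intro!: exI)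
  qed
  moreover have "?\<Omega> \<in> E"
    unfolding E_def by (auto simp: cyl_def intro!: exI[of _ "{}"] exI[of _ "\<lambda>_. UNIV"])
  ultimately show ?thesis
    using \<mu>(2) \<nu>(2)
    by (intro measure_eqI_generator_eq[of E ?\<Omega> \<mu> \<nu> "\<lambda>_. ?\<Omega>"]) (auto simp: E_def cyl_def)
qed

section \<open>Chaining along dyadic grids\<close>

definition gridpt :: "nat \<Rightarrow> ('a \<Rightarrow> int) \<Rightarrow> 'a::euclidean_space" where
  "gridpt m u = (\<Sum>b\<in>Basis. (of_int (u b) / 2 ^ m) *\<^sub>R b)"

definition dyadic_points :: "'a::euclidean_space set" where
  "dyadic_points = (\<Union>m. range (gridpt m))"

definition dyadic_floor :: "nat \<Rightarrow> 'a \<Rightarrow> 'a::euclidean_space" where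
  "dyadic_floor m x = gridpt m (\<lambda>b. \<lfloor>2 ^ m * (x \<bullet> b)\<rfloor>)"

definition cube :: "nat \<Rightarrow> 'a::euclidean_space set" where
  "cube N = {x. \<forall>b\<in>Basis. \<bar>x \<bullet> b\<bar> \<le> real N}"

lemma gridpt_inner [simp]: "b \<in> Basis \<Longrightarrow> gridpt m u \<bullet> b = of_int (u b) / 2 ^ m"
  unfolding gridpt_def by (simp add: inner_sum_left_Basis)

lemma gridpt_cong: "(\<And>b. b \<in> Basis \<Longrightarrow> u b = v b) \<Longrightarrow> gridpt m u = gridpt m v"
  unfolding gridpt_def by (intro sum.cong) auto

lemma dyadic_floor_in_dyadic [simp]: "dyadic_floor m x \<in> dyadic_points"
  unfolding dyadic_floor_def dyadic_points_def by auto

lemma countable_dyadic_points: "countable (dyadic_points :: 'a::euclidean_space set)"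
proof -
  have "countable (range (gridpt m :: _ \<Rightarrow> 'a))" for m
  proof -
    have "range (gridpt m :: _ \<Rightarrow> 'a) = gridpt m ` (PiE Basis (\<lambda>_. UNIV))"
    proof (intro subset_antisym subsetI)
      fix x :: 'a assume "x \<in> range (gridpt m)"
      then obtain u where "x = gridpt m u" by auto
      then have "x = gridpt m (restrict u Basis)" by (auto intro: gridpt_cong)
      then show "x \<in> gridpt m ` (PiE Basis (\<lambda>_. UNIV))" by (auto intro!: imageI)
    qed auto
    also have "countable \<dots>" by (intro countable_image countable_PiE) auto
    finally show ?thesis .
  qed
  then show ?thesis unfolding dyadic_points_def by (intro countable_UN) auto
qed

lemma dyadic_floor_coord:
  assumes "b \<in> Basis"
  shows "dyadic_floor m x \<bullet> b \<le> x \<bullet> b" "x \<bullet> b < dyadic_floor m x \<bullet> b + 1 / 2 ^ m"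
proof -
  have "of_int \<lfloor>2 ^ m * (x \<bullet> b)\<rfloor> \<le> 2 ^ m * (x \<bullet> b)" "2 ^ m * (x \<bullet> b) < of_int \<lfloor>2 ^ m * (x \<bullet> b)\<rfloor> + 1"
    by linarith+
  then show "dyadic_floor m x \<bullet> b \<le> x \<bullet> b" "x \<bullet> b < dyadic_floor m x \<bullet> b + 1 / 2 ^ m"
    using assms by (simp_all add: dyadic_floor_def field_simps)
qed

lemma norm_le_DIM_times:
  fixes z :: "'a::euclidean_space"
  assumes "\<And>b. b \<in> Basis \<Longrightarrow> \<bar>z \<bullet> b\<bar> \<le> r"
  shows "norm z \<le> real DIM('a) * r"
proof -
  have "norm z \<le> (\<Sum>b\<in>Basis. \<bar>z \<bullet> b\<bar>)" by (rule norm_le_l1)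
  also have "\<dots> \<le> (\<Sum>b\<in>(Basis :: 'a set). r)" by (intro sum_mono assms)
  finally show ?thesis by simp
qed

lemma dyadic_floor_tendsto: "(\<lambda>m. dyadic_floor m x) \<longlonglongrightarrow> x"
proof (rule LIM_zero_cancel[OF Lim_null_comparison])
  show "\<forall>\<^sub>F m in sequentially. norm (dyadic_floor m x - x) \<le> real DIM('a) * (1 / 2) ^ m"
  proof (intro always_eventually allI norm_le_DIM_times)
    fix m and b :: 'a assume "b \<in> Basis"
    from dyadic_floor_coord[OF this, where m = m and x = x] show "\<bar>(dyadic_floor m x - x) \<bullet> b\<bar> \<le> (1 / 2) ^ m"
      by (simp add: inner_diff_left power_one_over)
  qed
  show "(\<lambda>m. real DIM('a) * (1 / 2) ^ m) \<longlonglongrightarrow> 0"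
    by (intro tendsto_mult_right_zero LIMSEQ_realpow_zero) auto
qed

lemma dyadic_floor_dyadic:
  fixes x :: "'a::euclidean_space"
  assumes "x \<in> dyadic_points"
  obtains m where "\<And>k. k \<ge> m \<Longrightarrow> dyadic_floor k x = x"
proof -
  obtain m u where x: "x = gridpt m u" using assms unfolding dyadic_points_def by auto
  have "dyadic_floor k x = x" if "k \<ge> m" for k
  proof (rule euclidean_eqI)
    fix b :: 'a assume b: "b \<in> Basis"
    have "(2 :: real) ^ k = 2 ^ (k - m) * 2 ^ m" using that by (simp flip: power_add)
    then have k: "2 ^ k * (x \<bullet> b) = of_int (u b * 2 ^ (k - m))"
      using b by (simp add: x)
    then have "\<lfloor>2 ^ k * (x \<bullet> b)\<rfloor> = u b * 2 ^ (k - m)" by (simp only: floor_of_int)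
    then have "dyadic_floor k x \<bullet> b = of_int (u b * 2 ^ (k - m)) / 2 ^ k"
      using b by (simp add: dyadic_floor_def)
    also have "\<dots> = x \<bullet> b" unfolding k[symmetric] by simp
    finally show "dyadic_floor k x \<bullet> b = x \<bullet> b" .
  qed
  then show thesis by (rule that)
qed

lemma dyadic_floor_in_cube:
  "x \<in> cube N \<Longrightarrow> dyadic_floor m x \<in> cube (Suc N)"
  unfolding cube_def
proof (intro CollectI ballI)
  fix b :: 'a assume x: "x \<in> {x. \<forall>b\<in>Basis. \<bar>x \<bullet> b\<bar> \<le> real N}" and b: "b \<in> Basis"
  have "(1 :: real) / 2 ^ m \<le> 1" by simp
  moreover have "\<bar>x \<bullet> b\<bar> \<le> real N" using x b by auto
  ultimately show "\<bar>dyadic_floor m x \<bullet> b\<bar> \<le> real (Suc N)"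
    using dyadic_floor_coord[OF b, where m = m and x = x] by linarith
qed

lemma dyadic_floor_close:
  fixes x :: "'a::euclidean_space"
  assumes "j \<le> m" "j \<le> k" "b \<in> Basis"
  shows "\<bar>dyadic_floor m x \<bullet> b - dyadic_floor k x \<bullet> b\<bar> \<le> 1 / 2 ^ j"
proof -
  have "(1 :: real) / 2 ^ m \<le> 1 / 2 ^ j" "(1 :: real) / 2 ^ k \<le> 1 / 2 ^ j"
    using assms by (auto intro!: divide_left_mono power_increasing)
  then show ?thesis
    using dyadic_floor_coord[OF assms(3), where m = m and x = x] dyadic_floor_coord[OF assms(3), where m = k and x = x] by linarith
qed

lemma finite_dyadic_floor_cube: "finite (dyadic_floor m ` (cube N :: 'a::euclidean_space set))"
proof (rule finite_subset)
  \<comment> \<open>rounding down may leave the cube by less than one grid step\<close>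
  show "finite (gridpt m ` PiE (Basis :: 'a set) (\<lambda>_. {- (int N + 1) * 2 ^ m .. (int N + 1) * 2 ^ m}))"
    by (intro finite_imageI finite_PiE) auto
  show "dyadic_floor m ` cube N \<subseteq> gridpt m ` PiE (Basis :: 'a set) (\<lambda>_. {- (int N + 1) * 2 ^ m .. (int N + 1) * 2 ^ m})"
  proof (rule image_subsetI)
    fix x :: 'a assume x: "x \<in> cube N"
    have "dyadic_floor m x = gridpt m (\<lambda>b\<in>Basis. \<lfloor>2 ^ m * (x \<bullet> b)\<rfloor>)"
      unfolding dyadic_floor_def by (rule gridpt_cong) auto
    moreover have "\<lfloor>2 ^ m * (x \<bullet> b)\<rfloor> \<in> {- (int N + 1) * 2 ^ m .. (int N + 1) * 2 ^ m}" if b: "b \<in> Basis" for b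
    proof -
      have "\<bar>dyadic_floor m x \<bullet> b\<bar> \<le> real (Suc N)"
        using dyadic_floor_in_cube[OF x, of m] b by (auto simp: cube_def)
      then have "\<bar>of_int \<lfloor>2 ^ m * (x \<bullet> b)\<rfloor>\<bar> \<le> (real_of_int ((int N + 1) * 2 ^ m))"
        using b by (simp add: dyadic_floor_def divide_le_eq add.commute)
      then have "\<bar>\<lfloor>2 ^ m * (x \<bullet> b)\<rfloor>\<bar> \<le> (int N + 1) * 2 ^ m"
        by (simp only: of_int_abs[symmetric] of_int_le_iff)
      then show ?thesis unfolding atLeastAtMost_iff mult_minus_left by (intro conjI; linarith)
    qed
    ultimately show "dyadic_floor m x \<in> gridpt m ` PiE Basis (\<lambda>_. {- (int N + 1) * 2 ^ m .. (int N + 1) * 2 ^ m})"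
      by (intro image_eqI) auto
  qed
qed

text \<open>The first point of a pair of neighbours lies in the cube, the second one may leave it. In this way
  the pairs are indexed by a product of two sets of easily computed size.\<close>

definition small_grid_steps :: "real \<Rightarrow> nat \<Rightarrow> nat \<Rightarrow> ('a::euclidean_space \<Rightarrow> real) \<Rightarrow> bool" where
  "small_grid_steps \<theta> N m f \<longleftrightarrow>
     (\<forall>u\<in>PiE Basis (\<lambda>_. {- (int N * 2 ^ m) .. int N * 2 ^ m}). \<forall>h\<in>PiE Basis (\<lambda>_. {- 1 .. 1}).
        \<bar>f (gridpt m u) - f (gridpt m (\<lambda>b. u b + h b))\<bar> \<le> \<theta> ^ m)"

lemma small_grid_stepsD:
  assumes f: "small_grid_steps \<theta> N m f"
    and u: "\<And>b. b \<in> Basis \<Longrightarrow> \<bar>u b\<bar> \<le> int N * 2 ^ m"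
    and v: "\<And>b. b \<in> Basis \<Longrightarrow> \<bar>v b - u b\<bar> \<le> 1"
  shows "\<bar>f (gridpt m u) - f (gridpt m v)\<bar> \<le> \<theta> ^ m"
proof -
  have "restrict u Basis \<in> PiE Basis (\<lambda>_. {- (int N * 2 ^ m) .. int N * 2 ^ m})"
    using u by (auto simp: abs_le_iff) (metis minus_le_iff)
  moreover have "(\<lambda>b\<in>Basis. v b - u b) \<in> PiE Basis (\<lambda>_. {- 1 .. 1})"
  proof (intro restrict_PiE_iff[THEN iffD2] ballI)
    fix b :: 'a assume "b \<in> Basis"
    from v[OF this] show "v b - u b \<in> {- 1 .. 1}" unfolding atLeastAtMost_iff by (intro conjI; linarith)
  qed
  ultimately have "\<bar>f (gridpt m (restrict u Basis)) - f (gridpt m (\<lambda>b. restrict u Basis b + (\<lambda>b\<in>Basis. v b - u b) b))\<bar> \<le> \<theta> ^ m"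
    using f unfolding small_grid_steps_def by blast
  moreover have "gridpt m (restrict u Basis) = gridpt m u" by (rule gridpt_cong) auto
  moreover have "gridpt m (\<lambda>b. restrict u Basis b + (\<lambda>b\<in>Basis. v b - u b) b) = gridpt m v"
    by (rule gridpt_cong) auto
  ultimately show ?thesis by simp
qed

lemma floor_le_if_in_cube:
  fixes x :: "'a::euclidean_space"
  assumes x: "x \<in> cube N" and b: "b \<in> Basis"
  shows "\<bar>\<lfloor>2 ^ m * (x \<bullet> b)\<rfloor>\<bar> \<le> int N * 2 ^ m"
proof -
  have "\<bar>2 ^ m * (x \<bullet> b)\<bar> \<le> 2 ^ m * real N"
    using x b by (auto simp: cube_def abs_mult)
  then have "2 ^ m * (x \<bullet> b) \<le> real_of_int (int N * 2 ^ m)" "real_of_int (- (int N * 2 ^ m)) \<le> 2 ^ m * (x \<bullet> b)"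
    by (auto simp: abs_le_iff mult.commute)
  then have "- (int N * 2 ^ m) \<le> \<lfloor>2 ^ m * (x \<bullet> b)\<rfloor>" "\<lfloor>2 ^ m * (x \<bullet> b)\<rfloor> \<le> int N * 2 ^ m"
    by linarith+
  then show ?thesis by linarith
qed

text \<open>The points \<open>dyadic_floor j x\<close> and \<open>dyadic_floor (j + 1) x\<close> are neighbours on the finer of the
  two grids, so that the distance from \<open>f (dyadic_floor m x)\<close> to \<open>f x\<close> is controlled by a geometric
  series; the two chains ending at \<open>x\<close> and at \<open>y\<close> are joined by one step on the grid of level \<open>m\<close>.\<close>

lemma chain_to_floor:
  fixes x :: "'a::euclidean_space"
  assumes \<theta>: "0 < \<theta>" "\<theta> < 1" and steps: "\<And>j. j \<ge> m \<Longrightarrow> small_grid_steps \<theta> N j f"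
    and x: "x \<in> cube N"
  shows "\<bar>f (dyadic_floor (m + k) x) - f (dyadic_floor m x)\<bar> \<le> (\<theta> ^ (m + 1) - \<theta> ^ (m + k + 1)) / (1 - \<theta>)"
proof (induction k)
  case (Suc k)
  let ?j = "m + k"
  \<comment> \<open>the point of the coarser grid, written on the finer grid\<close>
  have coarse: "dyadic_floor ?j x = gridpt (Suc ?j) (\<lambda>b. 2 * \<lfloor>2 ^ ?j * (x \<bullet> b)\<rfloor>)"
    by (rule euclidean_eqI) (simp add: dyadic_floor_def)
  have "\<bar>f (dyadic_floor (Suc ?j) x) - f (dyadic_floor ?j x)\<bar> \<le> \<theta> ^ Suc ?j"
    unfolding coarse unfolding dyadic_floor_def
  proof (rule small_grid_stepsD[OF steps floor_le_if_in_cube[OF x]])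
    fix b :: 'a
    have "2 ^ Suc ?j * (x \<bullet> b) = 2 * (2 ^ ?j * (x \<bullet> b))" by simp
    then show "\<bar>2 * \<lfloor>2 ^ ?j * (x \<bullet> b)\<rfloor> - \<lfloor>2 ^ Suc ?j * (x \<bullet> b)\<rfloor>\<bar> \<le> 1" by linarith
  qed auto
  moreover have "(\<theta> ^ (m + 1) - \<theta> ^ (m + k + 1)) / (1 - \<theta>) + \<theta> ^ Suc ?j
      = (\<theta> ^ (m + 1) - \<theta> ^ (m + Suc k + 1)) / (1 - \<theta>)"
    using \<theta> by (simp add: field_simps)
  ultimately show ?case using Suc.IH unfolding add_Suc_right by linarith
qed simp

lemma chaining_modulus:
  fixes x y :: "'a::euclidean_space"
  assumes \<theta>: "0 < \<theta>" "\<theta> < 1" and steps: "\<And>j. j \<ge> m \<Longrightarrow> small_grid_steps \<theta> N j f"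
    and x: "x \<in> dyadic_points \<inter> cube N" and y: "y \<in> dyadic_points \<inter> cube N"
    and close: "\<And>b. b \<in> Basis \<Longrightarrow> \<bar>x \<bullet> b - y \<bullet> b\<bar> \<le> 1 / 2 ^ m"
  shows "\<bar>f x - f y\<bar> \<le> 3 * \<theta> ^ m / (1 - \<theta>)"
proof -
  have chain: "\<bar>f z - f (dyadic_floor m z)\<bar> \<le> \<theta> ^ m / (1 - \<theta>)" if z: "z \<in> dyadic_points \<inter> cube N" for z
  proof -
    obtain k where k: "\<And>i. i \<ge> k \<Longrightarrow> dyadic_floor i z = z"
      using dyadic_floor_dyadic[of z] z by blast
    have "\<bar>f z - f (dyadic_floor m z)\<bar> \<le> (\<theta> ^ (m + 1) - \<theta> ^ (m + k + 1)) / (1 - \<theta>)"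
      using chain_to_floor[OF \<theta> steps, of m z k] z k[of "m + k"] by simp
    also have "\<dots> \<le> \<theta> ^ m / (1 - \<theta>)"
    proof (rule divide_right_mono)
      have "\<theta> ^ (m + 1) \<le> \<theta> ^ m" using \<theta> by (intro power_decreasing) auto
      moreover have "\<theta> ^ (m + k + 1) \<ge> 0" using \<theta> by simp
      ultimately show "\<theta> ^ (m + 1) - \<theta> ^ (m + k + 1) \<le> \<theta> ^ m" by linarith
    qed (use \<theta> in simp)
    finally show ?thesis .
  qed
  have "\<bar>f (dyadic_floor m x) - f (dyadic_floor m y)\<bar> \<le> \<theta> ^ m"
    unfolding dyadic_floor_def
  proof (rule small_grid_stepsD[OF steps])
    fix b :: 'a assume b: "b \<in> Basis"
    show "\<bar>\<lfloor>2 ^ m * (x \<bullet> b)\<rfloor>\<bar> \<le> int N * 2 ^ m"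
      using x b by (intro floor_le_if_in_cube) auto
    have "\<bar>2 ^ m * (x \<bullet> b) - 2 ^ m * (y \<bullet> b)\<bar> = 2 ^ m * \<bar>x \<bullet> b - y \<bullet> b\<bar>"
      by (simp add: right_diff_distrib[symmetric] abs_mult)
    also have "\<dots> \<le> 1" using close[OF b] by (simp add: field_simps)
    finally show "\<bar>\<lfloor>2 ^ m * (y \<bullet> b)\<rfloor> - \<lfloor>2 ^ m * (x \<bullet> b)\<rfloor>\<bar> \<le> 1" by linarith
  qed simp
  moreover have "\<theta> ^ m \<le> \<theta> ^ m / (1 - \<theta>)"
    using \<theta> by (simp add: le_divide_eq mult_left_le)
  ultimately show ?thesis using chain[OF x] chain[OF y] by simp
qed

text \<open>The three terms of the bound are the two chains and the step that joins them. All levels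
  \<open>j \<ge> m\<close> occur, so that membership in one event gives uniform continuity on the cube.\<close>

definition dyadic_regular :: "real \<Rightarrow> nat \<Rightarrow> nat \<Rightarrow> ('a::euclidean_space \<Rightarrow> real) \<Rightarrow> bool" where
  "dyadic_regular \<theta> N m f \<longleftrightarrow>
     (\<forall>j\<ge>m. \<forall>x\<in>dyadic_points \<inter> cube N. \<forall>y\<in>dyadic_points \<inter> cube N.
        (\<forall>b\<in>Basis. \<bar>x \<bullet> b - y \<bullet> b\<bar> \<le> 1 / 2 ^ j) \<longrightarrow> \<bar>f x - f y\<bar> \<le> 3 * \<theta> ^ j / (1 - \<theta>))"

lemma small_grid_steps_imp_dyadic_regular:
  assumes "0 < \<theta>" "\<theta> < 1" "\<And>j. j \<ge> m \<Longrightarrow> small_grid_steps \<theta> N j f"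
  shows "dyadic_regular \<theta> N m f"
  unfolding dyadic_regular_def using chaining_modulus[OF assms(1,2)] assms(3)
  by (meson order_trans)

lemma exists_cube_superset:
  obtains N :: nat where "N > 0" "cball (0 :: 'a::euclidean_space) r \<subseteq> cube N"
proof -
  obtain N :: nat where N: "r \<le> real N" using real_arch_simple by blast
  have "cball (0 :: 'a) r \<subseteq> cube (Suc N)"
  proof
    fix x :: 'a assume "x \<in> cball 0 r"
    then have "\<bar>x \<bullet> b\<bar> \<le> real (Suc N)" if "b \<in> Basis" for b
      using Basis_le_norm[OF that, of x] N by simp
    then show "x \<in> cube (Suc N)" by (simp add: cube_def)
  qed
  then show thesis by (rule that[rotated]) simp
qed

lemma dyadic_regular_floor_Cauchy:
  assumes reg: "dyadic_regular \<theta> (Suc N) m f" and x: "x \<in> cube N" and "m \<le> j" "j \<le> k" "j \<le> l"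
  shows "\<bar>f (dyadic_floor k x) - f (dyadic_floor l x)\<bar> \<le> 3 * \<theta> ^ j / (1 - \<theta>)"
  using reg assms(3) dyadic_floor_in_cube[OF x, of k] dyadic_floor_in_cube[OF x, of l]
    dyadic_floor_close[OF assms(4,5), of _ x]
  unfolding dyadic_regular_def by simp

lemma geometric_modulus_tendsto:
  assumes "0 < \<theta>" "\<theta> < (1 :: real)"
  shows "(\<lambda>j. 3 * \<theta> ^ j / (1 - \<theta>)) \<longlonglongrightarrow> 0"
  using tendsto_divide[OF tendsto_mult[OF tendsto_const LIMSEQ_realpow_zero] tendsto_const, of \<theta> "1 - \<theta>" 3] assms
  by simp

text \<open>The values \<open>f (dyadic_floor m x)\<close> form a Cauchy sequence, and their limits inherit the modulus of
  continuity.\<close>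

lemma dyadic_regular_extension:
  fixes f :: "'a::euclidean_space \<Rightarrow> real"
  assumes \<theta>: "0 < \<theta>" "\<theta> < 1" and reg: "\<And>N. \<exists>m. dyadic_regular \<theta> N m f"
  obtains g where "continuous_on UNIV g" "\<And>x. (\<lambda>m. f (dyadic_floor m x)) \<longlonglongrightarrow> g x"
    "\<And>x. x \<in> dyadic_points \<Longrightarrow> g x = f x"
proof -
  have small: "\<exists>j\<ge>m. 3 * \<theta> ^ j / (1 - \<theta>) < e" if "e > 0" for e m
  proof -
    have "\<forall>\<^sub>F j in sequentially. 3 * \<theta> ^ j / (1 - \<theta>) < e \<and> j \<ge> m"
      using order_tendstoD(2)[OF geometric_modulus_tendsto[OF \<theta>] that] eventually_ge_at_top[of m]
      by eventually_elim auto
    then show ?thesis by (auto simp: eventually_sequentially)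
  qed
  have "convergent (\<lambda>m. f (dyadic_floor m x))" for x
  proof (rule real_Cauchy_convergent, rule CauchyI)
    fix e :: real assume "e > 0"
    obtain N where N: "x \<in> cube N" using exists_cube_superset[of "norm x"] by (metis mem_cball_0 order_refl subsetD)
    obtain m where m: "dyadic_regular \<theta> (Suc N) m f" using reg by blast
    obtain j where "j \<ge> m" "3 * \<theta> ^ j / (1 - \<theta>) < e" using small[OF \<open>e > 0\<close>] by blast
    then show "\<exists>M. \<forall>k\<ge>M. \<forall>l\<ge>M. norm (f (dyadic_floor k x) - f (dyadic_floor l x)) < e"
      using dyadic_regular_floor_Cauchy[OF m N] by (intro exI[of _ j]) (auto intro: order.strict_trans1)
  qed
  then obtain g where g: "(\<lambda>m. f (dyadic_floor m x)) \<longlonglongrightarrow> g x" for x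
    unfolding convergent_def by metis
  have "isCont g x" for x
    unfolding continuous_at_eps_delta
  proof (intro allI impI)
    fix e :: real assume "e > 0"
    obtain N where N: "cball 0 (norm x + 1) \<subseteq> (cube N :: 'a set)" using exists_cube_superset .
    obtain m where m: "dyadic_regular \<theta> (Suc N) m f" using reg by blast
    obtain j where j: "j \<ge> m" "3 * \<theta> ^ j / (1 - \<theta>) < e" using small[OF \<open>e > 0\<close>] by blast
    define d :: real where "d = 1 / 2 ^ Suc j"
    have "(1 :: real) \<le> 2 ^ Suc j" by (rule one_le_power) simp
    then have d: "d > 0" "d \<le> 1" unfolding d_def by (simp_all only: divide_le_eq_1 zero_less_divide_iff) auto
    have "\<bar>g y - g x\<bar> < e" if "dist y x < d" for y
    proof -
      have yx: "norm (y - x) < d" using that by (simp add: dist_norm)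
      then have "norm y \<le> norm x + 1" using norm_triangle_ineq2[of y x] d(2) by linarith
      then have xy: "x \<in> cube N" "y \<in> cube N" using N by auto
      have "\<bar>f (dyadic_floor k y) - f (dyadic_floor k x)\<bar> \<le> 3 * \<theta> ^ j / (1 - \<theta>)" if "k \<ge> Suc j" for k
      proof -
        have "\<bar>dyadic_floor k y \<bullet> b - dyadic_floor k x \<bullet> b\<bar> \<le> 1 / 2 ^ j" if b: "b \<in> Basis" for b
        proof -
          have "\<bar>y \<bullet> b - x \<bullet> b\<bar> \<le> norm (y - x)"
            using Basis_le_norm[OF b, of "y - x"] by (simp add: inner_diff_left)
          moreover have "(1 :: real) / 2 ^ k \<le> 1 / 2 ^ Suc j"
            using \<open>k \<ge> Suc j\<close> by (intro divide_left_mono power_increasing) auto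
          moreover have "1 / 2 ^ j = 1 / 2 ^ Suc j + 1 / (2 ^ Suc j :: real)" by simp
          ultimately show ?thesis using yx unfolding d_def
            using dyadic_floor_coord[OF b, where m = k and x = x] dyadic_floor_coord[OF b, where m = k and x = y] by linarith
        qed
        then show ?thesis using m j(1) dyadic_floor_in_cube[OF xy(1)] dyadic_floor_in_cube[OF xy(2)]
          unfolding dyadic_regular_def by auto
      qed
      then have "\<bar>g y - g x\<bar> \<le> 3 * \<theta> ^ j / (1 - \<theta>)"
        by (intro tendsto_upperbound[OF tendsto_rabs[OF tendsto_diff[OF g[of y] g[of x]]]])
          (auto simp: eventually_sequentially)
      then show ?thesis using j(2) by simp
    qed
    then show "\<exists>d>0. \<forall>y. dist y x < d \<longrightarrow> dist (g y) (g x) < e"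
      using d(1) by (auto simp: dist_real_def)
  qed
  then have "continuous_on UNIV g" by (simp add: continuous_at_imp_continuous_on)
  moreover have "g x = f x" if x: "x \<in> dyadic_points" for x
  proof -
    obtain k where k: "\<And>i. i \<ge> k \<Longrightarrow> dyadic_floor i x = x" using dyadic_floor_dyadic[OF x] by blast
    have "\<forall>\<^sub>F m in sequentially. f (dyadic_floor m x) = f x"
      using eventually_ge_at_top[of k] by eventually_elim (simp add: k)
    then have "(\<lambda>m. f (dyadic_floor m x)) \<longlonglongrightarrow> f x" by (rule tendsto_eventually)
    with g[of x] show ?thesis by (rule LIMSEQ_unique)
  qed
  ultimately show thesis using that g by blast
qed

lemma dyadic_regular_floor_approx:
  fixes f :: "'a::euclidean_space \<Rightarrow> real"
  assumes reg: "dyadic_regular \<theta> (Suc N) m f" and f: "continuous_on UNIV f" and x: "x \<in> cube N"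
  shows "\<bar>f x - f (dyadic_floor m x)\<bar> \<le> 3 * \<theta> ^ m / (1 - \<theta>)"
proof (rule tendsto_upperbound)
  have "(\<lambda>k. f (dyadic_floor k x)) \<longlonglongrightarrow> f x"
    using f by (intro continuous_on_tendsto_compose[OF f dyadic_floor_tendsto]) auto
  then show "(\<lambda>k. \<bar>f (dyadic_floor k x) - f (dyadic_floor m x)\<bar>) \<longlonglongrightarrow> \<bar>f x - f (dyadic_floor m x)\<bar>"
    by (intro tendsto_intros)
  show "\<forall>\<^sub>F k in sequentially. \<bar>f (dyadic_floor k x) - f (dyadic_floor m x)\<bar> \<le> 3 * \<theta> ^ m / (1 - \<theta>)"
    using eventually_ge_at_top[of m] by eventually_elim (rule dyadic_regular_floor_Cauchy[OF reg x], auto)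
qed simp

text \<open>Fields whose increments have the moments of order \<open>2 * (d + 1)\<close> of a Gaussian field with
  increments of variance \<open>O(\<bar>x - y\<bar>)\<close>. A power of \<open>\<bar>x - y\<bar>\<close> above the dimension \<open>d\<close> is what makes
  the number of grid points harmless.\<close>

definition increment_bound :: "real \<Rightarrow> 'w measure \<Rightarrow> ('a::euclidean_space \<Rightarrow> 'w \<Rightarrow> real) \<Rightarrow> bool" where
  "increment_bound A M X \<longleftrightarrow>
     (\<forall>x\<in>dyadic_points. X x \<in> borel_measurable M) \<and>
     (\<forall>x\<in>dyadic_points. \<forall>y\<in>dyadic_points.
        integrable M (\<lambda>\<omega>. (X x \<omega> - X y \<omega>) ^ (2 * Suc DIM('a))) \<and>
        (LINT \<omega>|M. (X x \<omega> - X y \<omega>) ^ (2 * Suc DIM('a))) \<le> A * norm (x - y) ^ Suc DIM('a))"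

lemma gridpt_in_dyadic [simp]: "gridpt m u \<in> dyadic_points"
  unfolding dyadic_points_def by auto

lemma Markov_even_power:
  fixes Z :: "'w \<Rightarrow> real"
  assumes "prob_space M" and int: "integrable M (\<lambda>\<omega>. Z \<omega> ^ (2 * q))" and Z: "Z \<in> borel_measurable M" and t: "t > 0"
  shows "measure M {\<omega> \<in> space M. \<bar>Z \<omega>\<bar> > t} \<le> (LINT \<omega>|M. Z \<omega> ^ (2 * q)) / t ^ (2 * q)"
proof -
  interpret prob_space M by fact
  have "measure M {\<omega> \<in> space M. \<bar>Z \<omega>\<bar> > t} \<le> measure M {\<omega> \<in> space M. Z \<omega> ^ (2 * q) \<ge> t ^ (2 * q)}"
  proof (rule finite_measure_mono)
    show "{\<omega> \<in> space M. \<bar>Z \<omega>\<bar> > t} \<subseteq> {\<omega> \<in> space M. Z \<omega> ^ (2 * q) \<ge> t ^ (2 * q)}"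
    proof safe
      fix \<omega> assume "t < \<bar>Z \<omega>\<bar>"
      then have "t ^ (2 * q) \<le> \<bar>Z \<omega>\<bar> ^ (2 * q)" using t by (intro power_mono) auto
      then show "t ^ (2 * q) \<le> Z \<omega> ^ (2 * q)" by (simp add: power_even_abs)
    qed
    show "{\<omega> \<in> space M. Z \<omega> ^ (2 * q) \<ge> t ^ (2 * q)} \<in> sets M" using Z by measurable
  qed
  also have "\<dots> \<le> (LINT \<omega>|M. Z \<omega> ^ (2 * q)) / t ^ (2 * q)"
    by (rule integral_Markov_inequality_measure[OF int sets.top]) (use t in auto)
  finally show ?thesis .
qed

text \<open>At level \<open>m\<close> there are at most a constant times \<open>2\<close> to the power \<open>m d\<close> pairs of neighbours. By the
  Markov inequality each of them violates the bound with probability at most a constant times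
  \<open>2\<close> to the power \<open>- m (d + 1)\<close>, times \<open>(3 / 2) ^ m\<close> because of the choice of \<open>\<theta>\<close>. What remains is
  \<open>(1 / 2 * 3 / 2) ^ m = (3 / 4) ^ m\<close>, which is summable.\<close>

lemma prob_not_small_grid_steps:
  fixes X :: "'a::euclidean_space \<Rightarrow> 'w \<Rightarrow> real"
  assumes M: "prob_space M" and X: "increment_bound A M X" and A: "A \<ge> 0" and N: "N > 0"
    and \<theta>: "0 < \<theta>" "\<theta> ^ (2 * Suc DIM('a)) = 2 / 3"
  shows "{\<omega> \<in> space M. \<not> small_grid_steps \<theta> N m (\<lambda>x. X x \<omega>)} \<in> sets M"
    and "measure M {\<omega> \<in> space M. \<not> small_grid_steps \<theta> N m (\<lambda>x. X x \<omega>)}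
      \<le> ((9 * real N) ^ DIM('a) * A * real DIM('a) ^ Suc DIM('a)) * (3 / 4) ^ m"
proof -
  interpret prob_space M by fact
  define d where "d = DIM('a)"
  define G where "G = PiE (Basis :: 'a set) (\<lambda>_. {- (int N * 2 ^ m) .. int N * 2 ^ m})"
  define H where "H = PiE (Basis :: 'a set) (\<lambda>_. {- 1 .. 1 :: int})"
  define Bad where "Bad = (\<lambda>(u, h). {\<omega> \<in> space M. \<bar>X (gridpt m u) \<omega> - X (gridpt m (\<lambda>b. u b + h b)) \<omega>\<bar> > \<theta> ^ m})"
  have fin: "finite (G \<times> H)" unfolding G_def H_def by (intro finite_cartesian_product finite_PiE) auto
  have eq: "{\<omega> \<in> space M. \<not> small_grid_steps \<theta> N m (\<lambda>x. X x \<omega>)} = (\<Union>p\<in>G \<times> H. Bad p)"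
    unfolding small_grid_steps_def Bad_def G_def H_def by (auto simp: not_le)
  have meas: "X (gridpt m u) \<in> borel_measurable M" for u
    using X by (simp add: increment_bound_def)
  have Bad: "Bad p \<in> sets M" for p
    using meas by (auto simp: Bad_def split: prod.split)
  show "{\<omega> \<in> space M. \<not> small_grid_steps \<theta> N m (\<lambda>x. X x \<omega>)} \<in> sets M"
    unfolding eq using fin Bad by auto
  have cardG: "real (card G) \<le> (3 * real N) ^ d * (2 ^ m) ^ d"
  proof -
    have "card G = (\<Prod>b\<in>(Basis :: 'a set). card {- (int N * 2 ^ m) .. int N * 2 ^ m})"
      unfolding G_def by (rule card_PiE) simp
    also have "\<dots> = (2 * N * 2 ^ m + 1) ^ d"
      by (simp add: d_def nat_add_distrib nat_mult_distrib nat_power_eq mult.assoc)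
    finally have "real (card G) = (real (2 * N * 2 ^ m + 1)) ^ d" by simp
    also have "\<dots> \<le> (3 * real N * 2 ^ m) ^ d"
    proof (rule power_mono)
      have "1 * 1 \<le> real N * 2 ^ m" using N by (intro mult_mono) auto
      then show "real (2 * N * 2 ^ m + 1) \<le> 3 * real N * 2 ^ m" by simp
    qed simp
    finally show ?thesis by (simp add: power_mult_distrib)
  qed
  have cardH: "real (card H) = 3 ^ d"
  proof -
    have "card H = (\<Prod>b\<in>(Basis :: 'a set). card {- 1 .. 1 :: int})"
      unfolding H_def by (rule card_PiE) simp
    then show ?thesis by (simp add: d_def)
  qed
  have prob_Bad: "measure M (Bad p) \<le> A * (real d / 2 ^ m) ^ Suc d / (2 / 3) ^ m" if p: "p \<in> G \<times> H" for p
  proof -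
    obtain u h where uh: "p = (u, h)" "h \<in> H" using p by auto
    let ?x = "gridpt m u" and ?y = "gridpt m (\<lambda>b. u b + h b) :: 'a"
    have "norm (?x - ?y) \<le> real DIM('a) * (1 / 2 ^ m)"
    proof (rule norm_le_DIM_times)
      fix b :: 'a assume b: "b \<in> Basis"
      have "h b \<in> {- 1 .. 1}" using uh(2) b unfolding H_def by auto
      then have h: "\<bar>real_of_int (h b)\<bar> \<le> 1" by auto
      have "(?x - ?y) \<bullet> b = - (of_int (h b) / 2 ^ m)"
        using b by (simp add: inner_diff_left add_divide_distrib)
      then show "\<bar>(?x - ?y) \<bullet> b\<bar> \<le> 1 / 2 ^ m"
        using h by (simp add: divide_right_mono)
    qed
    then have "norm (?x - ?y) ^ Suc d \<le> (real d / 2 ^ m) ^ Suc d"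
      by (intro power_mono) (auto simp: d_def)
    then have dist: "A * norm (?x - ?y) ^ Suc d \<le> A * (real d / 2 ^ m) ^ Suc d"
      using A by (rule mult_left_mono)
    have int: "integrable M (\<lambda>\<omega>. (X ?x \<omega> - X ?y \<omega>) ^ (2 * Suc d))"
      and mom: "(LINT \<omega>|M. (X ?x \<omega> - X ?y \<omega>) ^ (2 * Suc d)) \<le> A * norm (?x - ?y) ^ Suc d"
      using X by (simp_all add: increment_bound_def d_def del: power_Suc mult_Suc_right)
    have power_commute: "(\<theta> ^ m) ^ (2 * Suc d) = (\<theta> ^ (2 * Suc d)) ^ m"
      unfolding power_mult[symmetric] by (rule arg_cong[OF mult.commute])
    have "measure M (Bad p) \<le> (LINT \<omega>|M. (X ?x \<omega> - X ?y \<omega>) ^ (2 * Suc d)) / (\<theta> ^ m) ^ (2 * Suc d)"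
      unfolding uh(1) Bad_def prod.case
      by (rule Markov_even_power[OF M int borel_measurable_diff[OF meas meas]]) (use \<theta>(1) in simp)
    also have "(\<theta> ^ m) ^ (2 * Suc d) = (2 / 3) ^ m"
      by (simp only: power_commute \<theta>(2)[folded d_def])
    also have "(LINT \<omega>|M. (X ?x \<omega> - X ?y \<omega>) ^ (2 * Suc d)) / (2 / 3) ^ m
        \<le> A * (real d / 2 ^ m) ^ Suc d / (2 / 3) ^ m"
      by (rule divide_right_mono[OF order_trans[OF mom dist]]) simp
    finally show ?thesis .
  qed
  have "measure M (\<Union>p\<in>G \<times> H. Bad p) \<le> (\<Sum>p\<in>G \<times> H. measure M (Bad p))"
    by (rule measure_UNION_le[OF fin]) (rule Bad)
  also have "\<dots> \<le> (\<Sum>p\<in>G \<times> H. A * (real d / 2 ^ m) ^ Suc d / (2 / 3) ^ m)"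
    by (intro sum_mono prob_Bad)
  also have "\<dots> = real (card G) * 3 ^ d * (A * (real d / 2 ^ m) ^ Suc d / (2 / 3) ^ m)"
    by (simp add: card_cartesian_product cardH)
  also have "\<dots> \<le> (3 * real N) ^ d * (2 ^ m) ^ d * 3 ^ d * (A * (real d / 2 ^ m) ^ Suc d / (2 / 3) ^ m)"
    by (rule mult_right_mono[OF mult_right_mono[OF cardG]]) (use A in simp_all)
  also have "\<dots> = ((9 * real N) ^ d * A * real d ^ Suc d) * (3 / 4) ^ m"
  proof -
    have "(9 * real N) ^ d = (3 * real N * 3) ^ d" by simp
    then have "(9 * real N) ^ d = (3 * real N) ^ d * 3 ^ d" by (simp only: power_mult_distrib)
    moreover have "(3 / 4 :: real) ^ m = 1 / (2 ^ m * (2 / 3) ^ m)"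
      by (simp add: power_divide power_mult_distrib[symmetric])
    moreover have "(2 ^ m) ^ d * (real d / 2 ^ m) ^ Suc d = real d ^ Suc d / 2 ^ m"
      by (simp add: power_divide)
    moreover have "P * (R * Q) * 3 ^ d * S = P * 3 ^ d * R * Q * S" for P Q R S :: real by simp
    ultimately show ?thesis
      by (simp only: times_divide_eq_right times_divide_eq_left mult_ac) (simp add: mult_ac del: power_Suc)
  qed
  finally show "measure M {\<omega> \<in> space M. \<not> small_grid_steps \<theta> N m (\<lambda>x. X x \<omega>)}
      \<le> ((9 * real N) ^ DIM('a) * A * real DIM('a) ^ Suc DIM('a)) * (3 / 4) ^ m"
    unfolding eq d_def .
qed

text \<open>The probability of failure depends on the field through the constant \<open>A\<close> only; this is the
  uniformity that later gives tightness.\<close>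

lemma prob_not_dyadic_regular:
  fixes X :: "'a::euclidean_space \<Rightarrow> 'w \<Rightarrow> real"
  assumes M: "prob_space M" and X: "increment_bound A M X" and A: "A \<ge> 0" and N: "N > 0"
    and \<theta>: "0 < \<theta>" "\<theta> < 1" "\<theta> ^ (2 * Suc DIM('a)) = 2 / 3"
  obtains Bad where "Bad \<in> sets M"
    "measure M Bad \<le> 4 * ((9 * real N) ^ DIM('a) * A * real DIM('a) ^ Suc DIM('a)) * (3 / 4) ^ m"
    "\<And>\<omega>. \<omega> \<in> space M \<Longrightarrow> \<omega> \<notin> Bad \<Longrightarrow> dyadic_regular \<theta> N m (\<lambda>x. X x \<omega>)"
proof -
  interpret prob_space M by fact
  define C where "C = (9 * real N) ^ DIM('a) * A * real DIM('a) ^ Suc DIM('a)"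
  define B where "B i = {\<omega> \<in> space M. \<not> small_grid_steps \<theta> N (m + i) (\<lambda>x. X x \<omega>)}" for i
  note prob = prob_not_small_grid_steps[OF M X A N \<theta>(1,3)]
  have C: "C \<ge> 0" using A by (simp add: C_def)
  have BM: "range B \<subseteq> sets M" unfolding B_def using prob(1) by blast
  have le: "measure M (B i) \<le> C * (3 / 4) ^ m * (3 / 4) ^ i" for i
    using prob(2)[of "m + i"] by (simp add: B_def C_def power_add mult_ac)
  have geo: "summable (\<lambda>i. C * (3 / 4) ^ m * (3 / 4 :: real) ^ i)"
    by (intro summable_mult summable_geometric) simp
  have summ: "summable (\<lambda>i. measure M (B i))"
    by (rule summable_comparison_test'[OF geo]) (use le in auto)
  have "measure M (\<Union>i. B i) \<le> (\<Sum>i. measure M (B i))"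
    by (rule finite_measure_subadditive_countably[OF BM summ])
  also have "\<dots> \<le> (\<Sum>i. C * (3 / 4) ^ m * (3 / 4) ^ i)"
    by (rule suminf_le[OF le summ geo])
  also have "\<dots> = 4 * C * (3 / 4) ^ m"
    by (subst suminf_mult) (auto simp: suminf_geometric)
  finally have "measure M (\<Union>i. B i) \<le> 4 * C * (3 / 4) ^ m" .
  moreover have "dyadic_regular \<theta> N m (\<lambda>x. X x \<omega>)" if "\<omega> \<in> space M" "\<omega> \<notin> (\<Union>i. B i)" for \<omega>
  proof (rule small_grid_steps_imp_dyadic_regular[OF \<theta>(1,2)])
    fix j assume "m \<le> j"
    then have "j = m + (j - m)" by simp
    then show "small_grid_steps \<theta> N j (\<lambda>x. X x \<omega>)" using that unfolding B_def by (metis (mono_tags, lifting) UN_I UNIV_I mem_Collect_eq)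
  qed
  moreover have "(\<Union>i. B i) \<in> sets M" using BM by auto
  ultimately show thesis using that unfolding C_def by blast
qed

lemma geometric_bound_small:
  fixes c e :: real
  assumes "e > 0"
  obtains m where "4 * c * (3 / 4) ^ m \<le> e"
proof -
  have "(\<lambda>m. 4 * c * (3 / 4 :: real) ^ m) \<longlonglongrightarrow> 0"
    by (intro tendsto_mult_right_zero LIMSEQ_realpow_zero) auto
  from order_tendstoD(2)[OF this assms] obtain m where "4 * c * (3 / 4) ^ m < e"
    by (auto simp: eventually_sequentially)
  then show thesis using that[of m] by simp
qed

text \<open>By the summability of the error probabilities, almost every path is regular on every cube, so it
  extends from the dyadic points. On the exceptional set the version is \<open>0\<close>.\<close>

lemma dyadic_continuous_version:
  fixes X :: "'a::euclidean_space \<Rightarrow> 'w \<Rightarrow> real"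
  assumes M: "prob_space M" and X: "increment_bound A M X" and A: "A \<ge> 0"
  obtains Y where "\<And>x. Y x \<in> borel_measurable M" "\<And>\<omega>. continuous_on UNIV (\<lambda>x. Y x \<omega>)"
    "\<And>x. x \<in> dyadic_points \<Longrightarrow> AE \<omega> in M. Y x \<omega> = X x \<omega>"
proof -
  interpret prob_space M by fact
  \<comment> \<open>any value between \<open>1 / 2\<close> and \<open>1\<close> in place of \<open>2 / 3\<close> would give summable error probabilities\<close>
  define \<theta> where "\<theta> = root (2 * Suc DIM('a)) (2 / 3)"
  have \<theta>: "0 < \<theta>" "\<theta> < 1" "\<theta> ^ (2 * Suc DIM('a)) = 2 / 3"
    unfolding \<theta>_def by (simp_all add: real_root_lt_1_iff del: mult_Suc_right power_Suc)
  have "AE \<omega> in M. \<exists>m. dyadic_regular \<theta> N m (\<lambda>x. X x \<omega>)" for N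
  proof -
    define C where "C = (9 * real (Suc N)) ^ DIM('a) * A * real DIM('a) ^ Suc DIM('a)"
    define P where "P m Bad \<longleftrightarrow> Bad \<in> sets M \<and> measure M Bad \<le> 4 * C * (3 / 4) ^ m \<and>
        (\<forall>\<omega>\<in>space M - Bad. dyadic_regular \<theta> (Suc N) m (\<lambda>x. X x \<omega>))" for m Bad
    have "\<exists>Bad. P m Bad" for m
    proof (rule prob_not_dyadic_regular[OF M X A zero_less_Suc[of N] \<theta>, of m], rule exI)
      fix Bad assume "Bad \<in> sets M" "\<And>\<omega>. \<omega> \<in> space M \<Longrightarrow> \<omega> \<notin> Bad \<Longrightarrow> dyadic_regular \<theta> (Suc N) m (\<lambda>x. X x \<omega>)"
        and "measure M Bad \<le> 4 * ((9 * real (Suc N)) ^ DIM('a) * A * real DIM('a) ^ Suc DIM('a)) * (3 / 4) ^ m"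
      then show "P m Bad" by (simp only: P_def C_def) simp
    qed
    then obtain Bad where "\<And>m. P m (Bad m)" by metis
    then have Bad: "\<And>m. Bad m \<in> sets M" "\<And>m. measure M (Bad m) \<le> 4 * C * (3 / 4) ^ m"
      "\<And>m \<omega>. \<omega> \<in> space M - Bad m \<Longrightarrow> dyadic_regular \<theta> (Suc N) m (\<lambda>x. X x \<omega>)"
      unfolding P_def by blast+
    have le_e: "measure M (\<Inter>m. Bad m) \<le> e" if e: "e > 0" for e
    proof -
      obtain m where m: "4 * C * (3 / 4) ^ m \<le> e" using geometric_bound_small[OF e] .
      have "measure M (\<Inter>m. Bad m) \<le> measure M (Bad m)"
        using Bad(1) by (intro finite_measure_mono) auto
      then show ?thesis using Bad(2)[of m] m by linarith
    qed
    have "measure M (\<Inter>m. Bad m) \<le> 0"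
      by (rule field_le_epsilon) (simp only: add_0 le_e)
    then have "measure M (\<Inter>m. Bad m) = 0" by (simp add: measure_le_0_iff)
    then have "(\<Inter>m. Bad m) \<in> null_sets M" using Bad(1) by (intro null_setsI) (auto simp: emeasure_eq_measure)
    then show ?thesis
    proof (rule AE_I')
      show "{\<omega> \<in> space M. \<not> (\<exists>m. dyadic_regular \<theta> N m (\<lambda>x. X x \<omega>))} \<subseteq> (\<Inter>m. Bad m)"
      proof safe
        fix \<omega> m assume \<omega>: "\<omega> \<in> space M" and not: "\<not> (\<exists>m. dyadic_regular \<theta> N m (\<lambda>x. X x \<omega>))"
        have "cube N \<subseteq> (cube (Suc N) :: 'a set)" by (force simp: cube_def)
        then have "dyadic_regular \<theta> (Suc N) m f \<Longrightarrow> dyadic_regular \<theta> N m f" for f :: "'a \<Rightarrow> real"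
          unfolding dyadic_regular_def by blast
        then show "\<omega> \<in> Bad m" using Bad(3)[of \<omega> m] \<omega> not by blast
      qed
    qed
  qed
  then have "AE \<omega> in M. \<forall>N. \<exists>m. dyadic_regular \<theta> N m (\<lambda>x. X x \<omega>)"
    by (simp add: AE_all_countable)
  then obtain Nul where Nul: "Nul \<in> null_sets M"
    and sub: "{\<omega> \<in> space M. \<not> (\<forall>N. \<exists>m. dyadic_regular \<theta> N m (\<lambda>x. X x \<omega>))} \<subseteq> Nul"
    unfolding eventually_ae_filter by blast
  have reg: "\<exists>m. dyadic_regular \<theta> N m (\<lambda>x. X x \<omega>)" if "\<omega> \<in> space M - Nul" for \<omega> N
    using sub that by blast
  define good where "good = space M - Nul"
  define ext where "ext \<omega> h \<longleftrightarrow> continuous_on UNIV h \<and>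
      (\<forall>x. (\<lambda>m. X (dyadic_floor m x) \<omega>) \<longlonglongrightarrow> h x) \<and> (\<forall>x\<in>dyadic_points. h x = X x \<omega>)" for \<omega> h
  have "\<exists>h. ext \<omega> h" if "\<omega> \<in> good" for \<omega>
  proof (rule dyadic_regular_extension[OF \<theta>(1,2) reg])
    show "\<omega> \<in> space M - Nul" using that by (simp add: good_def)
  qed (auto simp: ext_def)
  then obtain g where "\<And>\<omega>. \<omega> \<in> good \<Longrightarrow> ext \<omega> (g \<omega>)" by metis
  then have g: "\<And>\<omega>. \<omega> \<in> good \<Longrightarrow> continuous_on UNIV (g \<omega>)"
      "\<And>\<omega> x. \<omega> \<in> good \<Longrightarrow> (\<lambda>m. X (dyadic_floor m x) \<omega>) \<longlonglongrightarrow> g \<omega> x"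
      "\<And>\<omega> x. \<omega> \<in> good \<Longrightarrow> x \<in> dyadic_points \<Longrightarrow> g \<omega> x = X x \<omega>"
    unfolding ext_def by blast+
  define Y where "Y x \<omega> = (if \<omega> \<in> good then g \<omega> x else 0)" for x \<omega>
  have good [measurable]: "good \<in> sets M" using Nul by (auto simp: good_def)
  show thesis
  proof (rule that)
    show "Y x \<in> borel_measurable M" for x
    proof (rule borel_measurable_LIMSEQ_real)
      show "(\<lambda>m. if \<omega> \<in> good then X (dyadic_floor m x) \<omega> else 0) \<longlonglongrightarrow> Y x \<omega>" for \<omega>
        using g(2) by (simp add: Y_def)
      have [measurable]: "X (dyadic_floor m x) \<in> borel_measurable M" for m
        using X by (simp add: increment_bound_def)
      show "(\<lambda>\<omega>. if \<omega> \<in> good then X (dyadic_floor m x) \<omega> else 0) \<in> borel_measurable M" for m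
        by measurable
    qed
    show "continuous_on UNIV (\<lambda>x. Y x \<omega>)" for \<omega>
      unfolding Y_def using g(1) by (cases "\<omega> \<in> good") auto
    show "AE \<omega> in M. Y x \<omega> = X x \<omega>" if "x \<in> dyadic_points" for x
      using AE_not_in[OF Nul] by (rule AE_mp) (use g(3) that in \<open>auto intro!: AE_I2 simp: Y_def good_def\<close>)
  qed
qed

section \<open>Continuous Gaussian fields\<close>

text \<open>For a stationary kernel \<open>K x y = C (x - y)\<close> the condition says that \<open>C\<close> is even and Lipschitz. It
  bounds the variance of increments and gives the continuity of \<open>K\<close>, and it is stable under
  pointwise limits.\<close>

definition lipschitz_kernel :: "real \<Rightarrow> ('a::euclidean_space \<Rightarrow> 'a \<Rightarrow> real) \<Rightarrow> bool" where
  "lipschitz_kernel B K \<longleftrightarrow> B \<ge> 0 \<and> (\<forall>x y. K x y = K y x) \<and>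
     (\<forall>x x' y. \<bar>K x y - K x' y\<bar> \<le> B * norm (x - x'))"

lemma lipschitz_kernelD:
  assumes "lipschitz_kernel B K"
  shows "B \<ge> 0" "K x y = K y x" "\<bar>K x y - K x' y\<bar> \<le> B * norm (x - x')"
  using assms unfolding lipschitz_kernel_def by blast+

lemma lipschitz_kernel_diff:
  assumes "lipschitz_kernel B K"
  shows "\<bar>K x y - K x' y'\<bar> \<le> B * norm (x - x') + B * norm (y - y')"
proof -
  have "\<bar>K x y - K x' y\<bar> \<le> B * norm (x - x')" "\<bar>K y x' - K y' x'\<bar> \<le> B * norm (y - y')"
    by (rule lipschitz_kernelD(3)[OF assms])+
  moreover have "K y x' = K x' y" "K y' x' = K x' y'" by (rule lipschitz_kernelD(2)[OF assms])+
  ultimately show ?thesis by linarith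
qed

lemma lipschitz_kernel_tendsto:
  assumes K: "lipschitz_kernel B K" and "f \<longlonglongrightarrow> x" "g \<longlonglongrightarrow> y"
  shows "(\<lambda>n. K (f n) (g n)) \<longlonglongrightarrow> K x y"
proof (rule LIM_zero_cancel[OF Lim_null_comparison])
  show "\<forall>\<^sub>F n in sequentially. norm (K (f n) (g n) - K x y) \<le> B * norm (f n - x) + B * norm (g n - y)"
    using lipschitz_kernel_diff[OF K] by (intro always_eventually) simp
  have "(\<lambda>n. B * norm (f n - x) + B * norm (g n - y)) \<longlonglongrightarrow> B * 0 + B * 0"
    using assms(2,3) by (intro tendsto_intros tendsto_norm_zero LIM_zero)
  then show "(\<lambda>n. B * norm (f n - x) + B * norm (g n - y)) \<longlonglongrightarrow> 0" by simp
qed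

lemma gaussian_on_increment:
  assumes X: "gaussian_on T M X K" and K: "lipschitz_kernel B K" and x: "x \<in> T" and y: "y \<in> T"
  obtains v where "centered_normal M (\<lambda>\<omega>. X x \<omega> - X y \<omega>) v" "0 \<le> v" "v \<le> 2 * B * norm (x - y)"
proof (rule that)
  let ?v = "K x x - K x y - K y x + K y y"
  show cn: "centered_normal M (\<lambda>\<omega>. X x \<omega> - X y \<omega>) ?v"
    using gaussian_on_two_points[OF X x y, of "-1"] by simp
  show "0 \<le> ?v" by (rule centered_normal_var_nonneg[OF gaussian_on_prob_space[OF X] cn])
  have "\<bar>K x x - K y x\<bar> \<le> B * norm (x - y)" "\<bar>K x y - K y y\<bar> \<le> B * norm (x - y)"
    by (rule lipschitz_kernelD(3)[OF K])+
  then show "?v \<le> 2 * B * norm (x - y)" by linarith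
qed

lemma std_normal_even_moment_nonneg: "0 \<le> (LINT x|std_normal_distribution. x ^ (2 * q))"
  by (intro integral_nonneg_AE AE_I2) (rule zero_le_even_power, simp)

lemma gaussian_on_increment_bound:
  fixes X :: "'a::euclidean_space \<Rightarrow> 'w \<Rightarrow> real"
  assumes X: "gaussian_on dyadic_points M X K" and K: "lipschitz_kernel B K"
  shows "increment_bound ((2 * B) ^ Suc DIM('a) * (LINT x|std_normal_distribution. x ^ (2 * Suc DIM('a)))) M X"
  unfolding increment_bound_def
proof (intro conjI ballI)
  show "X x \<in> borel_measurable M" if "x \<in> dyadic_points" for x
    by (rule gaussian_on_measurable[OF X that])
  fix x y :: 'a assume xy: "x \<in> dyadic_points" "y \<in> dyadic_points"
  obtain v where v: "centered_normal M (\<lambda>\<omega>. X x \<omega> - X y \<omega>) v" "0 \<le> v" "v \<le> 2 * B * norm (x - y)"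
    by (rule gaussian_on_increment[OF X K xy])
  note moment = centered_normal_moment[OF gaussian_on_prob_space[OF X] v(1), of "2 * Suc DIM('a)"]
  show "integrable M (\<lambda>\<omega>. (X x \<omega> - X y \<omega>) ^ (2 * Suc DIM('a)))" by (rule moment(1))
  have "sqrt v ^ (2 * Suc DIM('a)) = v ^ Suc DIM('a)"
    using v(2) by (simp only: power_mult real_sqrt_pow2)
  also have "\<dots> \<le> (2 * B * norm (x - y)) ^ Suc DIM('a)"
    using v by (intro power_mono)
  also have "\<dots> = (2 * B) ^ Suc DIM('a) * norm (x - y) ^ Suc DIM('a)" by (rule power_mult_distrib)
  finally have "sqrt v ^ (2 * Suc DIM('a)) * (LINT x|std_normal_distribution. x ^ (2 * Suc DIM('a)))
      \<le> (2 * B) ^ Suc DIM('a) * norm (x - y) ^ Suc DIM('a) * (LINT x|std_normal_distribution. x ^ (2 * Suc DIM('a)))"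
    by (rule mult_right_mono[OF _ std_normal_even_moment_nonneg])
  then show "(LINT \<omega>|M. (X x \<omega> - X y \<omega>) ^ (2 * Suc DIM('a)))
      \<le> (2 * B) ^ Suc DIM('a) * (LINT x|std_normal_distribution. x ^ (2 * Suc DIM('a))) * norm (x - y) ^ Suc DIM('a)"
    unfolding moment(2) by (simp only: mult_ac)
qed

lemma gaussian_on_cong_AE:
  assumes X: "gaussian_on T M X K"
    and Y: "\<And>x. x \<in> T \<Longrightarrow> Y x \<in> borel_measurable M" "\<And>x. x \<in> T \<Longrightarrow> AE \<omega> in M. Y x \<omega> = X x \<omega>"
  shows "gaussian_on T M Y K"
  unfolding gaussian_on_def
proof (intro conjI allI impI)
  show "prob_space M" by (rule gaussian_on_prob_space[OF X])
  fix n :: nat and a :: "nat \<Rightarrow> real" and p assume p: "\<forall>i<n. p i \<in> T"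
  have measX: "(\<lambda>\<omega>. \<Sum>i<n. a i * X (p i) \<omega>) \<in> borel_measurable M"
    using gaussian_on_measurable[OF X] p by (intro borel_measurable_sum borel_measurable_times) auto
  have measY: "(\<lambda>\<omega>. \<Sum>i<n. a i * Y (p i) \<omega>) \<in> borel_measurable M"
    using Y(1) p by (intro borel_measurable_sum borel_measurable_times) auto
  have "AE \<omega> in M. \<forall>i\<in>{..<n}. Y (p i) \<omega> = X (p i) \<omega>"
    using Y(2) p by (intro AE_finite_allI) auto
  then have ae: "AE \<omega> in M. (\<Sum>i<n. a i * Y (p i) \<omega>) = (\<Sum>i<n. a i * X (p i) \<omega>)"
    by eventually_elim (auto intro!: sum.cong)
  have "(CLINT \<omega>|M. iexp (t * (\<Sum>i<n. a i * Y (p i) \<omega>))) = (CLINT \<omega>|M. iexp (t * (\<Sum>i<n. a i * X (p i) \<omega>)))" for t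
  proof (rule integral_cong_AE)
    show "AE \<omega> in M. iexp (t * (\<Sum>i<n. a i * Y (p i) \<omega>)) = iexp (t * (\<Sum>i<n. a i * X (p i) \<omega>))"
      using ae by eventually_elim simp
  qed (use measX measY in measurable)
  then show "centered_normal M (\<lambda>\<omega>. \<Sum>i<n. a i * Y (p i) \<omega>) (\<Sum>i<n. \<Sum>j<n. a i * a j * K (p i) (p j))"
    using gaussian_onD[where n = n and p = p and a = a, OF X] p measY unfolding centered_normal_def by simp
qed

text \<open>A linear combination of values of a continuous field is the pointwise limit of combinations of
  values at dyadic points; the characteristic functions converge by dominated convergence, and the
  variances because \<open>K\<close> is continuous.\<close>

lemma gaussian_on_dyadic_imp_UNIV:
  fixes Y :: "'a::euclidean_space \<Rightarrow> 'w \<Rightarrow> real"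
  assumes Y: "gaussian_on dyadic_points M Y K" and K: "lipschitz_kernel B K"
    and meas: "\<And>x. Y x \<in> borel_measurable M"
    and cont: "\<And>\<omega>. \<omega> \<in> space M \<Longrightarrow> continuous_on UNIV (\<lambda>x. Y x \<omega>)"
  shows "gaussian_on UNIV M Y K"
  unfolding gaussian_on_def
proof (intro conjI allI impI)
  show M: "prob_space M" by (rule gaussian_on_prob_space[OF Y])
  interpret prob_space M by fact
  fix n :: nat and a :: "nat \<Rightarrow> real" and p :: "nat \<Rightarrow> 'a"
  define Z where "Z m \<omega> = (\<Sum>i<n. a i * Y (dyadic_floor m (p i)) \<omega>)" for m \<omega>
  define V where "V m = (\<Sum>i<n. \<Sum>j<n. a i * a j * K (dyadic_floor m (p i)) (dyadic_floor m (p j)))" for m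
  have [measurable]: "Z m \<in> borel_measurable M" for m
    unfolding Z_def using meas by measurable
  have Zlim: "(\<lambda>m. Z m \<omega>) \<longlonglongrightarrow> (\<Sum>i<n. a i * Y (p i) \<omega>)" if "\<omega> \<in> space M" for \<omega>
    unfolding Z_def
    by (intro tendsto_sum tendsto_mult tendsto_const
          continuous_on_tendsto_compose[OF cont[OF that] dyadic_floor_tendsto]) auto
  have Vlim: "V \<longlonglongrightarrow> (\<Sum>i<n. \<Sum>j<n. a i * a j * K (p i) (p j))"
    unfolding V_def
    by (intro tendsto_sum tendsto_mult tendsto_const lipschitz_kernel_tendsto[OF K] dyadic_floor_tendsto)
  have Zn: "(CLINT \<omega>|M. iexp (t * Z m \<omega>)) = of_real (exp (- V m * t\<^sup>2 / 2))" for m t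
    using gaussian_onD[where n = n and p = "\<lambda>i. dyadic_floor m (p i)" and a = a, OF Y]
    unfolding centered_normal_def Z_def V_def by simp
  define S where "S \<omega> = (\<Sum>i<n. a i * Y (p i) \<omega>)" for \<omega>
  have sum_meas [measurable]: "S \<in> borel_measurable M"
    unfolding S_def using meas by measurable
  show "centered_normal M (\<lambda>\<omega>. \<Sum>i<n. a i * Y (p i) \<omega>) (\<Sum>i<n. \<Sum>j<n. a i * a j * K (p i) (p j))"
    unfolding centered_normal_def S_def[symmetric]
  proof (intro conjI allI)
    show "(\<lambda>\<omega>. S \<omega>) \<in> borel_measurable M" by measurable
    fix t
    have "(\<lambda>m. CLINT \<omega>|M. iexp (t * Z m \<omega>)) \<longlonglongrightarrow> (CLINT \<omega>|M. iexp (t * S \<omega>))"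
    proof (rule integral_dominated_convergence[where w = "\<lambda>_. 1"])
      show "AE \<omega> in M. (\<lambda>m. iexp (t * Z m \<omega>)) \<longlonglongrightarrow> iexp (t * S \<omega>)"
        using Zlim[folded S_def] by (intro AE_I2 tendsto_intros) auto
    qed auto
    moreover have "(\<lambda>m. CLINT \<omega>|M. iexp (t * Z m \<omega>))
        \<longlonglongrightarrow> of_real (exp (- (\<Sum>i<n. \<Sum>j<n. a i * a j * K (p i) (p j)) * t\<^sup>2 / 2))"
      unfolding Zn by (intro tendsto_intros Vlim) simp
    ultimately show "(CLINT \<omega>|M. iexp (t * S \<omega>))
        = of_real (exp (- (\<Sum>i<n. \<Sum>j<n. a i * a j * K (p i) (p j)) * t\<^sup>2 / 2))"
      by (rule LIMSEQ_unique)
  qed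
qed

lemma gaussian_continuous_version_dyadic:
  fixes X :: "'a::euclidean_space \<Rightarrow> 'w \<Rightarrow> real"
  assumes X: "gaussian_on dyadic_points M X K" and K: "lipschitz_kernel B K"
  obtains Y where "\<And>x. Y x \<in> borel_measurable M" "\<And>\<omega>. continuous_on UNIV (\<lambda>x. Y x \<omega>)"
    "\<And>x. x \<in> dyadic_points \<Longrightarrow> AE \<omega> in M. Y x \<omega> = X x \<omega>" "gaussian_on UNIV M Y K"
proof -
  have "0 \<le> (2 * B) ^ Suc DIM('a) * (LINT x|std_normal_distribution. x ^ (2 * Suc DIM('a)))"
    using lipschitz_kernelD(1)[OF K]
    by (intro mult_nonneg_nonneg zero_le_power std_normal_even_moment_nonneg) simp
  from dyadic_continuous_version[OF gaussian_on_prob_space[OF X] gaussian_on_increment_bound[OF X K] this]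
  obtain Y where Y: "\<And>x. Y x \<in> borel_measurable M" "\<And>\<omega>. continuous_on UNIV (\<lambda>x. Y x \<omega>)"
    "\<And>x. x \<in> dyadic_points \<Longrightarrow> AE \<omega> in M. Y x \<omega> = X x \<omega>" by blast
  have "gaussian_on dyadic_points M Y K" by (rule gaussian_on_cong_AE[OF X Y(1,3)])
  then have "gaussian_on UNIV M Y K" by (rule gaussian_on_dyadic_imp_UNIV[OF _ K Y(1,2)])
  with Y show thesis by (rule that)
qed

text \<open>Off the dyadic points the two fields agree because both are limits along the grid, one
  pointwise and the other in mean square.\<close>

lemma gaussian_continuous_version:
  fixes X :: "'a::euclidean_space \<Rightarrow> 'w \<Rightarrow> real"
  assumes X: "gaussian_on UNIV M X K" and K: "lipschitz_kernel B K"
  shows "\<exists>Y. continuous_version M X Y"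
proof -
  have M: "prob_space M" by (rule gaussian_on_prob_space[OF X])
  have "gaussian_on dyadic_points M X K" by (rule gaussian_on_subset[OF X]) simp
  then obtain Y where Y: "\<And>x. Y x \<in> borel_measurable M" "\<And>\<omega>. continuous_on UNIV (\<lambda>x. Y x \<omega>)"
    "\<And>x. x \<in> dyadic_points \<Longrightarrow> AE \<omega> in M. Y x \<omega> = X x \<omega>"
    by (rule gaussian_continuous_version_dyadic[OF _ K]) blast
  have "AE \<omega> in M. Y x \<omega> = X x \<omega>" for x
  proof -
    let ?x = "\<lambda>m. dyadic_floor m x"
    have sq: "integrable M (\<lambda>\<omega>. (X (?x m) \<omega> - X x \<omega>)\<^sup>2) \<and>
        (LINT \<omega>|M. norm ((X (?x m) \<omega> - X x \<omega>)\<^sup>2)) \<le> 2 * B * norm (?x m - x)" for m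
    proof -
      obtain v where v: "centered_normal M (\<lambda>\<omega>. X (?x m) \<omega> - X x \<omega>) v" "v \<le> 2 * B * norm (?x m - x)"
        by (rule gaussian_on_increment[OF X K UNIV_I UNIV_I])
      then show ?thesis
        using centered_normal_moment(1)[OF M v(1), of 2] centered_normal_mean_variance(2)[OF M v(1)] by simp
    qed
    have "(\<lambda>m. LINT \<omega>|M. norm ((X (?x m) \<omega> - X x \<omega>)\<^sup>2)) \<longlonglongrightarrow> 0"
    proof (rule Lim_null_comparison)
      show "\<forall>\<^sub>F m in sequentially. norm (LINT \<omega>|M. norm ((X (?x m) \<omega> - X x \<omega>)\<^sup>2)) \<le> 2 * B * norm (?x m - x)"
        using sq by (intro always_eventually) simp
      show "(\<lambda>m. 2 * B * norm (?x m - x)) \<longlonglongrightarrow> 0"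
        by (intro tendsto_mult_right_zero tendsto_norm_zero LIM_zero dyadic_floor_tendsto)
    qed
    then obtain r :: "nat \<Rightarrow> nat" where r: "strict_mono r"
      and ae: "AE \<omega> in M. (\<lambda>m. (X (?x (r m)) \<omega> - X x \<omega>)\<^sup>2) \<longlonglongrightarrow> 0"
      using tendsto_L1_AE_subseq[of M "\<lambda>m \<omega>. (X (?x m) \<omega> - X x \<omega>)\<^sup>2"] sq by auto
    have "AE \<omega> in M. \<forall>m. Y (?x m) \<omega> = X (?x m) \<omega>"
      using Y(3) by (simp add: AE_all_countable)
    with ae show ?thesis
    proof eventually_elim
      case (elim \<omega>)
      from tendsto_real_sqrt[OF elim(1)] have "(\<lambda>m. X (?x (r m)) \<omega> - X x \<omega>) \<longlonglongrightarrow> 0"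
        by (intro tendsto_rabs_zero_cancel[where f = "\<lambda>m. X (?x (r m)) \<omega> - X x \<omega>"]) simp
      then have "(\<lambda>m. Y (?x (r m)) \<omega>) \<longlonglongrightarrow> X x \<omega>"
        using elim(2) by (simp add: LIM_zero_iff)
      moreover have "(\<lambda>m. Y (?x m) \<omega>) \<longlonglongrightarrow> Y x \<omega>"
        by (intro continuous_on_tendsto_compose[OF Y(2) dyadic_floor_tendsto]) auto
      then have "(\<lambda>m. Y (?x (r m)) \<omega>) \<longlonglongrightarrow> Y x \<omega>"
        using LIMSEQ_subseq_LIMSEQ[OF _ r] by (auto simp: o_def)
      ultimately show ?case using LIMSEQ_unique by blast
    qed
  qed
  then show ?thesis using Y unfolding continuous_version_def by blast
qed

lemma continuous_version_gaussian_on: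
  assumes "continuous_version M X Y" "gaussian_on UNIV M X K"
  shows "gaussian_on UNIV M Y K"
  using assms(1) by (intro gaussian_on_cong_AE[OF assms(2)]) (auto simp: continuous_version_def)

lemma field_distribution_measurable:
  assumes "\<And>x. Y x \<in> borel_measurable M" "\<And>\<omega>. \<omega> \<in> space M \<Longrightarrow> continuous_on UNIV (\<lambda>x. Y x \<omega>)"
  shows "(\<lambda>\<omega> x. Y x \<omega>) \<in> measurable M (borel_of_topology C_topology)"
  using assms by (intro measurable_into_C_topology)

lemma gaussian_on_field_distribution:
  assumes Y: "gaussian_on UNIV M Y K"
    and cont: "\<And>\<omega>. \<omega> \<in> space M \<Longrightarrow> continuous_on UNIV (\<lambda>x. Y x \<omega>)"
  shows "gaussian_on UNIV (field_distribution M Y) (\<lambda>x f. f x) K"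
  unfolding gaussian_on_def
proof (intro conjI allI impI)
  interpret prob_space M by (rule gaussian_on_prob_space[OF Y])
  have meas [measurable]: "(\<lambda>\<omega> x. Y x \<omega>) \<in> measurable M (borel_of_topology C_topology)"
    using gaussian_on_measurable[OF Y UNIV_I] cont by (rule field_distribution_measurable)
  show "prob_space (field_distribution M Y)"
    unfolding field_distribution_def by (rule prob_space_distr[OF meas])
  fix n :: nat and a :: "nat \<Rightarrow> real" and p :: "nat \<Rightarrow> 'a"
  have [measurable]: "(\<lambda>f. \<Sum>i<n. a i * f (p i)) \<in> borel_measurable (borel_of_topology C_topology)"
    by (intro borel_measurable_sum borel_measurable_times evaluation_measurable borel_measurable_const)
  have "(CLINT f|field_distribution M Y. iexp (t * (\<Sum>i<n. a i * f (p i))))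
      = (CLINT \<omega>|M. iexp (t * (\<Sum>i<n. a i * Y (p i) \<omega>)))" for t
    unfolding field_distribution_def by (rule integral_distr[OF meas]) measurable
  then show "centered_normal (field_distribution M Y) (\<lambda>f. \<Sum>i<n. a i * f (p i))
      (\<Sum>i<n. \<Sum>j<n. a i * a j * K (p i) (p j))"
    using gaussian_onD[where n = n and p = p and a = a, OF Y]
    unfolding centered_normal_def field_distribution_def by simp
qed

lemma sets_field_distribution [simp]:
  "sets (field_distribution M Y) = sets (borel_of_topology C_topology)"
  by (simp add: field_distribution_def)

section \<open>Realising Gaussian fields by independent normal variables\<close>

definition psd_kernel :: "(nat \<Rightarrow> nat \<Rightarrow> real) \<Rightarrow> bool" where
  "psd_kernel K \<longleftrightarrow> (\<forall>i j. K i j = K j i) \<and>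
     (\<forall>F a. finite F \<longrightarrow> 0 \<le> (\<Sum>i\<in>F. \<Sum>j\<in>F. a i * a j * K i j))"

definition schur_complement :: "nat \<Rightarrow> (nat \<Rightarrow> nat \<Rightarrow> real) \<Rightarrow> nat \<Rightarrow> nat \<Rightarrow> real" where
  "schur_complement m K i j = K i j - K i m * K j m / K m m"

lemma psd_kernel_diag_nonneg: "psd_kernel K \<Longrightarrow> 0 \<le> K m m"
  unfolding psd_kernel_def by (elim conjE allE[of _ "{m}"] allE[of _ "\<lambda>_. 1"]) simp

lemma psd_kernel_shift:
  assumes K: "psd_kernel K" and F: "finite F"
  shows "0 \<le> (\<Sum>i\<in>F. \<Sum>j\<in>F. a i * a j * K i j) + 2 * t * (\<Sum>i\<in>F. a i * K i m) + t\<^sup>2 * K m m"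
proof -
  define G where "G = insert m F"
  define a0 where "a0 i = (if i \<in> F then a i else 0)" for i
  define b where "b i = a0 i + (if i = m then t else 0)" for i
  have G: "finite G" "m \<in> G" "F \<subseteq> G" using F by (auto simp: G_def)
  have sym: "K i j = K j i" for i j using K unfolding psd_kernel_def by blast
  have sumF: "(\<Sum>i\<in>G. a0 i * f i) = (\<Sum>i\<in>F. a i * f i)" for f
    using G by (intro sum.mono_neutral_cong_right) (auto simp: a0_def)
  have sumb: "(\<Sum>i\<in>G. b i * f i) = (\<Sum>i\<in>F. a i * f i) + t * f m" for f
  proof -
    have "(\<Sum>i\<in>G. b i * f i) = (\<Sum>i\<in>G. a0 i * f i + (if i = m then t * f i else 0))"
      by (intro sum.cong) (auto simp: b_def algebra_simps)
    then show ?thesis using G by (simp add: sum.distrib sumF sum.delta)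
  qed
  have "(\<Sum>i\<in>G. \<Sum>j\<in>G. b i * b j * K i j) = (\<Sum>i\<in>G. b i * (\<Sum>j\<in>G. b j * K i j))"
    by (simp add: sum_distrib_left mult_ac)
  also have "\<dots> = (\<Sum>i\<in>F. a i * ((\<Sum>j\<in>F. a j * K i j) + t * K i m)) + t * ((\<Sum>j\<in>F. a j * K m j) + t * K m m)"
    by (simp only: sumb)
  also have "\<dots> = (\<Sum>i\<in>F. \<Sum>j\<in>F. a i * a j * K i j) + 2 * t * (\<Sum>i\<in>F. a i * K i m) + t\<^sup>2 * K m m"
  proof -
    have "(\<Sum>i\<in>F. a i * ((\<Sum>j\<in>F. a j * K i j) + t * K i m))
        = (\<Sum>i\<in>F. \<Sum>j\<in>F. a i * a j * K i j) + t * (\<Sum>i\<in>F. a i * K i m)"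
      by (simp add: distrib_left sum.distrib sum_distrib_left mult_ac)
    moreover have "(\<Sum>j\<in>F. a j * K m j) = (\<Sum>j\<in>F. a j * K j m)"
      by (intro sum.cong refl arg_cong2[where f = "(*)"] sym)
    ultimately show ?thesis by (simp only: power2_eq_square) (simp add: algebra_simps)
  qed
  finally show ?thesis
    using K[unfolded psd_kernel_def, THEN conjunct2, rule_format, OF G(1), of b] by (simp only:)
qed

text \<open>The quadratic form of the Schur complement is the minimum over \<open>t\<close> of the quadratic form of
  \<open>K\<close> at \<open>a + t e\<^sub>m\<close>.\<close>

lemma psd_schur_complement:
  assumes K: "psd_kernel K"
  shows "psd_kernel (schur_complement m K)"
  unfolding psd_kernel_def
proof (intro conjI allI impI)
  show "schur_complement m K i j = schur_complement m K j i" for i j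
    using K unfolding psd_kernel_def schur_complement_def by (simp add: mult.commute)
  fix F :: "nat set" and a :: "nat \<Rightarrow> real" assume F: "finite F"
  define Q where "Q = (\<Sum>i\<in>F. \<Sum>j\<in>F. a i * a j * K i j)"
  define S where "S = (\<Sum>i\<in>F. a i * K i m)"
  have eq: "(\<Sum>i\<in>F. \<Sum>j\<in>F. a i * a j * schur_complement m K i j) = Q - S * S / K m m"
  proof -
    have "(\<Sum>i\<in>F. \<Sum>j\<in>F. a i * a j * schur_complement m K i j)
        = (\<Sum>i\<in>F. \<Sum>j\<in>F. a i * a j * K i j - (a i * K i m) * (a j * K j m) / K m m)"
      by (simp add: schur_complement_def algebra_simps)
    also have "\<dots> = Q - (\<Sum>i\<in>F. \<Sum>j\<in>F. (a i * K i m) * (a j * K j m)) / K m m"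
      by (simp add: sum_subtractf sum_divide_distrib Q_def)
    also have "(\<Sum>i\<in>F. \<Sum>j\<in>F. (a i * K i m) * (a j * K j m)) = S * S"
      by (simp add: S_def sum_product)
    finally show ?thesis .
  qed
  have shift: "0 \<le> Q + 2 * t * S + t\<^sup>2 * K m m" for t
    unfolding Q_def S_def by (rule psd_kernel_shift[OF K F])
  show "0 \<le> (\<Sum>i\<in>F. \<Sum>j\<in>F. a i * a j * schur_complement m K i j)"
  proof (cases "K m m = 0")
    case True
    then show ?thesis using shift[of 0] eq by simp
  next
    case False
    then have "Q + 2 * (- S / K m m) * S + (- S / K m m)\<^sup>2 * K m m = Q - S * S / K m m"
      by (simp add: power2_eq_square)
    then show ?thesis using shift[of "- S / K m m"] eq by simp
  qed
qed

text \<open>Otherwise the quadratic form would be affine and nonconstant along \<open>e\<^sub>i + t e\<^sub>m\<close> and take negative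
  values.\<close>

lemma psd_kernel_zero_diag:
  assumes K: "psd_kernel K" and "K m m = 0"
  shows "K i m = 0"
proof (rule ccontr)
  assume nz: "K i m \<noteq> 0"
  have line: "0 \<le> K i i + 2 * t * K i m" for t
    using psd_kernel_shift[OF K, of "{i}" "\<lambda>_. 1" t m] assms(2) by simp
  define t where "t = - (K i i + 1) / (2 * K i m)"
  have "2 * t * K i m = - (K i i + 1)" using nz unfolding t_def by simp
  then show False using line[of t] by linarith
qed

text \<open>Eliminating the variables one after the other gives the Cholesky factorisation; the
  convention \<open>x / 0 = 0\<close> takes care of degenerate kernels.\<close>

lemma cholesky:
  assumes K: "psd_kernel K"
  obtains L :: "nat \<Rightarrow> nat \<Rightarrow> real"
  where "\<And>i m. i < m \<Longrightarrow> L i m = 0" "\<And>i j. K i j = (\<Sum>m\<le>i. L i m * L j m)"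
proof -
  define S where "S n = rec_nat K schur_complement n" for n
  have S0: "S 0 = K" and S_Suc: "S (Suc n) = schur_complement n (S n)" for n
    by (simp_all add: S_def)
  have psd: "psd_kernel (S n)" for n
    by (induction n) (simp_all add: S0 S_Suc K psd_schur_complement)
  have sym: "S n i j = S n j i" for n i j using psd[of n] unfolding psd_kernel_def by blast
  have zero: "S n i j = 0" if "i < n \<or> j < n" for n i j
    using that
  proof (induction n arbitrary: i j)
    case (Suc n)
    have col: "S (Suc n) k n = 0" for k
      using psd_kernel_zero_diag[OF psd[of n], of n k] by (simp add: S_Suc schur_complement_def)
    consider "i = n \<or> j = n" | "i < n" | "j < n" using Suc.prems by linarith
    then show ?case
    proof cases
      case 1
      then show ?thesis using col sym by metis
    next
      case 2
      then show ?thesis using Suc.IH by (simp add: S_Suc schur_complement_def)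
    next
      case 3
      then show ?thesis using Suc.IH by (simp add: S_Suc schur_complement_def)
    qed
  qed simp
  define L where "L i m = S m i m / sqrt (S m m m)" for i m
  have step: "S m i j = L i m * L j m + S (Suc m) i j" for m i j
    using psd_kernel_diag_nonneg[OF psd[of m], of m] by (simp add: L_def S_Suc schur_complement_def)
  have sum: "K i j = (\<Sum>m<n. L i m * L j m) + S n i j" for i j n
  proof (induction n)
    case (Suc n)
    then show ?case using step[of n i j] by simp
  qed (simp add: S0)
  have "K i j = (\<Sum>m\<le>i. L i m * L j m)" for i j
    using sum[of i j "Suc i"] zero[of i "Suc i" j] by (simp add: lessThan_Suc_atMost)
  moreover have "L i m = 0" if "i < m" for i m using zero[of i m m] that by (simp add: L_def)
  ultimately show thesis using that by blast
qed

definition iid_normals :: "(nat \<Rightarrow> real) measure" where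
  "iid_normals = PiM UNIV (\<lambda>_. std_normal_distribution)"

lemma prob_space_std_normal: "prob_space std_normal_distribution"
  using real_dist_normal_dist by (simp add: real_distribution_def)

lemma prob_space_iid_normals: "prob_space iid_normals"
  unfolding iid_normals_def by (rule prob_space_PiM) (rule prob_space_std_normal)

lemma space_iid_normals [simp]: "space iid_normals = UNIV"
  by (simp add: iid_normals_def space_PiM)

lemma iid_normals_coordinate_measurable [measurable]: "(\<lambda>\<omega>. \<omega> l) \<in> borel_measurable iid_normals"
proof -
  have "(\<lambda>\<omega>. \<omega> l) \<in> measurable iid_normals std_normal_distribution"
    unfolding iid_normals_def by (rule measurable_component_singleton) simp
  then show ?thesis by simp
qed

lemma distr_iid_normals_coordinate: "distr iid_normals borel (\<lambda>\<omega>. \<omega> l) = std_normal_distribution"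
proof -
  have "distr iid_normals std_normal_distribution (\<lambda>\<omega>. \<omega> l) = std_normal_distribution"
    unfolding iid_normals_def by (rule distr_PiM_component) (auto intro: prob_space_std_normal)
  moreover have "distr iid_normals std_normal_distribution (\<lambda>\<omega>. \<omega> l) = distr iid_normals borel (\<lambda>\<omega>. \<omega> l)"
    by (rule distr_cong) auto
  ultimately show ?thesis by simp
qed

lemma indep_iid_normals: "prob_space.indep_vars iid_normals (\<lambda>_. borel) (\<lambda>l \<omega>. \<omega> l) UNIV"
proof -
  interpret prob_space iid_normals by (rule prob_space_iid_normals)
  have b: "iid_normals = PiM UNIV (\<lambda>l. distr iid_normals borel (\<lambda>\<omega>. \<omega> l))"
    unfolding distr_iid_normals_coordinate by (simp add: iid_normals_def)
  have "distr iid_normals (PiM UNIV (\<lambda>_. borel)) (\<lambda>\<omega>. \<lambda>l\<in>UNIV. \<omega> l) = distr iid_normals iid_normals (\<lambda>\<omega>. \<omega>)"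
    unfolding iid_normals_def by (intro distr_cong refl sets_PiM_cong) auto
  also have "\<dots> = PiM UNIV (\<lambda>l. distr iid_normals borel (\<lambda>\<omega>. \<omega> l))"
    using b by (simp add: distr_id2)
  finally show ?thesis
    by (subst indep_vars_iff_distr_eq_PiM) auto
qed

lemma centered_normal_iid_sum:
  "centered_normal iid_normals (\<lambda>\<omega>. \<Sum>l<n. c l * \<omega> l) (\<Sum>l<n. (c l)\<^sup>2)"
  unfolding centered_normal_def
proof (intro conjI allI)
  interpret prob_space iid_normals by (rule prob_space_iid_normals)
  show meas: "(\<lambda>\<omega>. \<Sum>l<n. c l * \<omega> l) \<in> borel_measurable iid_normals" by measurable
  fix t
  have "indep_vars (\<lambda>_. borel) (\<lambda>l. (\<lambda>x. c l * x) \<circ> (\<lambda>\<omega>. \<omega> l)) {..<n}"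
    using indep_vars_subset[OF indep_iid_normals, of "{..<n}"] by (rule indep_vars_compose) auto
  then have "indep_vars (\<lambda>_. borel) (\<lambda>l \<omega>. c l * \<omega> l) {..<n}" by (simp add: o_def)
  from char_distr_sum[OF this]
  have "char (distr iid_normals borel (\<lambda>\<omega>. \<Sum>l<n. c l * \<omega> l)) t
      = (\<Prod>l<n. char (distr iid_normals borel (\<lambda>\<omega>. c l * \<omega> l)) t)" .
  also have "\<dots> = (\<Prod>l<n. char std_normal_distribution (t * c l))"
  proof (rule prod.cong)
    fix l
    have "char (distr iid_normals borel (\<lambda>\<omega>. c l * \<omega> l)) t = char (distr iid_normals borel (\<lambda>\<omega>. \<omega> l)) (t * c l)"
      by (simp add: char_def integral_distr mult_ac)
    then show "char (distr iid_normals borel (\<lambda>\<omega>. c l * \<omega> l)) t = char std_normal_distribution (t * c l)"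
      by (simp only: distr_iid_normals_coordinate)
  qed simp
  also have "\<dots> = of_real (exp (\<Sum>l<n. - ((t * c l)\<^sup>2) / 2))"
    by (simp add: char_std_normal_distribution exp_sum)
  also have "(\<Sum>l<n. - ((t * c l)\<^sup>2) / 2) = - (\<Sum>l<n. (c l)\<^sup>2) * t\<^sup>2 / 2"
  proof -
    have "(\<Sum>l<n. - ((t * c l)\<^sup>2) / 2) = (\<Sum>l<n. (c l)\<^sup>2 * (- t\<^sup>2 / 2))"
      by (intro sum.cong refl) (simp add: power_mult_distrib)
    then show ?thesis unfolding sum_distrib_right[symmetric] by simp
  qed
  finally show "(CLINT \<omega>|iid_normals. iexp (t * (\<Sum>l<n. c l * \<omega> l)))
      = of_real (exp (- (\<Sum>l<n. (c l)\<^sup>2) * t\<^sup>2 / 2))"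
    using meas by (simp only: char_def) (subst (asm) integral_distr; simp)
qed

text \<open>Since \<open>L\<close> is lower triangular, the sums may be extended to a common length, after which the
  quadratic form of the covariance is the sum of the squares of the coefficients.\<close>

lemma gaussian_on_iid_normals:
  fixes L :: "nat \<Rightarrow> nat \<Rightarrow> real" and \<iota> :: "'t \<Rightarrow> nat"
  assumes L: "\<And>i m. i < m \<Longrightarrow> L i m = 0"
  shows "gaussian_on T iid_normals (\<lambda>x \<omega>. \<Sum>l\<le>\<iota> x. L (\<iota> x) l * \<omega> l) (\<lambda>x y. \<Sum>l\<le>\<iota> x. L (\<iota> x) l * L (\<iota> y) l)"
  unfolding gaussian_on_def
proof (intro conjI allI impI)
  show "prob_space iid_normals" by (rule prob_space_iid_normals)
  fix n :: nat and a :: "nat \<Rightarrow> real" and p :: "nat \<Rightarrow> 't"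
  define N where "N = Suc (Max (insert 0 ((\<iota> \<circ> p) ` {..<n})))"
  have N: "\<iota> (p i) < N" if "i < n" for i
    unfolding N_def using that by (intro le_imp_less_Suc Max_ge) auto
  have extend: "(\<Sum>l\<le>\<iota> (p i). L (\<iota> (p i)) l * f l) = (\<Sum>l<N. L (\<iota> (p i)) l * f l)" if "i < n" for i f
    using N[OF that] L by (intro sum.mono_neutral_left) auto
  define c where "c l = (\<Sum>i<n. a i * L (\<iota> (p i)) l)" for l
  have "(\<Sum>i<n. a i * (\<Sum>l\<le>\<iota> (p i). L (\<iota> (p i)) l * \<omega> l)) = (\<Sum>l<N. c l * \<omega> l)" for \<omega> :: "nat \<Rightarrow> real"
  proof -
    have "(\<Sum>i<n. a i * (\<Sum>l\<le>\<iota> (p i). L (\<iota> (p i)) l * \<omega> l)) = (\<Sum>i<n. \<Sum>l<N. a i * L (\<iota> (p i)) l * \<omega> l)"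
      by (intro sum.cong refl) (simp add: extend mult.assoc flip: sum_distrib_left)
    also have "\<dots> = (\<Sum>l<N. \<Sum>i<n. a i * L (\<iota> (p i)) l * \<omega> l)" by (rule sum.swap)
    finally show ?thesis by (simp add: c_def sum_distrib_right)
  qed
  moreover have "(\<Sum>i<n. \<Sum>j<n. a i * a j * (\<Sum>l\<le>\<iota> (p i). L (\<iota> (p i)) l * L (\<iota> (p j)) l)) = (\<Sum>l<N. (c l)\<^sup>2)"
  proof -
    have "(\<Sum>i<n. \<Sum>j<n. a i * a j * (\<Sum>l\<le>\<iota> (p i). L (\<iota> (p i)) l * L (\<iota> (p j)) l))
        = (\<Sum>i<n. \<Sum>j<n. \<Sum>l<N. (a i * L (\<iota> (p i)) l) * (a j * L (\<iota> (p j)) l))"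
      by (intro sum.cong) (simp_all add: extend sum_distrib_left mult_ac)
    also have "\<dots> = (\<Sum>l<N. \<Sum>i<n. \<Sum>j<n. (a i * L (\<iota> (p i)) l) * (a j * L (\<iota> (p j)) l))"
      by (simp only: sum.swap[of _ "{..<N}"])
    finally show ?thesis by (simp add: c_def power2_eq_square sum_product)
  qed
  ultimately show "centered_normal iid_normals (\<lambda>\<omega>. \<Sum>i<n. a i * (\<Sum>l\<le>\<iota> (p i). L (\<iota> (p i)) l * \<omega> l))
      (\<Sum>i<n. \<Sum>j<n. a i * a j * (\<Sum>l\<le>\<iota> (p i). L (\<iota> (p i)) l * L (\<iota> (p j)) l))"
    using centered_normal_iid_sum[where n = N and c = c] by simp
qed

text \<open>A product of countably many compact intervals is compact and metrisable, hence sequentially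
  compact. The lemma is meant for Cholesky factors, whose rows are bounded in terms of the diagonal of
  the kernel.\<close>

lemma bounded_sequence_of_arrays_subseq:
  fixes L :: "nat \<Rightarrow> nat \<Rightarrow> nat \<Rightarrow> real"
  assumes "\<And>n i m. \<bar>L n i m\<bar> \<le> b i"
  obtains r :: "nat \<Rightarrow> nat" and L' where "strict_mono r" "\<And>i m. (\<lambda>n. L (r n) i m) \<longlonglongrightarrow> L' i m"
proof -
  define S where "S = PiE (UNIV :: (nat \<times> nat) set) (\<lambda>p. {- b (fst p) .. b (fst p)})"
  have "compactin (product_topology (\<lambda>_. euclideanreal) (UNIV :: (nat \<times> nat) set)) S"
    unfolding S_def by (subst compactin_PiE) simp
  then have "compact S" by (simp add: euclidean_product_topology)
  moreover have "(\<lambda>p. L n (fst p) (snd p)) \<in> S" for n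
    using assms by (auto simp: S_def abs_le_iff minus_le_iff)
  ultimately obtain F r where r: "strict_mono r" and lim: "((\<lambda>n p. L n (fst p) (snd p)) \<circ> r) \<longlonglongrightarrow> F"
    using seq_compactE[OF compact_imp_seq_compact, of S "\<lambda>n p. L n (fst p) (snd p)"] by blast
  have "(\<lambda>n. L (r n) i m) \<longlonglongrightarrow> F (i, m)" for i m
  proof -
    have "continuous_on UNIV (\<lambda>x :: nat \<times> nat \<Rightarrow> real. x (i, m))" by (rule continuous_on_product_coordinates)
    from continuous_on_tendsto_compose[OF this lim] show ?thesis by (simp add: o_def)
  qed
  then show thesis using r by (intro that[of r "\<lambda>i m. F (i, m)"])
qed

section \<open>Convergence of laws\<close>

definition kernel_on_grid :: "('a::euclidean_space \<Rightarrow> 'a \<Rightarrow> real) \<Rightarrow> nat \<Rightarrow> nat \<Rightarrow> real" where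
  "kernel_on_grid K i j = K (from_nat_into dyadic_points i) (from_nat_into dyadic_points j)"

lemma from_nat_into_dyadic [simp]:
  "x \<in> dyadic_points \<Longrightarrow> from_nat_into dyadic_points (to_nat_on dyadic_points x) = (x :: 'a::euclidean_space)"
  by (rule from_nat_into_to_nat_on[OF countable_dyadic_points])

lemma psd_kernel_on_grid:
  assumes X: "gaussian_on UNIV M X K" and K: "lipschitz_kernel B K"
  shows "psd_kernel (kernel_on_grid K)"
  unfolding psd_kernel_def
proof (intro conjI allI impI)
  show "kernel_on_grid K i j = kernel_on_grid K j i" for i j
    unfolding kernel_on_grid_def by (rule lipschitz_kernelD(2)[OF K])
  fix F :: "nat set" and a :: "nat \<Rightarrow> real" assume F: "finite F"
  obtain q where q: "bij_betw q {0..<card F} F" using ex_bij_betw_nat_finite[OF F] by blast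
  have "0 \<le> (\<Sum>i<card F. \<Sum>j<card F. a (q i) * a (q j) * kernel_on_grid K (q i) (q j))"
    unfolding kernel_on_grid_def by (rule gaussian_on_PSD[OF X UNIV_I])
  also have "\<dots> = (\<Sum>i<card F. \<Sum>j\<in>F. a (q i) * a j * kernel_on_grid K (q i) j)"
    using sum.reindex_bij_betw[OF q, of "\<lambda>j. a (q i) * a j * kernel_on_grid K (q i) j" for i]
    by (simp add: lessThan_atLeast0)
  also have "\<dots> = (\<Sum>i\<in>F. \<Sum>j\<in>F. a i * a j * kernel_on_grid K i j)"
    using sum.reindex_bij_betw[OF q, of "\<lambda>i. \<Sum>j\<in>F. a i * a j * kernel_on_grid K i j"]
    by (simp add: lessThan_atLeast0)
  finally show "0 \<le> (\<Sum>i\<in>F. \<Sum>j\<in>F. a i * a j * kernel_on_grid K i j)" .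
qed

text \<open>The field on the dyadic points with Cholesky factor \<open>L\<close>: every value is a finite linear
  combination of the independent variables, so it depends continuously on \<open>L\<close>.\<close>

definition grid_field :: "(nat \<Rightarrow> nat \<Rightarrow> real) \<Rightarrow> 'a::euclidean_space \<Rightarrow> (nat \<Rightarrow> real) \<Rightarrow> real" where
  "grid_field L x \<omega> = (\<Sum>l\<le>to_nat_on dyadic_points x. L (to_nat_on dyadic_points x) l * \<omega> l)"

definition grid_factor :: "('a::euclidean_space \<Rightarrow> 'a \<Rightarrow> real) \<Rightarrow> (nat \<Rightarrow> nat \<Rightarrow> real) \<Rightarrow> bool" where
  "grid_factor K L \<longleftrightarrow> (\<forall>i m. i < m \<longrightarrow> L i m = 0) \<and>
     (\<forall>i j. kernel_on_grid K i j = (\<Sum>m\<le>i. L i m * L j m))"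

lemma gaussian_on_grid_field:
  assumes L: "grid_factor K L"
  shows "gaussian_on dyadic_points iid_normals (grid_field L) K"
proof -
  let ?\<iota> = "to_nat_on (dyadic_points :: 'a set)"
  have "gaussian_on dyadic_points iid_normals (grid_field L) (\<lambda>x y. \<Sum>l\<le>?\<iota> x. L (?\<iota> x) l * L (?\<iota> y) l)"
    unfolding grid_field_def using L by (intro gaussian_on_iid_normals) (simp add: grid_factor_def)
  moreover have "(\<Sum>l\<le>?\<iota> x. L (?\<iota> x) l * L (?\<iota> y) l) = K x y" if "x \<in> dyadic_points" "y \<in> dyadic_points" for x y
    using L that unfolding grid_factor_def kernel_on_grid_def by (metis from_nat_into_dyadic)
  ultimately show ?thesis unfolding gaussian_on_def by simp
qed

lemma grid_factor_entry_le:
  assumes "grid_factor K L"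
  shows "(L i m)\<^sup>2 \<le> kernel_on_grid K i i"
proof (cases "m \<le> i")
  case True
  have "(L i m)\<^sup>2 \<le> (\<Sum>k\<le>i. (L i k)\<^sup>2)" using True by (intro member_le_sum) auto
  then show ?thesis using assms by (simp add: grid_factor_def power2_eq_square)
next
  case False
  have "0 \<le> (\<Sum>k\<le>i. (L i k)\<^sup>2)" by (intro sum_nonneg) simp
  then show ?thesis using assms False by (simp add: grid_factor_def power2_eq_square)
qed

lemma grid_factor_limit:
  assumes L: "\<And>n. grid_factor (K n) (L n)" and lim: "\<And>i m. (\<lambda>n. L n i m) \<longlonglongrightarrow> L' i m"
    and K: "\<And>x y. (\<lambda>n. K n x y) \<longlonglongrightarrow> K' x y"
  shows "grid_factor K' L'"
  unfolding grid_factor_def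
proof (intro conjI allI impI)
  show "L' i m = 0" if "i < m" for i m
    using lim[of i m] L that by (simp add: grid_factor_def LIMSEQ_const_iff)
  fix i j
  have "(\<lambda>n. kernel_on_grid (K n) i j) \<longlonglongrightarrow> kernel_on_grid K' i j"
    unfolding kernel_on_grid_def by (rule K)
  moreover have "(\<lambda>n. \<Sum>m\<le>i. L n i m * L n j m) \<longlonglongrightarrow> (\<Sum>m\<le>i. L' i m * L' j m)"
    by (intro tendsto_sum tendsto_mult lim)
  moreover have "kernel_on_grid (K n) i j = (\<Sum>m\<le>i. L n i m * L n j m)" for n
    using L[of n] by (simp add: grid_factor_def)
  ultimately show "kernel_on_grid K' i j = (\<Sum>m\<le>i. L' i m * L' j m)"
    by (simp add: LIMSEQ_unique)
qed

lemma lipschitz_kernel_limit: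
  assumes "\<And>n. lipschitz_kernel B (K n)" "\<And>x y. (\<lambda>n. K n x y) \<longlonglongrightarrow> K' x y"
  shows "lipschitz_kernel B K'"
  unfolding lipschitz_kernel_def
proof (intro conjI allI)
  show "B \<ge> 0" by (rule lipschitz_kernelD(1)[OF assms(1)])
  show "K' x y = K' y x" for x y
    using assms(2)[of x y] assms(2)[of y x] lipschitz_kernelD(2)[OF assms(1), of _ x y]
    by (simp add: LIMSEQ_unique)
  show "\<bar>K' x y - K' x' y\<bar> \<le> B * norm (x - x')" for x x' y
    by (rule tendsto_upperbound[OF tendsto_rabs[OF tendsto_diff[OF assms(2) assms(2)]]])
      (auto intro!: always_eventually lipschitz_kernelD(3)[OF assms(1)])
qed

text \<open>Tightness enters here: outside an event of small probability, which can be chosen for each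
  \<open>n\<close> with the same bound, the fields are close to their values at finitely many grid points, and there
  the convergence is pointwise.\<close>

lemma seminorm_diff_tendsto_zero:
  fixes Y :: "nat \<Rightarrow> 'a::euclidean_space \<Rightarrow> 'w \<Rightarrow> real"
  assumes M: "prob_space M" and A: "A \<ge> 0"
    and Y: "\<And>n. increment_bound A M (Y n)" and Y': "increment_bound A M Y'"
    and meas: "\<And>n x. Y n x \<in> borel_measurable M" "\<And>x. Y' x \<in> borel_measurable M"
    and cont: "\<And>n \<omega>. continuous_on UNIV (\<lambda>x. Y n x \<omega>)" "\<And>\<omega>. continuous_on UNIV (\<lambda>x. Y' x \<omega>)"
    and lim: "\<And>x. x \<in> dyadic_points \<Longrightarrow> AE \<omega> in M. (\<lambda>n. Y n x \<omega>) \<longlonglongrightarrow> Y' x \<omega>"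
  shows "(\<lambda>n. LINT \<omega>|M. min 1 (ball_seminorm k (\<lambda>x. Y n x \<omega> - Y' x \<omega>))) \<longlonglongrightarrow> 0"
proof (rule LIMSEQ_I)
  interpret prob_space M by fact
  fix r :: real assume r: "r > 0"
  define \<theta> where "\<theta> = root (2 * Suc DIM('a)) (2 / 3)"
  have \<theta>: "0 < \<theta>" "\<theta> < 1" "\<theta> ^ (2 * Suc DIM('a)) = 2 / 3"
    unfolding \<theta>_def by (simp_all add: real_root_lt_1_iff del: mult_Suc_right power_Suc)
  obtain N where N: "cball (0 :: 'a) (real k) \<subseteq> cube N" using exists_cube_superset .
  define C where "C = (9 * real (Suc N)) ^ DIM('a) * A * real DIM('a) ^ Suc DIM('a)"
  define \<delta> where "\<delta> m = 3 * \<theta> ^ m / (1 - \<theta>)" for m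
  have "(\<lambda>m. 2 * (4 * C * (3 / 4) ^ m) + 2 * \<delta> m) \<longlonglongrightarrow> 2 * (4 * C * 0) + 2 * 0"
    unfolding \<delta>_def by (intro tendsto_intros geometric_modulus_tendsto[OF \<theta>(1,2)] LIMSEQ_realpow_zero) auto
  then have "\<forall>\<^sub>F m in sequentially. 2 * (4 * C * (3 / 4) ^ m) + 2 * \<delta> m < r / 2"
    using r by (intro order_tendstoD(2)) auto
  then obtain m where m: "2 * (4 * C * (3 / 4) ^ m) + 2 * \<delta> m < r / 2"
    by (auto simp: eventually_sequentially)
  have \<delta>0: "\<delta> m \<ge> 0" using \<theta> by (simp add: \<delta>_def)
  define bad where "bad Z Bad \<longleftrightarrow> Bad \<in> sets M \<and> measure M Bad \<le> 4 * C * (3 / 4) ^ m \<and>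
      (\<forall>\<omega>\<in>space M - Bad. dyadic_regular \<theta> (Suc N) m (\<lambda>x. Z x \<omega>))" for Z :: "'a \<Rightarrow> 'w \<Rightarrow> real" and Bad
  have ex_bad: "\<exists>Bad. bad Z Bad" if "increment_bound A M Z" for Z
  proof (rule prob_not_dyadic_regular[OF M that A zero_less_Suc[of N] \<theta>, of m], rule exI)
    fix Bad assume "Bad \<in> sets M" "\<And>\<omega>. \<omega> \<in> space M \<Longrightarrow> \<omega> \<notin> Bad \<Longrightarrow> dyadic_regular \<theta> (Suc N) m (\<lambda>x. Z x \<omega>)"
      and "measure M Bad \<le> 4 * ((9 * real (Suc N)) ^ DIM('a) * A * real DIM('a) ^ Suc DIM('a)) * (3 / 4) ^ m"
    then show "bad Z Bad" by (simp only: bad_def C_def) simp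
  qed
  obtain Bad where Bad: "\<And>n. bad (Y n) (Bad n)" using ex_bad[OF Y] by metis
  obtain Bad' where Bad': "bad Y' Bad'" using ex_bad[OF Y'] by metis
  have badD: "Bad \<in> sets M" "measure M Bad \<le> 4 * C * (3 / 4) ^ m"
    "\<omega> \<in> space M \<Longrightarrow> \<omega> \<notin> Bad \<Longrightarrow> dyadic_regular \<theta> (Suc N) m (\<lambda>x. Z x \<omega>)" if "bad Z Bad" for Z Bad \<omega>
    using that by (auto simp: bad_def)
  define G where "G = (dyadic_floor m ` cube N :: 'a set)"
  have G: "finite G" "G \<subseteq> dyadic_points" unfolding G_def by (rule finite_dyadic_floor_cube) auto
  define S where "S n \<omega> = (\<Sum>x\<in>G. \<bar>Y n x \<omega> - Y' x \<omega>\<bar>)" for n \<omega>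
  have [measurable]: "S n \<in> borel_measurable M" for n
    unfolding S_def using meas by measurable
  have S0: "S n \<omega> \<ge> 0" for n \<omega> by (simp add: S_def sum_nonneg)
  have Sint: "integrable M (\<lambda>\<omega>. min 1 (S n \<omega>))" for n
    using S0 by (intro integrable_const_bound[where B = 1] AE_I2) (auto simp: abs_of_nonneg)
  have "(\<lambda>n. LINT \<omega>|M. min 1 (S n \<omega>)) \<longlonglongrightarrow> (LINT \<omega>|M. 0)"
  proof (rule integral_dominated_convergence[where w = "\<lambda>_. 1"])
    have "AE \<omega> in M. \<forall>x\<in>G. (\<lambda>n. Y n x \<omega>) \<longlonglongrightarrow> Y' x \<omega>"
      using G lim by (intro AE_finite_allI) auto
    then show "AE \<omega> in M. (\<lambda>n. min 1 (S n \<omega>)) \<longlonglongrightarrow> 0"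
    proof eventually_elim
      case (elim \<omega>)
      have "(\<lambda>n. S n \<omega>) \<longlonglongrightarrow> (\<Sum>x\<in>G. \<bar>Y' x \<omega> - Y' x \<omega>\<bar>)"
        unfolding S_def using elim by (intro tendsto_sum tendsto_rabs tendsto_diff tendsto_const) auto
      then have "(\<lambda>n. min 1 (S n \<omega>)) \<longlonglongrightarrow> min 1 0"
        by (intro tendsto_min tendsto_const) simp
      then show ?case by simp
    qed
    show "AE \<omega> in M. norm (min 1 (S n \<omega>)) \<le> 1" for n
      by (intro AE_I2) (auto simp: S_def sum_nonneg)
  qed auto
  then have "\<forall>\<^sub>F n in sequentially. (LINT \<omega>|M. min 1 (S n \<omega>)) < r / 2"
    using r by (intro order_tendstoD(2)) auto
  then obtain n0 where n0: "\<And>n. n \<ge> n0 \<Longrightarrow> (LINT \<omega>|M. min 1 (S n \<omega>)) < r / 2"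
    by (auto simp: eventually_sequentially)
  define f where "f n \<omega> = min 1 (ball_seminorm k (\<lambda>x. Y n x \<omega> - Y' x \<omega>))" for n \<omega>
  have contd: "continuous_on UNIV (\<lambda>x. Y n x \<omega> - Y' x \<omega>)" for n \<omega>
    by (intro continuous_on_diff cont)
  have f0: "f n \<omega> \<ge> 0" for n \<omega> unfolding f_def using ball_seminorm_nonneg[OF contd] by simp
  have fmeas [measurable]: "f n \<in> borel_measurable M" for n
  proof -
    have "(\<lambda>\<omega> x. Y n x \<omega> - Y' x \<omega>) \<in> measurable M (borel_of_topology C_topology)"
      using meas contd by (intro measurable_into_C_topology) auto
    from measurable_compose[OF this ball_seminorm_measurable[of k]] show ?thesis
      unfolding f_def by measurable
  qed
  have fint: "integrable M (f n)" for n
    using f0 by (intro integrable_const_bound[where B = 1]) (auto simp: f_def)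
  show "\<exists>no. \<forall>n\<ge>no. norm ((LINT \<omega>|M. min 1 (ball_seminorm k (\<lambda>x. Y n x \<omega> - Y' x \<omega>))) - 0) < r"
  proof (intro exI allI impI)
    fix n assume n: "n \<ge> n0"
    note Bn = badD[OF Bad[of n]] and B' = badD[OF Bad']
    have ind: "integrable M (indicator (Bad n) :: 'w \<Rightarrow> real)" "integrable M (indicator Bad' :: 'w \<Rightarrow> real)"
      using Bn(1) B'(1) by (simp_all add: less_top[symmetric])
    have le: "f n \<omega> \<le> indicator (Bad n) \<omega> + indicator Bad' \<omega> + 2 * \<delta> m + min 1 (S n \<omega>)" if \<omega>: "\<omega> \<in> space M" for \<omega>
    proof (cases "\<omega> \<in> Bad n \<or> \<omega> \<in> Bad'")
      case True
      then have "1 \<le> indicator (Bad n) \<omega> + (indicator Bad' \<omega> :: real)" by (auto simp: indicator_def)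
      moreover have "f n \<omega> \<le> 1" by (simp add: f_def)
      moreover have "0 \<le> min 1 (S n \<omega>)" by (simp add: S_def sum_nonneg)
      ultimately show ?thesis using \<delta>0 by linarith
    next
      case False
      have "ball_seminorm k (\<lambda>x. Y n x \<omega> - Y' x \<omega>) \<le> 2 * \<delta> m + S n \<omega>"
      proof (rule ball_seminorm_least)
        fix x :: 'a assume "norm x \<le> real k"
        then have x: "x \<in> cube N" using N by auto
        let ?x = "dyadic_floor m x"
        have "\<bar>Y n x \<omega> - Y n ?x \<omega>\<bar> \<le> \<delta> m" unfolding \<delta>_def
          by (rule dyadic_regular_floor_approx[OF Bn(3)[OF \<omega>] cont(1) x]) (use False in simp)
        moreover have "\<bar>Y' x \<omega> - Y' ?x \<omega>\<bar> \<le> \<delta> m" unfolding \<delta>_def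
          by (rule dyadic_regular_floor_approx[OF B'(3)[OF \<omega>] cont(2) x]) (use False in simp)
        moreover have "\<bar>Y n ?x \<omega> - Y' ?x \<omega>\<bar> \<le> S n \<omega>"
          unfolding S_def by (rule member_le_sum[where f = "\<lambda>x. \<bar>Y n x \<omega> - Y' x \<omega>\<bar>"]) (use x G in \<open>auto simp: G_def\<close>)
        ultimately show "\<bar>Y n x \<omega> - Y' x \<omega>\<bar> \<le> 2 * \<delta> m + S n \<omega>" by linarith
      qed
      then have "f n \<omega> \<le> 2 * \<delta> m + min 1 (S n \<omega>)" using \<delta>0 by (simp add: f_def min_def split: if_splits)
      then show ?thesis using False by simp
    qed
    have "(LINT \<omega>|M. f n \<omega>) \<le> (LINT \<omega>|M. indicator (Bad n) \<omega> + indicator Bad' \<omega> + 2 * \<delta> m + min 1 (S n \<omega>))"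
      by (rule integral_mono[OF fint _ le])
        (intro Bochner_Integration.integrable_add integrable_const ind Sint)
    also have "\<dots> = measure M (Bad n) + measure M Bad' + 2 * \<delta> m + (LINT \<omega>|M. min 1 (S n \<omega>))"
    proof -
      have sp: "Bad n \<inter> space M = Bad n" "Bad' \<inter> space M = Bad'"
        using sets.sets_into_space[OF Bn(1)] sets.sets_into_space[OF B'(1)] by auto
      show ?thesis using ind Sint by (simp add: prob_space sp)
    qed
    also have "\<dots> < r" using Bn(2) B'(2) m n0[OF n] by linarith
    finally have "(LINT \<omega>|M. f n \<omega>) < r" .
    moreover have "0 \<le> (LINT \<omega>|M. f n \<omega>)" using f0 by simp
    ultimately show "norm ((LINT \<omega>|M. min 1 (ball_seminorm k (\<lambda>x. Y n x \<omega> - Y' x \<omega>))) - 0) < r"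
      by (simp add: f_def)
  qed
qed

text \<open>A diagonal choice: at the index \<open>q k\<close> the \<open>k\<close>-th seminorm has truncated expectation below
  \<open>(1 / 2) ^ k\<close>. As the seminorms increase with \<open>k\<close>, the convergence of this one sequence controls all
  of them.\<close>

lemma seminorms_AE_subseq:
  fixes D :: "nat \<Rightarrow> 'w \<Rightarrow> 'a::euclidean_space \<Rightarrow> real"
  assumes M: "prob_space M" and D: "\<And>n. D n \<in> measurable M (borel_of_topology C_topology)"
    and lim: "\<And>k. (\<lambda>n. LINT \<omega>|M. min 1 (ball_seminorm k (D n \<omega>))) \<longlonglongrightarrow> 0"
  obtains r :: "nat \<Rightarrow> nat" where "strict_mono r"
    "AE \<omega> in M. \<forall>k. (\<lambda>n. ball_seminorm k (D (r n) \<omega>)) \<longlonglongrightarrow> 0"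
proof -
  interpret prob_space M by fact
  have cont: "continuous_on UNIV (D n \<omega>)" if "\<omega> \<in> space M" for n \<omega>
    using measurable_space[OF D that] by (simp add: topspace_C_topology)
  define f where "f k n \<omega> = min 1 (ball_seminorm k (D n \<omega>))" for k n \<omega>
  have [measurable]: "f k n \<in> borel_measurable M" for k n
    using measurable_compose[OF D ball_seminorm_measurable[of k], of n] unfolding f_def by measurable
  have f0: "f k n \<omega> \<ge> 0" if "\<omega> \<in> space M" for k n \<omega>
    unfolding f_def using ball_seminorm_nonneg[OF cont[OF that]] by simp
  have fint: "integrable M (f k n)" for k n
  proof (rule integrable_const_bound[where B = 1, OF AE_I2])
    show "norm (f k n \<omega>) \<le> 1" if "\<omega> \<in> space M" for \<omega>
      using f0[OF that, of k n] by (simp add: f_def)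
  qed measurable
  define P where "P k p n \<longleftrightarrow> p < n \<and> (LINT \<omega>|M. f k n \<omega>) < (1 / 2) ^ k" for k p n
  have "\<exists>n. P k p n" for k p
  proof -
    have "\<forall>\<^sub>F n in sequentially. (LINT \<omega>|M. f k n \<omega>) < (1 / 2) ^ k"
      using lim[of k] unfolding f_def by (intro order_tendstoD(2)) auto
    then have "\<forall>\<^sub>F n in sequentially. (LINT \<omega>|M. f k n \<omega>) < (1 / 2) ^ k \<and> n > p"
      using eventually_gt_at_top[of p] by eventually_elim auto
    then show ?thesis unfolding P_def by (auto simp: eventually_sequentially)
  qed
  then obtain g where "\<And>k p. P k p (g k p)" by metis
  then have g: "p < g k p" "(LINT \<omega>|M. f k (g k p) \<omega>) < (1 / 2) ^ k" for k p
    unfolding P_def by blast+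
  define q where "q = rec_nat (g 0 0) (\<lambda>k p. g (Suc k) p)"
  have "strict_mono q" unfolding strict_mono_Suc_iff by (simp add: q_def g(1))
  have small: "(LINT \<omega>|M. f k (q k) \<omega>) < (1 / 2) ^ k" for k
    by (cases k) (simp_all add: q_def g(2) del: power_Suc, (use g(2)[of 0 0] in simp))
  have "(\<lambda>k. LINT \<omega>|M. norm (f k (q k) \<omega>)) \<longlonglongrightarrow> 0"
  proof (rule Lim_null_comparison)
    have "(LINT \<omega>|M. norm (f k (q k) \<omega>)) = (LINT \<omega>|M. f k (q k) \<omega>)" for k
      by (intro Bochner_Integration.integral_cong) (auto simp: abs_of_nonneg[OF f0])
    moreover have "0 \<le> (LINT \<omega>|M. f k (q k) \<omega>)" for k using f0 by (intro integral_nonneg_AE AE_I2)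
    ultimately show "\<forall>\<^sub>F k in sequentially. norm (LINT \<omega>|M. norm (f k (q k) \<omega>)) \<le> (1 / 2) ^ k"
      using small by (intro always_eventually) (simp add: less_imp_le)
    show "(\<lambda>k. (1 / 2 :: real) ^ k) \<longlonglongrightarrow> 0" by (rule LIMSEQ_realpow_zero) auto
  qed
  then obtain u :: "nat \<Rightarrow> nat" where u: "strict_mono u" and ae: "AE \<omega> in M. (\<lambda>k. f (u k) (q (u k)) \<omega>) \<longlonglongrightarrow> 0"
    using tendsto_L1_AE_subseq[of M "\<lambda>k. f k (q k)"] fint by auto
  show thesis
  proof (rule that)
    show "strict_mono (q \<circ> u)" using \<open>strict_mono q\<close> u by (rule strict_mono_o)
    from ae AE_space show "AE \<omega> in M. \<forall>k. (\<lambda>n. ball_seminorm k (D ((q \<circ> u) n) \<omega>)) \<longlonglongrightarrow> 0"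
    proof eventually_elim
      case (elim \<omega>)
      show ?case
      proof
        fix k
        have ev: "\<forall>\<^sub>F n in sequentially. norm (ball_seminorm k (D ((q \<circ> u) n) \<omega>)) \<le> f (u n) (q (u n)) \<omega>"
          using order_tendstoD(2)[OF elim(1), of 1, simplified] eventually_ge_at_top[of k]
        proof eventually_elim
          case (elim n)
          note c = cont[OF \<open>\<omega> \<in> space M\<close>, of "q (u n)"]
          have "k \<le> u n" using elim(2) seq_suble[OF u, of n] by simp
          then have "ball_seminorm k (D (q (u n)) \<omega>) \<le> ball_seminorm (u n) (D (q (u n)) \<omega>)"
            by (rule ball_seminorm_mono[OF c])
          then show ?case using elim(1) ball_seminorm_nonneg[OF c, of k] by (simp add: f_def)
        qed
        show "(\<lambda>n. ball_seminorm k (D ((q \<circ> u) n) \<omega>)) \<longlonglongrightarrow> 0"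
          by (rule Lim_null_comparison[OF ev elim(1)])
      qed
    qed
  qed
qed

lemma LIMSEQ_if_subseqs_have_convergent_subseq:
  fixes a :: "nat \<Rightarrow> 'a::metric_space"
  assumes "\<And>s :: nat \<Rightarrow> nat. strict_mono s \<Longrightarrow> \<exists>r. strict_mono r \<and> (\<lambda>n. a (s (r n))) \<longlonglongrightarrow> l"
  shows "a \<longlonglongrightarrow> l"
proof (rule ccontr)
  assume "\<not> a \<longlonglongrightarrow> l"
  then obtain e where e: "e > 0" and inf: "\<And>N. \<exists>n\<ge>N. \<not> dist (a n) l < e"
    unfolding lim_sequentially by blast
  have "infinite {n. \<not> dist (a n) l < e}"
    unfolding infinite_nat_iff_unbounded_le using inf by auto
  then obtain s :: "nat \<Rightarrow> nat" where s: "strict_mono s" "\<And>n. s n \<in> {n. \<not> dist (a n) l < e}"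
    using infinite_enumerate by blast
  obtain r where "(\<lambda>n. a (s (r n))) \<longlonglongrightarrow> l" using assms[OF s(1)] by blast
  then obtain n where "dist (a (s (r n))) l < e"
    using e unfolding lim_sequentially by blast
  with s(2)[of "r n"] show False by simp
qed

text \<open>On one probability space, the field with covariance \<open>K n\<close> is realised through its Cholesky
  factor on the dyadic points. Along a subsequence the factors converge, and along a further one
  the fields converge almost surely, uniformly on compact sets. By uniqueness of the laws this concerns
  any fields with these covariances. The limit field also provides the law with covariance \<open>K'\<close>.\<close>

lemma gaussian_laws_convergent_subseq:
  fixes K :: "nat \<Rightarrow> 'a::euclidean_space \<Rightarrow> 'a \<Rightarrow> real"
  assumes X: "\<And>n. gaussian_on UNIV (M n) (X n) (K n)" and lip: "\<And>n. lipschitz_kernel B (K n)"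
    and lim: "\<And>x y. (\<lambda>n. K n x y) \<longlonglongrightarrow> K' x y"
  obtains r :: "nat \<Rightarrow> nat" and \<mu> where "strict_mono r"
    "gaussian_on UNIV \<mu> (\<lambda>x f. f x) K'" "sets \<mu> = sets (borel_of_topology C_topology)"
    "\<And>\<nu> \<phi>. (\<And>n. gaussian_on UNIV (\<nu> n) (\<lambda>x f. f x) (K n)) \<Longrightarrow>
       (\<And>n. sets (\<nu> n) = sets (borel_of_topology C_topology)) \<Longrightarrow>
       continuous_map C_topology euclideanreal \<phi> \<Longrightarrow> bounded (\<phi> ` topspace C_topology) \<Longrightarrow>
       (\<lambda>n. integral\<^sup>L (\<nu> (r n)) \<phi>) \<longlonglongrightarrow> integral\<^sup>L \<mu> \<phi>"
proof -
  let ?\<Omega> = iid_normals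
  have prob: "prob_space ?\<Omega>" by (rule prob_space_iid_normals)
  interpret prob_space ?\<Omega> by (rule prob)
  have lip': "lipschitz_kernel B K'" by (rule lipschitz_kernel_limit[OF lip lim])
  have "\<exists>L. grid_factor (K n) L" for n
  proof -
    obtain L :: "nat \<Rightarrow> nat \<Rightarrow> real" where "\<And>i m. i < m \<Longrightarrow> L i m = 0"
      "\<And>i j. kernel_on_grid (K n) i j = (\<Sum>m\<le>i. L i m * L j m)"
      using cholesky[OF psd_kernel_on_grid[OF X lip]] by blast
    then show ?thesis unfolding grid_factor_def by blast
  qed
  then obtain L where L: "\<And>n. grid_factor (K n) (L n)" by metis
  have "\<exists>b. \<forall>n. kernel_on_grid (K n) i i \<le> b" for i
  proof -
    have "convergent (\<lambda>n. kernel_on_grid (K n) i i)"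
      unfolding kernel_on_grid_def convergent_def using lim by blast
    then have "Bseq (\<lambda>n. kernel_on_grid (K n) i i)" by (rule convergent_imp_Bseq)
    then obtain b where "\<And>n. norm (kernel_on_grid (K n) i i) \<le> b" by (rule BseqE) blast
    then show ?thesis by (intro exI[of _ b] allI) (metis abs_le_D1 real_norm_def)
  qed
  then obtain b where b: "\<And>i n. kernel_on_grid (K n) i i \<le> b i" by metis
  have "\<bar>L n i m\<bar> \<le> sqrt (b i)" for n i m
    using order_trans[OF grid_factor_entry_le[OF L] b] by (rule real_le_rsqrt[of "\<bar>_\<bar>", simplified])
  then obtain u :: "nat \<Rightarrow> nat" and L' where u: "strict_mono u"
    and Llim: "\<And>i m. (\<lambda>n. L (u n) i m) \<longlonglongrightarrow> L' i m"
    using bounded_sequence_of_arrays_subseq[of L "\<lambda>i. sqrt (b i)"] by blast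
  have Klim: "(\<lambda>n. K (u n) x y) \<longlonglongrightarrow> K' x y" for x y
    using LIMSEQ_subseq_LIMSEQ[OF lim u] by (simp add: o_def)
  have L': "grid_factor K' L'" by (rule grid_factor_limit[OF L Llim Klim])
  define version where "version L K Y \<longleftrightarrow> (\<forall>x. Y x \<in> borel_measurable ?\<Omega>) \<and>
      (\<forall>\<omega>. continuous_on UNIV (\<lambda>x. Y x \<omega>)) \<and>
      (\<forall>x\<in>dyadic_points. AE \<omega> in ?\<Omega>. Y x \<omega> = grid_field L x \<omega>) \<and> gaussian_on UNIV ?\<Omega> Y K"
    for L and K :: "'a \<Rightarrow> 'a \<Rightarrow> real" and Y
  have ex_version: "\<exists>Y. version L K Y" if "grid_factor K L" "lipschitz_kernel B K" for L K
    by (rule gaussian_continuous_version_dyadic[OF gaussian_on_grid_field[OF that(1)] that(2)])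
      (unfold version_def, blast)
  obtain Y where Y: "\<And>n. version (L n) (K n) (Y n)" using ex_version[OF L lip] by metis
  obtain Y' where Y': "version L' K' Y'" using ex_version[OF L' lip'] by blast
  have versionD: "Y x \<in> borel_measurable ?\<Omega>" "continuous_on UNIV (\<lambda>x. Y x \<omega>)"
    "x \<in> dyadic_points \<Longrightarrow> AE \<omega> in ?\<Omega>. Y x \<omega> = grid_field L x \<omega>" "gaussian_on UNIV ?\<Omega> Y K"
    if "version L K Y" for L K Y x \<omega>
    using that unfolding version_def by blast+
  define A where "A = (2 * B) ^ Suc DIM('a) * (LINT x|std_normal_distribution. x ^ (2 * Suc DIM('a)))"
  have A: "A \<ge> 0" unfolding A_def using lipschitz_kernelD(1)[OF lip']
    by (intro mult_nonneg_nonneg zero_le_power std_normal_even_moment_nonneg) simp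
  have inc: "increment_bound A ?\<Omega> Y" if "version L K Y" "lipschitz_kernel B K" for L K Y
    unfolding A_def
    by (rule gaussian_on_increment_bound[OF gaussian_on_subset[OF versionD(4)[OF that(1)] subset_UNIV] that(2)])
  have pointwise: "AE \<omega> in ?\<Omega>. (\<lambda>n. Y (u n) x \<omega>) \<longlonglongrightarrow> Y' x \<omega>" if x: "x \<in> dyadic_points" for x
  proof -
    have "AE \<omega> in ?\<Omega>. \<forall>n. Y n x \<omega> = grid_field (L n) x \<omega>"
      using versionD(3)[OF Y x] by (simp add: AE_all_countable)
    with versionD(3)[OF Y' x] show ?thesis
    proof eventually_elim
      case (elim \<omega>)
      have "(\<lambda>n. grid_field (L (u n)) x \<omega>) \<longlonglongrightarrow> grid_field L' x \<omega>"
        unfolding grid_field_def by (intro tendsto_sum tendsto_mult tendsto_const Llim)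
      then show ?case using elim by simp
    qed
  qed
  define D where "D n \<omega> x = Y (u n) x \<omega> - Y' x \<omega>" for n \<omega> x
  have D: "D n \<in> measurable ?\<Omega> (borel_of_topology C_topology)" for n
    unfolding D_def by (intro measurable_into_C_topology borel_measurable_diff continuous_on_diff
        versionD(1,2)[OF Y] versionD(1,2)[OF Y'])
  have "(\<lambda>n. LINT \<omega>|?\<Omega>. min 1 (ball_seminorm k (D n \<omega>))) \<longlonglongrightarrow> 0" for k
    unfolding D_def
    by (rule seminorm_diff_tendsto_zero[OF prob A inc[OF Y lip] inc[OF Y' lip']
        versionD(1)[OF Y] versionD(1)[OF Y'] versionD(2)[OF Y] versionD(2)[OF Y'] pointwise])
  then obtain q :: "nat \<Rightarrow> nat" where q: "strict_mono q"
    and ae: "AE \<omega> in ?\<Omega>. \<forall>k. (\<lambda>n. ball_seminorm k (D (q n) \<omega>)) \<longlonglongrightarrow> 0"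
    by (rule seminorms_AE_subseq[OF prob D])
  define law where "law Y = field_distribution ?\<Omega> Y" for Y :: "'a \<Rightarrow> (nat \<Rightarrow> real) \<Rightarrow> real"
  have law: "gaussian_on UNIV (law Y) (\<lambda>x f. f x) K" if "version L K Y" for L K Y
    unfolding law_def by (rule gaussian_on_field_distribution[OF versionD(4)[OF that] versionD(2)[OF that]])
  show thesis
  proof (rule that)
    show "strict_mono (u \<circ> q)" using u q by (rule strict_mono_o)
    show "gaussian_on UNIV (law Y') (\<lambda>x f. f x) K'" by (rule law[OF Y'])
    show "sets (law Y') = sets (borel_of_topology C_topology)" by (simp add: law_def)
    fix \<nu> and \<phi> :: "('a \<Rightarrow> real) \<Rightarrow> real"
    assume \<nu>: "\<And>n. gaussian_on UNIV (\<nu> n) (\<lambda>x f. f x) (K n)"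
        "\<And>n. sets (\<nu> n) = sets (borel_of_topology C_topology)"
      and \<phi>: "continuous_map C_topology euclideanreal \<phi>" "bounded (\<phi> ` topspace C_topology)"
    have \<nu>_law: "\<nu> n = law (Y n)" for n
      by (rule gaussian_law_unique[OF \<nu> law[OF Y]]) (simp add: law_def)
    note \<phi>_meas = borel_measurable_continuous_map[OF \<phi>(1)]
    obtain c where c: "\<And>f. continuous_on UNIV f \<Longrightarrow> norm (\<phi> f) \<le> c"
      using \<phi>(2) unfolding bounded_iff topspace_C_topology by auto
    have field_meas: "(\<lambda>\<omega> x. Z x \<omega>) \<in> measurable ?\<Omega> (borel_of_topology C_topology)"
      if "version L K Z" for L K Z
      by (rule field_distribution_measurable[OF versionD(1,2)[OF that]])
    have int_law: "integral\<^sup>L (law Z) \<phi> = (LINT \<omega>|?\<Omega>. \<phi> (\<lambda>x. Z x \<omega>))" if "version L K Z" for L K Z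
      unfolding law_def field_distribution_def by (rule integral_distr[OF field_meas[OF that] \<phi>_meas])
    have "(\<lambda>n. LINT \<omega>|?\<Omega>. \<phi> (\<lambda>x. Y (u (q n)) x \<omega>)) \<longlonglongrightarrow> (LINT \<omega>|?\<Omega>. \<phi> (\<lambda>x. Y' x \<omega>))"
    proof (rule integral_dominated_convergence[where w = "\<lambda>_. c"])
      show "(\<lambda>\<omega>. \<phi> (\<lambda>x. Y' x \<omega>)) \<in> borel_measurable ?\<Omega>"
        by (rule measurable_compose[OF field_meas[OF Y'] \<phi>_meas])
      show "(\<lambda>\<omega>. \<phi> (\<lambda>x. Y (u (q n)) x \<omega>)) \<in> borel_measurable ?\<Omega>" for n
        by (rule measurable_compose[OF field_meas[OF Y] \<phi>_meas])
      show "AE \<omega> in ?\<Omega>. (\<lambda>n. \<phi> (\<lambda>x. Y (u (q n)) x \<omega>)) \<longlonglongrightarrow> \<phi> (\<lambda>x. Y' x \<omega>)"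
        using ae
      proof eventually_elim
        case (elim \<omega>)
        show ?case
          by (rule C_topology_convergent_imp[OF \<phi>(1) versionD(2)[OF Y'] versionD(2)[OF Y]])
            (use elim in \<open>simp only: D_def[symmetric]\<close>)
      qed
      show "AE \<omega> in ?\<Omega>. norm (\<phi> (\<lambda>x. Y (u (q n)) x \<omega>)) \<le> c" for n
        by (intro AE_I2 c versionD(2)[OF Y])
    qed simp
    then show "(\<lambda>n. integral\<^sup>L (\<nu> ((u \<circ> q) n)) \<phi>) \<longlonglongrightarrow> integral\<^sup>L (law Y') \<phi>"
      by (simp add: \<nu>_law int_law[OF Y] int_law[OF Y'])
  qed
qed

lemma centered_gaussian_law_iff:
  assumes "lipschitz_kernel B K"
  shows "centered_gaussian_law \<mu> K \<longleftrightarrow>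
    sets \<mu> = sets (borel_of_topology C_topology) \<and> gaussian_on UNIV \<mu> (\<lambda>x f. f x) K"
proof -
  have "K x y = K y x" for x y by (rule lipschitz_kernelD(2)[OF assms])
  then show ?thesis
    unfolding centered_gaussian_law_def
    using centered_gaussian_field_imp_gaussian_on[of \<mu> "\<lambda>x f. f x" K]
      gaussian_on_imp_centered_gaussian_field[of \<mu> "\<lambda>x f. f x" K] by blast
qed

text \<open>Every subsequence of the laws has a further subsequence converging to the law with covariance
  \<open>K'\<close>, and this limit does not depend on the subsequence.\<close>

lemma gaussian_fields_weakly_converge:
  fixes K :: "nat \<Rightarrow> 'a::euclidean_space \<Rightarrow> 'a \<Rightarrow> real"
  assumes X: "\<And>n. gaussian_on UNIV (M n) (X n) (K n)" and lip: "\<And>n. lipschitz_kernel B (K n)"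
    and lim: "\<And>x y. (\<lambda>n. K n x y) \<longlonglongrightarrow> K' x y"
  shows "\<exists>!\<mu>. centered_gaussian_law \<mu> K'"
    and "\<And>Y \<mu>. (\<And>n. continuous_version (M n) (X n) (Y n)) \<Longrightarrow> centered_gaussian_law \<mu> K' \<Longrightarrow>
       weakly_converges C_topology (\<lambda>n. field_distribution (M n) (Y n)) \<mu>"
proof -
  note law_iff = centered_gaussian_law_iff[OF lipschitz_kernel_limit[OF lip lim]]
  have unique: "\<mu> = \<nu>" if "centered_gaussian_law \<mu> K'" "centered_gaussian_law \<nu> K'" for \<mu> \<nu>
    using gaussian_law_unique that unfolding law_iff by blast
  have "\<exists>\<mu>. centered_gaussian_law \<mu> K'"
    by (rule gaussian_laws_convergent_subseq[OF X lip lim]) (unfold law_iff, blast)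
  then show "\<exists>!\<mu>. centered_gaussian_law \<mu> K'" using unique by blast
  fix Y \<mu> assume Y: "\<And>n. continuous_version (M n) (X n) (Y n)" and \<mu>: "centered_gaussian_law \<mu> K'"
  define \<nu> where "\<nu> n = field_distribution (M n) (Y n)" for n
  have \<nu>: "gaussian_on UNIV (\<nu> n) (\<lambda>x f. f x) (K n)" for n
    unfolding \<nu>_def using Y[of n]
    by (intro gaussian_on_field_distribution continuous_version_gaussian_on[OF Y X]) (simp add: continuous_version_def)
  have sets: "sets (\<nu> n) = sets (borel_of_topology C_topology)" for n by (simp add: \<nu>_def)
  have "(\<lambda>n. integral\<^sup>L (\<nu> n) \<phi>) \<longlonglongrightarrow> integral\<^sup>L \<mu> \<phi>"
    if \<phi>: "continuous_map C_topology euclideanreal \<phi>" "bounded (\<phi> ` topspace C_topology)" for \<phi>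
  proof (rule LIMSEQ_if_subseqs_have_convergent_subseq)
    fix s :: "nat \<Rightarrow> nat" assume s: "strict_mono s"
    have "(\<lambda>n. K (s n) x y) \<longlonglongrightarrow> K' x y" for x y
      using LIMSEQ_subseq_LIMSEQ[OF lim s] by (simp add: o_def)
    from gaussian_laws_convergent_subseq[of "\<lambda>n. M (s n)" "\<lambda>n. X (s n)" "\<lambda>n. K (s n)", OF X lip this]
    obtain r :: "nat \<Rightarrow> nat" and \<mu>' where r: "strict_mono r"
      and \<mu>': "gaussian_on UNIV \<mu>' (\<lambda>x f. f x) K'" "sets \<mu>' = sets (borel_of_topology C_topology)"
      and conv: "\<And>\<nu> \<phi>. (\<And>n. gaussian_on UNIV (\<nu> n) (\<lambda>x f. f x) (K (s n))) \<Longrightarrow>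
         (\<And>n. sets (\<nu> n) = sets (borel_of_topology C_topology)) \<Longrightarrow>
         continuous_map C_topology euclideanreal \<phi> \<Longrightarrow> bounded (\<phi> ` topspace C_topology) \<Longrightarrow>
         (\<lambda>n. integral\<^sup>L (\<nu> (r n)) \<phi>) \<longlonglongrightarrow> integral\<^sup>L \<mu>' \<phi>"
      by blast
    have "\<mu>' = \<mu>" using unique \<mu> \<mu>' law_iff by blast
    then show "\<exists>r. strict_mono r \<and> (\<lambda>n. integral\<^sup>L (\<nu> (s (r n))) \<phi>) \<longlonglongrightarrow> integral\<^sup>L \<mu> \<phi>"
      using r conv[of "\<lambda>n. \<nu> (s n)" \<phi>, OF \<nu> sets \<phi>] by blast
  qed
  then show "weakly_converges C_topology (\<lambda>n. field_distribution (M n) (Y n)) \<mu>"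
    using gaussian_on_prob_space[OF \<nu>] sets \<mu>
    unfolding weakly_converges_def \<nu>_def[symmetric] law_iff by (auto intro: gaussian_on_prob_space)
qed

theorem theorem5p2:
  fixes M :: "nat \<Rightarrow> 'w measure"
    and X :: "nat \<Rightarrow> real ^ 'd \<Rightarrow> 'w \<Rightarrow> real"
    and Cn :: "nat \<Rightarrow> real ^ 'd \<Rightarrow> real"
    and Cn_hat :: "nat \<Rightarrow> real ^ 'd \<Rightarrow> complex"
    and C :: "real ^ 'd \<Rightarrow> real ^ 'd \<Rightarrow> real"
    and c s :: real
  assumes gaussian: "\<And>n. centered_gaussian_field (M n) (X n) (\<lambda>x y. Cn n (x - y))"
    and spectrum: "\<And>n. has_spectrum (Cn n) (Cn_hat n)"
    and c: "c > 0"
    and s: "s > (real CARD('d) + 1) / 2"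
    and bound: "\<And>n \<xi>. cmod (Cn_hat n \<xi>) \<le> c / (1 + norm \<xi> powr (2 * s))"
    and limit: "\<And>x y. (\<lambda>n. Cn n (x - y)) \<longlonglongrightarrow> C x y"
  shows "(\<forall>n. \<exists>Y. continuous_version (M n) (X n) Y) \<and>
    (\<exists>!\<mu>. centered_gaussian_law \<mu> C) \<and>
    (\<forall>Y \<mu>. (\<forall>n. continuous_version (M n) (X n) (Y n)) \<longrightarrow> centered_gaussian_law \<mu> C \<longrightarrow>
       weakly_converges C_topology (\<lambda>n. field_distribution (M n) (Y n)) \<mu>)"
proof -
  have "2 * s > real DIM(real ^ 'd) + 1" using s by simp
  then obtain B where B: "B \<ge> 0" "\<And>n h h'. \<bar>Cn n h - Cn n h'\<bar> \<le> B * norm (h - h')"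
    using spectral_decay_imp_uniform_Lipschitz[of Cn Cn_hat "2 * s" c, OF spectrum _ bound] by blast
  have lip: "lipschitz_kernel B (\<lambda>x y. Cn n (x - y))" for n
    unfolding lipschitz_kernel_def
  proof (intro conjI allI B(1))
    fix x y :: "real ^ 'd"
    have "Cn n (x - y) = covariance_function (M n) (X n) x y"
      using gaussian[of n] by (simp add: centered_gaussian_field_def)
    also have "\<dots> = covariance_function (M n) (X n) y x"
      unfolding covariance_function_def by (simp only: mult.commute)
    finally show "Cn n (x - y) = Cn n (y - x)"
      using gaussian[of n] by (simp add: centered_gaussian_field_def)
    show "\<bar>Cn n (x - y) - Cn n (x' - y)\<bar> \<le> B * norm (x - x')" for x'
      using B(2)[of n "x - y" "x' - y"] by simp
  qed
  note X = centered_gaussian_field_imp_gaussian_on[OF gaussian]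
  show ?thesis
  proof (intro conjI allI impI)
    show "\<exists>Y. continuous_version (M n) (X n) Y" for n
      by (rule gaussian_continuous_version[OF X lip])
    show "\<exists>!\<mu>. centered_gaussian_law \<mu> C"
      by (rule gaussian_fields_weakly_converge(1)[OF X lip limit])
    show "weakly_converges C_topology (\<lambda>n. field_distribution (M n) (Y n)) \<mu>"
      if "\<forall>n. continuous_version (M n) (X n) (Y n)" "centered_gaussian_law \<mu> C" for Y \<mu>
      by (rule gaussian_fields_weakly_converge(2)[OF X lip limit]) (use that in blast)+
  qed
qed

end
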